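(* Let $\varepsilon>0$ be fixed, let $p>2$ be a fixed prime, and let $\Phi:\mathbb{R}\rightarrow\mathbb{R}_{\ge 0}$ be a Schwartz class function. For $n\in\mathbb{N}$ set $q:=p^n$, and let $\alpha_1,\alpha_2,\alpha_3$ be integers coprime to $p$ which are allowed to vary with $n$, subject to $p>s_p(\alpha_1,\alpha_2,\alpha_3)$. Then, as $n\rightarrow\infty$, uniformly for $N\ge q^{11/18+\varepsilon}$, $$ \sum_{\substack{(x_1,x_2,x_3)\in\mathbb{Z}^3\\ (x_1x_2x_3,p)=1\\ \alpha_1x_1^2+\alpha_2x_2^2+\alpha_3x_3^2\equiv 0 \bmod q}}\Phi\left(\frac{x_1}{N}\right)\Phi\left(\frac{x_2}{N}\right)\Phi\left(\frac{x_3}{N}\right)\sim \hat{\Phi}(0)^3\cdot C_p(\alpha_1,\alpha_2,\alpha_3)\cdot\frac{N^3}{q}. $$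
   Context: For integers $\alpha_1,\alpha_2,\alpha_3$ coprime to $p$, define $$s_p(\alpha_1,\alpha_2,\alpha_3):=2+\left(\frac{-\alpha_1\alpha_2}{p}\right)+\left(\frac{-\alpha_1\alpha_3}{p}\right)+\left(\frac{-\alpha_2\alpha_3}{p}\right),$$ where $\left(\frac{\cdot}{p}\right)$ is the Legendre symbol, and $$C_p(\alpha_1,\alpha_2,\alpha_3):=\frac{(p-s_p(\alpha_1,\alpha_2,\alpha_3))(p-1)}{p^2}.$$ $\hat{\Phi}$ denotes the Fourier transform $\hat\Phi(y)=\int_{\mathbb{R}}\Phi(x)e^{-2\pi i xy}\,dx$. The asymptotic "$\sim$" means the ratio of the two sides tends to $1$ as $n\to\infty$, for arbitrary choices $\alpha_i=\alpha_i(n)$ and $N=N(n)\ge q^{11/18+\varepsilon}$ satisfying the hypotheses. *)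

theory Defs
  imports "HOL-Analysis.Analysis" "HOL-Number_Theory.Number_Theory" "HOL-Library.Landau_Symbols"
begin

definition schwartz :: "(real \<Rightarrow> real) \<Rightarrow> bool" where
  "schwartz f \<longleftrightarrow>
     (\<forall>m x. ((deriv ^^ m) f) differentiable (at x)) \<and>
     (\<forall>k m. bounded (range (\<lambda>x. \<bar>x\<bar> ^ k * \<bar>(deriv ^^ m) f x\<bar>)))"

definition fourier_transform :: "(real \<Rightarrow> real) \<Rightarrow> real \<Rightarrow> complex" where
  "fourier_transform f y =
     integral\<^sup>L lborel (\<lambda>x. complex_of_real (f x) * cis (- 2 * pi * x * y))"

definition s_p :: "int \<Rightarrow> int \<Rightarrow> int \<Rightarrow> int \<Rightarrow> int" where
  "s_p p a1 a2 a3 = 2 + Legendre (- a1 * a2) p + Legendre (- a1 * a3) p + Legendre (- a2 * a3) p"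

definition C_p :: "int \<Rightarrow> int \<Rightarrow> int \<Rightarrow> int \<Rightarrow> real" where
  "C_p p a1 a2 a3 = (real_of_int (p - s_p p a1 a2 a3) * real_of_int (p - 1)) / real_of_int (p ^ 2)"

end

theory Submission
  imports Defs "HOL-Probability.Sinc_Integral"
begin

text \<open>
  Put \<open>q = p ^ n\<close>. Finite Fourier analysis modulo \<open>q\<close> turns the weighted count into
  \<open>q ^ (-3)\<close> times the sum over frequencies \<open>m\<close> of \<open>E(m)\<close> times three sampled Fourier transforms
  of \<open>\<Phi>\<close>, where \<open>E(m)\<close> is the exponential sum over the zeros modulo \<open>q\<close>. The frequency \<open>0\<close> gives
  the main term, and iterated differences make every frequency beyond \<open>M = q powr (7/18)\<close> negligible.
  Translating by tangent vectors divisible by about \<open>sqrt q\<close> and dilating shows that \<open>E(m)\<close> is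
  bounded by about \<open>q powr (3/2)\<close> and vanishes unless \<open>m\<close> is, essentially modulo \<open>q\<close>, a zero of the
  dual form. So it suffices to have fewer than \<open>q powr (1/2 - \<delta>)\<close> zeros of the dual form with
  entries at most \<open>M\<close>, uniformly in the coefficients. Zeros that agree projectively modulo \<open>p ^ j\<close>
  have determinants divisible by \<open>p ^ (3 * j)\<close>; if \<open>p ^ j\<close> is large compared to \<open>M\<close>, they lie in a
  plane, and either this class contains at most one zero up to sign or the normal vector of the plane is
  itself a much smaller zero of the dual form modulo a high power of \<open>p\<close>. Counting the latter
  recursively improves an exponent \<open>b\<close> of \<open>M\<close> to \<open>2 * b / (b + 1)\<close>; two steps lead from the trivial
  exponent \<open>2\<close> to \<open>8 / 7\<close>, which is enough since \<open>7/18 * 8/7 = 4/9 < 1/2\<close>.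
\<close>

section \<open>Integer vectors in dimension three\<close>

text \<open>Since the coefficients move with \<open>n\<close>, the arithmetic of a fixed rational
  form gives nothing: the count of dual zeros may use only p-adic congruences and the size of the
  entries, with constants depending on \<open>p\<close> alone. The recursion for the exponent comes
  from a balance. With \<open>p ^ j\<close> about \<open>R powr c\<close> there are about
  \<open>R powr c\<close> classes, each either harmless or contained in a plane. The normals
  \<open>v\<close> of these planes have size at most \<open>V\<close>, about
  \<open>R powr (2 - c)\<close>, and the plane of \<open>v\<close> holds at most a constant times
  \<open>V / nrm v\<close> zeros. Counting normals with exponent \<open>b > 1\<close>, the planes
  contribute about \<open>V powr b\<close>, and equating \<open>c = (2 - c) * b\<close> gives the
  new exponent; in terms of \<open>1 - 1 / b\<close> one step is a halving. The cutoff
  \<open>M\<close> is forced by \<open>7/18 = 1 - 11/18\<close>: up to the factor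
  \<open>q powr \<epsilon>\<close> it is the effective length \<open>q / N\<close> of the dual sum.
  The relative error is then about \<open>M powr b\<close> over \<open>sqrt q\<close>, so
  \<open>b\<close> has to lie below \<open>9/7\<close>. One step only reaches \<open>4/3\<close>,
  which just misses this; hence two steps.\<close>

type_synonym ivec = "int \<times> int \<times> int"

fun dot :: "ivec \<Rightarrow> ivec \<Rightarrow> int" where
  "dot (x1, x2, x3) (y1, y2, y3) = x1 * y1 + x2 * y2 + x3 * y3"

fun cross :: "ivec \<Rightarrow> ivec \<Rightarrow> ivec" where
  "cross (x1, x2, x3) (y1, y2, y3) = (x2 * y3 - x3 * y2, x3 * y1 - x1 * y3, x1 * y2 - x2 * y1)"

fun scale :: "int \<Rightarrow> ivec \<Rightarrow> ivec" where
  "scale c (x1, x2, x3) = (c * x1, c * x2, c * x3)"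

fun nrm :: "ivec \<Rightarrow> int" where
  "nrm (x1, x2, x3) = max \<bar>x1\<bar> (max \<bar>x2\<bar> \<bar>x3\<bar>)"

fun dvdv :: "int \<Rightarrow> ivec \<Rightarrow> bool" where
  "dvdv d (x1, x2, x3) \<longleftrightarrow> d dvd x1 \<and> d dvd x2 \<and> d dvd x3"

fun bf :: "ivec \<Rightarrow> ivec \<Rightarrow> ivec \<Rightarrow> int" where
  "bf (a1, a2, a3) (x1, x2, x3) (y1, y2, y3) = a1 * x1 * y1 + a2 * x2 * y2 + a3 * x3 * y3"

fun qf :: "ivec \<Rightarrow> ivec \<Rightarrow> int" where
  "qf (a1, a2, a3) (x1, x2, x3) = a1 * x1\<^sup>2 + a2 * x2\<^sup>2 + a3 * x3\<^sup>2"

fun dual :: "ivec \<Rightarrow> ivec" where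
  "dual (a1, a2, a3) = (a2 * a3, a1 * a3, a1 * a2)"

fun unitv :: "int \<Rightarrow> ivec \<Rightarrow> bool" where
  "unitv p (a1, a2, a3) \<longleftrightarrow> coprime a1 p \<and> coprime a2 p \<and> coprime a3 p"

text \<open>Coprimality of the entries in Bezout form: the witness \<open>u\<close> serves as a
  coordinate functional that reads off \<open>c\<close> from a multiple
  \<open>scale c v\<close>.\<close>

definition prim :: "ivec \<Rightarrow> bool" where
  "prim v \<longleftrightarrow> (\<exists>u. dot u v = 1)"

abbreviation det3 :: "ivec \<Rightarrow> ivec \<Rightarrow> ivec \<Rightarrow> int" where
  "det3 x y z \<equiv> dot x (cross y z)"

text \<open>The Gram determinant of two vectors is the form induced on the exterior square, which
  the cross product identifies with the dual form. This is why normals of planes spanned by two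
  zeros are nearly zeros of the dual form.\<close>

lemma lagrange_identity: "qf a x * qf a y - (bf a x y)\<^sup>2 = qf (dual a) (cross x y)"
  by (cases a; cases x; cases y) (simp add: power2_eq_square algebra_simps)

text \<open>The Gram determinant of three vectors, i.e. the determinant of the form times the square
  of \<open>det3\<close>. It converts divisibility of the Gram entries into divisibility of
  \<open>det3\<close>.\<close>

lemma gram_identity:
  "(case a of (a1, a2, a3) \<Rightarrow> a1 * a2 * a3) * (det3 x y z)\<^sup>2 =
    qf a x * qf a y * qf a z + 2 * bf a x y * bf a x z * bf a y z
    - qf a x * (bf a y z)\<^sup>2 - qf a y * (bf a x z)\<^sup>2 - qf a z * (bf a x y)\<^sup>2"
  by (cases a; cases x; cases y; cases z) (simp add: power2_eq_square algebra_simps)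

lemma unitv_dual: "unitv p a \<Longrightarrow> unitv p (dual a)"
  by (cases a) simp

lemma qf_scale: "qf a (scale c x) = c\<^sup>2 * qf a x"
  by (cases a; cases x) (simp add: power_mult_distrib algebra_simps)

lemma dvdv_scale: "d dvd c \<Longrightarrow> dvdv d (scale c x)"
  by (cases x) simp

lemma dvdv_scale_prim:
  assumes "prim v" "dvdv d (scale c v)"
  shows "d dvd c"
proof -
  obtain u where u: "dot u v = 1" using assms(1) prim_def by blast
  obtain u1 u2 u3 where uv_u: "u = (u1, u2, u3)" by (cases u)
  obtain v1 v2 v3 where uv_v: "v = (v1, v2, v3)" by (cases v)
  note uv = uv_u uv_v
  have "d dvd u1 * (c * v1) + u2 * (c * v2) + u3 * (c * v3)"
    using assms(2) uv by simp
  also have "\<dots> = c * dot u v" using uv by (simp add: algebra_simps)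
  finally show ?thesis using u by simp
qed

text \<open>The factor is \<open>dot u w\<close> for a Bezout vector \<open>u\<close> of
  \<open>v\<close>. As the minors vanish, each coordinate of \<open>v\<close> times
  \<open>dot u w\<close> equals the same coordinate of \<open>w\<close> times
  \<open>dot u v = 1\<close>.\<close>

lemma parallel_prim:
  assumes "prim v" "cross v w = (0, 0, 0)"
  shows "\<exists>c. w = scale c v"
proof -
  obtain u where u: "dot u v = 1" using assms(1) prim_def by blast
  obtain u1 u2 u3 where uv_u: "u = (u1, u2, u3)" by (cases u)
  obtain v1 v2 v3 where uv_v: "v = (v1, v2, v3)" by (cases v)
  obtain w1 w2 w3 where uv_w: "w = (w1, w2, w3)" by (cases w)
  note uv = uv_u uv_v uv_w
  have e: "u1 * v1 + u2 * v2 + u3 * v3 = 1" using u uv by simp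
  have f: "v2 * w3 = v3 * w2" "v3 * w1 = v1 * w3" "v1 * w2 = v2 * w1" using assms(2) uv by auto
  have "(u1 * w1 + u2 * w2 + u3 * w3) * v1 = w1 * (u1 * v1) + u2 * (v1 * w2) + u3 * (v1 * w3)"
    by (simp add: algebra_simps)
  also have "\<dots> = w1 * (u1 * v1 + u2 * v2 + u3 * v3)"
    unfolding f(3) f(2)[symmetric] by (simp only: distrib_left mult.assoc mult.commute mult.left_commute)
  finally have 1: "(u1 * w1 + u2 * w2 + u3 * w3) * v1 = w1" using e by simp
  have "(u1 * w1 + u2 * w2 + u3 * w3) * v2 = u1 * (v2 * w1) + w2 * (u2 * v2) + u3 * (v2 * w3)"
    by (simp add: algebra_simps)
  also have "\<dots> = w2 * (u1 * v1 + u2 * v2 + u3 * v3)"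
    unfolding f(3)[symmetric] f(1) by (simp only: distrib_left mult.assoc mult.commute mult.left_commute)
  finally have 2: "(u1 * w1 + u2 * w2 + u3 * w3) * v2 = w2" using e by simp
  have "(u1 * w1 + u2 * w2 + u3 * w3) * v3 = u1 * (v3 * w1) + u2 * (v3 * w2) + w3 * (u3 * v3)"
    by (simp add: algebra_simps)
  also have "\<dots> = w3 * (u1 * v1 + u2 * v2 + u3 * v3)"
    unfolding f(2) f(1)[symmetric] by (simp only: distrib_left mult.assoc mult.commute mult.left_commute)
  finally have 3: "(u1 * w1 + u2 * w2 + u3 * w3) * v3 = w3" using e by simp
  from 1 2 3 have "w = scale (dot u w) v" using uv by simp
  thus ?thesis by blast
qed

lemma prim_nonzero: "prim v \<Longrightarrow> nrm v \<ge> 1"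
proof (rule ccontr)
  assume "prim v" "\<not> nrm v \<ge> 1"
  then obtain u where u: "dot u v = 1" "nrm v \<le> 0" using prim_def by auto
  obtain v1 v2 v3 where v_v: "v = (v1, v2, v3)" by (cases v)
  note v = v_v
  have "v = (0, 0, 0)" using u(2) v by auto
  thus False using u(1) by (cases u) simp
qed

lemma nrm_nonneg: "nrm v \<ge> 0" by (cases v) simp

lemma nrm_scale: "nrm (scale c v) = \<bar>c\<bar> * nrm v"
  by (cases v) (auto simp: abs_mult max_mult_distrib_left)

lemma nrm_cross: "nrm (cross x y) \<le> 2 * nrm x * nrm y"
proof -
  obtain x1 x2 x3 where xy_x: "x = (x1, x2, x3)" by (cases x)
  obtain y1 y2 y3 where xy_y: "y = (y1, y2, y3)" by (cases y)
  note xy = xy_x xy_y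
  have a: "\<bar>x1\<bar> \<le> nrm x" "\<bar>x2\<bar> \<le> nrm x" "\<bar>x3\<bar> \<le> nrm x"
    "\<bar>y1\<bar> \<le> nrm y" "\<bar>y2\<bar> \<le> nrm y" "\<bar>y3\<bar> \<le> nrm y" using xy by auto
  have *: "\<bar>s * t - s' * t'\<bar> \<le> 2 * nrm x * nrm y"
    if "\<bar>s\<bar> \<le> nrm x" "\<bar>t\<bar> \<le> nrm y" "\<bar>s'\<bar> \<le> nrm x" "\<bar>t'\<bar> \<le> nrm y" for s t s' t'
  proof -
    have "\<bar>s * t\<bar> \<le> nrm x * nrm y" "\<bar>s' * t'\<bar> \<le> nrm x * nrm y"
      unfolding abs_mult using that nrm_nonneg by (auto intro!: mult_mono)
    thus ?thesis by linarith
  qed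
  have "\<bar>x2 * y3 - x3 * y2\<bar> \<le> 2 * nrm x * nrm y" by (rule *) (fact a)+
  moreover have "\<bar>x3 * y1 - x1 * y3\<bar> \<le> 2 * nrm x * nrm y" by (rule *) (fact a)+
  moreover have "\<bar>x1 * y2 - x2 * y1\<bar> \<le> 2 * nrm x * nrm y" by (rule *) (fact a)+
  moreover have "nrm (cross x y) = max \<bar>x2 * y3 - x3 * y2\<bar> (max \<bar>x3 * y1 - x1 * y3\<bar> \<bar>x1 * y2 - x2 * y1\<bar>)"
    unfolding xy by simp
  ultimately show ?thesis by (simp only: max.bounded_iff simp_thms)
qed

lemma abs_dot: "\<bar>dot x y\<bar> \<le> 3 * nrm x * nrm y"
proof -
  obtain x1 x2 x3 where xy_x: "x = (x1, x2, x3)" by (cases x)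
  obtain y1 y2 y3 where xy_y: "y = (y1, y2, y3)" by (cases y)
  note xy = xy_x xy_y
  have a: "\<bar>x1\<bar> \<le> nrm x" "\<bar>x2\<bar> \<le> nrm x" "\<bar>x3\<bar> \<le> nrm x"
    "\<bar>y1\<bar> \<le> nrm y" "\<bar>y2\<bar> \<le> nrm y" "\<bar>y3\<bar> \<le> nrm y" using xy by auto
  have *: "\<bar>s * t\<bar> \<le> nrm x * nrm y"
    if "\<bar>s\<bar> \<le> nrm x" "\<bar>t\<bar> \<le> nrm y" for s t
      unfolding abs_mult using that nrm_nonneg by (auto intro!: mult_mono)
  have "\<bar>x1 * y1\<bar> \<le> nrm x * nrm y" "\<bar>x2 * y2\<bar> \<le> nrm x * nrm y" "\<bar>x3 * y3\<bar> \<le> nrm x * nrm y"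
    using * a by blast+
  moreover have "dot x y = x1 * y1 + x2 * y2 + x3 * y3" by (simp add: xy)
  ultimately show ?thesis by linarith
qed

lemma cross_prim_zero:
  assumes "prim x" "prim y" "cross x y = (0, 0, 0)"
  shows "y = x \<or> y = scale (-1) x"
proof -
  obtain c where c: "y = scale c x" using parallel_prim[OF assms(1,3)] by blast
  obtain u where u: "dot u y = 1" using assms(2) prim_def by blast
  have "dot u y = c * dot u x" using c by (cases u; cases x) (simp add: algebra_simps)
  hence "c = 1 \<or> c = -1" using u by (metis dvd_triv_left zdvd1_eq abs_eq_iff' abs_1)
  thus ?thesis using c by (cases x) auto
qed

lemma prim_factor:
  assumes "w \<noteq> (0, 0, 0)"
  shows "\<exists>g v. g \<ge> 1 \<and> prim v \<and> w = scale g v"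
proof -
  obtain w1 w2 w3 where w_w: "w = (w1, w2, w3)" by (cases w)
  note w = w_w
  define g where "g = gcd (gcd w1 w2) w3"
  have g: "g \<ge> 1" using assms w unfolding g_def
    by (metis Nat.One_nat_def gcd_eq_0_iff gcd_ge_0_int int_one_le_iff_zero_less order_le_less)
  obtain v1 v2 v3 where v: "w1 = g * v1" "w2 = g * v2" "w3 = g * v3"
    unfolding g_def by (meson dvd_def dvd_trans gcd_dvd1 gcd_dvd2)
  obtain r s where "r * w1 + s * w2 = gcd w1 w2" by (metis bezout_int)
  moreover obtain r' s' where "r' * gcd w1 w2 + s' * w3 = g" unfolding g_def by (metis bezout_int)
  ultimately have "r' * (r * w1 + s * w2) + s' * w3 = g" by simp
  hence "g * (r' * r * v1 + r' * s * v2 + s' * v3) = g * 1"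
    unfolding v by (simp add: algebra_simps)
  hence "r' * r * v1 + r' * s * v2 + s' * v3 = 1" using g by (subst (asm) mult_left_cancel) auto
  hence "prim (v1, v2, v3)" unfolding prim_def by (intro exI[of _ "(r' * r, r' * s, s')"]) simp
  thus ?thesis using g v w by (intro exI[of _ g] exI[of _ "(v1, v2, v3)"]) simp
qed

lemma prim_not_dvdv: "prime (p::int) \<Longrightarrow> prim v \<Longrightarrow> \<not> dvdv p v"
proof
  assume "prime p" "prim v" "dvdv p v"
  then obtain u where u: "dot u v = 1" using prim_def by auto
  have "p dvd dot u v" using \<open>dvdv p v\<close> by (cases u; cases v) auto
  thus False using u \<open>prime p\<close> not_prime_unit by auto
qed

lemma cross_orth:
  assumes "prim v" "dot x v = 0" "dot y v = 0"
  shows "\<exists>c. cross x y = scale c v"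
proof (rule parallel_prim[OF assms(1)])
  obtain x1 x2 x3 where xyv_x: "x = (x1, x2, x3)" by (cases x)
  obtain y1 y2 y3 where xyv_y: "y = (y1, y2, y3)" by (cases y)
  obtain v1 v2 v3 where xyv_v: "v = (v1, v2, v3)" by (cases v)
  note xyv = xyv_x xyv_y xyv_v
  have "cross v (cross x y) =
      (x1 * dot y v - y1 * dot x v, x2 * dot y v - y2 * dot x v, x3 * dot y v - y3 * dot x v)"
    unfolding xyv by (simp add: algebra_simps)
  thus "cross v (cross x y) = (0, 0, 0)" using assms by simp
qed

text \<open>Cramer's relation writes \<open>det3 m x y\<close> times \<open>u\<close> through
  \<open>m\<close>, \<open>x\<close>, \<open>y\<close>; pairing it with \<open>m\<close> under the
  form gives this identity. For coplanar \<open>m\<close>, \<open>x\<close>, \<open>y\<close> it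
  computes \<open>cross x y\<close> from the two coordinates \<open>bf a m\<close> and
  \<open>dot u (cross m _)\<close>.\<close>

lemma plane_identity:
  "qf a m * dot u (cross x y) - bf a m x * dot u (cross m y) + bf a m y * dot u (cross m x)
    = det3 m x y * bf a m u"
  by (cases a; cases m; cases x; cases y; cases u) (simp add: power2_eq_square algebra_simps)

lemma dot_scale: "dot u (scale c v) = c * dot u v"
  by (cases u; cases v) (simp add: algebra_simps)

lemma dot_commute: "dot u v = dot v u"
  by (cases u; cases v) (simp add: algebra_simps)

text \<open>Valuations of at most \<open>i - 1\<close> and \<open>j - 1\<close> would add up to less
  than \<open>n\<close>. Allowing \<open>Suc n\<close> covers \<open>i = 1\<close>,
  \<open>j = n\<close>, which is the cancellation of a unit.\<close>

lemma prime_pow_dvd_mult_cases: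
  assumes "prime (p::int)" "p ^ n dvd a * b" "i + j \<le> Suc n"
  shows "p ^ i dvd a \<or> p ^ j dvd b"
proof (cases "a = 0 \<or> b = 0")
  case False
  have n: "\<not> is_unit p" using assms(1) not_prime_unit by blast
  have "n \<le> multiplicity p (a * b)"
    using assms(2) False n by (subst (asm) power_dvd_iff_le_multiplicity) auto
  also have "\<dots> = multiplicity p a + multiplicity p b"
    using False assms(1) by (intro prime_elem_multiplicity_mult_distrib) auto
  finally have "i \<le> multiplicity p a \<or> j \<le> multiplicity p b" using assms(3) by linarith
  thus ?thesis using False n power_dvd_iff_le_multiplicity[of a p i]
      power_dvd_iff_le_multiplicity[of b p j] by blast
qed auto

lemma prime_pow_dvd_mult_unit:
  assumes "prime (p::int)" "p ^ n dvd a * b" "\<not> p dvd a"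
  shows "p ^ n dvd b"
  using prime_pow_dvd_mult_cases[OF assms(1,2), of 1 n] assms(3) by simp

lemma coprime_prime_iff: "prime (p::int) \<Longrightarrow> coprime a p \<longleftrightarrow> \<not> p dvd a"
  by (metis coprime_commute prime_imp_coprime coprime_absorb_left not_prime_unit)

lemma prime_not_dvd_2: "prime (p::int) \<Longrightarrow> p > 2 \<Longrightarrow> \<not> p dvd 2"
  by (auto dest: zdvd_imp_le)

section \<open>Ternary quadratic forms modulo prime powers\<close>

context
  fixes p :: int
  assumes p: "prime p" "p > 2"
begin

lemma not_dvd_2: "\<not> p dvd 2"
  using prime_not_dvd_2 p by blast

lemma p_pos: "p > 0" using p by simp

lemma pdvd_mult: "p dvd a * b \<longleftrightarrow> p dvd a \<or> p dvd b"
  using p(1) by (rule prime_dvd_mult_iff)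

lemma pdvd_sq: "p dvd a\<^sup>2 \<longleftrightarrow> p dvd a"
  by (simp add: power2_eq_square pdvd_mult)

lemma unitv_iff: "unitv p (a1, a2, a3) \<longleftrightarrow> \<not> p dvd a1 \<and> \<not> p dvd a2 \<and> \<not> p dvd a3"
  by (simp add: coprime_prime_iff p)

text \<open>The combination \<open>x1 * y - y1 * x\<close> has the entries 0 and the two given
  minors, so its form value is divisible by \<open>p ^ (2 * g)\<close>. Expanding that value leaves
  \<open>2 * x1 * y1\<close> times the bilinear form, up to multiples of the two form values.
  Projective agreement modulo \<open>p ^ g\<close> is thus worth twice as much for
  \<open>bf\<close>.\<close>

lemma bf_dvd_aux:
  assumes "p ^ n dvd qf (a1, a2, a3) (x1, x2, x3)" "p ^ n dvd qf (a1, a2, a3) (y1, y2, y3)"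
    and "p ^ g dvd x1 * y2 - x2 * y1" "p ^ g dvd x1 * y3 - x3 * y1"
    and "\<not> p dvd x1" "\<not> dvdv p (y1, y2, y3)"
  shows "p ^ min n (2 * g) dvd bf (a1, a2, a3) (x1, x2, x3) (y1, y2, y3)"
proof (cases "g = 0")
  case False
  hence pg: "p dvd p ^ g" by (simp add: dvd_power)
  define N where "N = min n (2 * g)"
  have "\<not> p dvd y1"
  proof
    assume y1: "p dvd y1"
    have "p dvd x1 * y2 - x2 * y1" "p dvd x1 * y3 - x3 * y1"
      using assms(3,4) pg dvd_trans by blast+
    hence "p dvd x1 * y2" "p dvd x1 * y3"
      using y1 by (simp_all add: dvd_diff_left_iff)
    thus False using assms(5,6) y1 by (simp add: pdvd_mult)
  qed
  hence nd: "\<not> p dvd 2 * x1 * y1" using assms(5) not_dvd_2 by (simp add: pdvd_mult)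
  obtain c d where cd: "x1 * y2 - x2 * y1 = p ^ g * c" "x1 * y3 - x3 * y1 = p ^ g * d"
    using assms(3,4) by (elim dvdE)
  have "2 * x1 * y1 * bf (a1, a2, a3) (x1, x2, x3) (y1, y2, y3) =
      x1\<^sup>2 * qf (a1, a2, a3) (y1, y2, y3) + y1\<^sup>2 * qf (a1, a2, a3) (x1, x2, x3)
      - (a2 * (x1 * y2 - x2 * y1)\<^sup>2 + a3 * (x1 * y3 - x3 * y1)\<^sup>2)"
    by (simp add: power2_eq_square algebra_simps)
  also have "a2 * (x1 * y2 - x2 * y1)\<^sup>2 + a3 * (x1 * y3 - x3 * y1)\<^sup>2 = p ^ (2 * g) * (a2 * c\<^sup>2 + a3 * d\<^sup>2)"
    unfolding cd by (simp add: power_mult_distrib power_mult power2_eq_square algebra_simps flip: power_add)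
  finally have e: "2 * x1 * y1 * bf (a1, a2, a3) (x1, x2, x3) (y1, y2, y3) =
      x1\<^sup>2 * qf (a1, a2, a3) (y1, y2, y3) + y1\<^sup>2 * qf (a1, a2, a3) (x1, x2, x3)
      - p ^ (2 * g) * (a2 * c\<^sup>2 + a3 * d\<^sup>2)" .
  have "p ^ N dvd p ^ n" "p ^ N dvd p ^ (2 * g)" unfolding N_def by (auto intro: le_imp_power_dvd)
  hence "p ^ N dvd qf (a1, a2, a3) (x1, x2, x3)" "p ^ N dvd qf (a1, a2, a3) (y1, y2, y3)"
    "p ^ N dvd p ^ (2 * g)" using assms(1,2) dvd_trans by blast+
  hence "p ^ N dvd 2 * x1 * y1 * bf (a1, a2, a3) (x1, x2, x3) (y1, y2, y3)"
    unfolding e by (meson dvd_add dvd_diff dvd_mult dvd_mult2)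
  thus ?thesis using prime_pow_dvd_mult_unit[OF p(1) _ nd] unfolding N_def by blast
qed auto

lemma bf_dvd:
  assumes "p ^ n dvd qf a x" "p ^ n dvd qf a y" "dvdv (p ^ g) (cross x y)" "\<not> dvdv p x" "\<not> dvdv p y"
  shows "p ^ min n (2 * g) dvd bf a x y"
proof -
  obtain a1 a2 a3 where a: "a = (a1, a2, a3)" by (cases a)
  obtain x1 x2 x3 where x: "x = (x1, x2, x3)" by (cases x)
  obtain y1 y2 y3 where y: "y = (y1, y2, y3)" by (cases y)
  have d: "p ^ g dvd x2 * y3 - x3 * y2" "p ^ g dvd x3 * y1 - x1 * y3" "p ^ g dvd x1 * y2 - x2 * y1"
    using assms(3) x y by auto
  have d': "p ^ g dvd x3 * y2 - x2 * y3" "p ^ g dvd x1 * y3 - x3 * y1" "p ^ g dvd x2 * y1 - x1 * y2"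
    using d by (metis dvd_minus_iff minus_diff_eq)+
  consider "\<not> p dvd x1" | "\<not> p dvd x2" | "\<not> p dvd x3" using assms(4) x by auto
  thus ?thesis
  proof cases
    case 1
    thus ?thesis unfolding a x y using bf_dvd_aux[of n a1 a2 a3 x1 x2 x3 y1 y2 y3 g] assms d d' a x y by simp
  next
    case 2
    have "p ^ min n (2 * g) dvd bf (a2, a1, a3) (x2, x1, x3) (y2, y1, y3)"
      by (rule bf_dvd_aux) (use 2 assms d d' a x y in \<open>auto simp: add_ac\<close>)
    thus ?thesis unfolding a x y by (simp add: add_ac)
  next
    case 3
    have "p ^ min n (2 * g) dvd bf (a3, a1, a2) (x3, x1, x2) (y3, y1, y2)"
      by (rule bf_dvd_aux) (use 3 assms d d' a x y in \<open>auto simp: add_ac\<close>)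
    thus ?thesis unfolding a x y by (simp add: add_ac)
  qed
qed

text \<open>All entries of the Gram matrix are divisible by \<open>p ^ (2 * g)\<close>, so its
  determinant is divisible by \<open>p ^ (6 * g)\<close>; taking the square root leaves
  \<open>3 * g\<close>.\<close>

lemma det_dvd:
  assumes a: "unitv p a" and n: "2 * g \<le> n"
    and q: "p ^ n dvd qf a x" "p ^ n dvd qf a y" "p ^ n dvd qf a z"
    and nd: "\<not> dvdv p x" "\<not> dvdv p y" "\<not> dvdv p z"
    and c: "dvdv (p ^ g) (cross x y)" "dvdv (p ^ g) (cross x z)" "dvdv (p ^ g) (cross y z)"
  shows "p ^ (3 * g) dvd det3 x y z"
proof -
  obtain a1 a2 a3 where a': "a = (a1, a2, a3)" by (cases a)
  define P where "P = p ^ (2 * g)"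
  have m: "min n (2 * g) = 2 * g" using n by simp
  have b: "P dvd bf a x y" "P dvd bf a x z" "P dvd bf a y z"
    unfolding P_def using bf_dvd[OF q(1,2) c(1)] bf_dvd[OF q(1,3) c(2)] bf_dvd[OF q(2,3) c(3)] nd m by auto
  have "P dvd p ^ n" unfolding P_def using n by (rule le_imp_power_dvd)
  hence q': "P dvd qf a x" "P dvd qf a y" "P dvd qf a z" using q dvd_trans by blast+
  have e: "p ^ (6 * g) = P * P * P" unfolding P_def by (simp flip: power_add)
  have "P * P * P dvd (a1 * a2 * a3) * (det3 x y z)\<^sup>2"
    using gram_identity[of a x y z] unfolding a' prod.case
    unfolding a'[symmetric] power2_eq_square mult.assoc[symmetric]
    using b q' by (simp only:) (intro dvd_add dvd_diff mult_dvd_mono dvd_mult2[of _ _ "_ * _"]; simp add: mult.assoc)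
  hence "p ^ (6 * g) dvd (a1 * a2 * a3) * (det3 x y z)\<^sup>2" using e by simp
  moreover have "\<not> p dvd a1 * a2 * a3" using a unfolding a' unitv_iff by (simp add: pdvd_mult)
  ultimately have "p ^ (6 * g) dvd (det3 x y z)\<^sup>2" using prime_pow_dvd_mult_unit[OF p(1)] by blast
  hence "(p ^ (3 * g))\<^sup>2 dvd (det3 x y z)\<^sup>2" by (simp flip: power_mult add: mult.commute)
  thus ?thesis by (simp add: pow_divides_pow_iff)
qed

text \<open>A form with unit coefficients cannot vanish modulo \<open>p\<close> on a whole plane.
  The test vectors are, up to sign, the cross products of \<open>v\<close> with the coordinate
  vectors; if all three values were divisible by \<open>p\<close>, a combination would isolate
  \<open>2 * a2 * a3 * v1\<^sup>2\<close>.\<close>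

lemma exists_unit_value_orth:
  assumes "unitv p a" "\<not> dvdv p v"
  shows "\<exists>m. dot m v = 0 \<and> \<not> p dvd qf a m"
proof (rule ccontr)
  assume *: "\<not> ?thesis"
  obtain a1 a2 a3 where a: "a = (a1, a2, a3)" by (cases a)
  obtain v1 v2 v3 where v: "v = (v1, v2, v3)" by (cases v)
  have u: "\<not> p dvd a1" "\<not> p dvd a2" "\<not> p dvd a3" using assms(1) unfolding a unitv_iff by auto
  have "p dvd qf a (v2, -v1, 0)" "p dvd qf a (v3, 0, -v1)" "p dvd qf a (0, v3, -v2)"
    using * v by (auto intro: ccontr)
  hence e: "p dvd a1 * v2\<^sup>2 + a2 * v1\<^sup>2" "p dvd a1 * v3\<^sup>2 + a3 * v1\<^sup>2" "p dvd a2 * v3\<^sup>2 + a3 * v2\<^sup>2"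
    using a by auto
  have "p dvd a3 * (a1 * v2\<^sup>2 + a2 * v1\<^sup>2) + a2 * (a1 * v3\<^sup>2 + a3 * v1\<^sup>2) - a1 * (a2 * v3\<^sup>2 + a3 * v2\<^sup>2)"
    by (rule dvd_diff[OF dvd_add[OF dvd_mult[OF e(1)] dvd_mult[OF e(2)]] dvd_mult[OF e(3)]])
  also have "\<dots> = 2 * a2 * a3 * v1\<^sup>2" by (simp add: algebra_simps)
  finally have 1: "p dvd v1" using u not_dvd_2 by (simp add: pdvd_mult pdvd_sq)
  have "p dvd a1 * v2\<^sup>2" using e(1) 1 by (simp add: dvd_add_left_iff power2_eq_square)
  hence 2: "p dvd v2" using u by (simp add: pdvd_mult pdvd_sq)
  have "p dvd a1 * v3\<^sup>2" using e(2) 1 by (simp add: dvd_add_left_iff power2_eq_square)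
  hence "p dvd v3" using u by (simp add: pdvd_mult pdvd_sq)
  thus False using 1 2 assms(2) v by simp
qed

text \<open>If \<open>p\<close> divided \<open>t\<close>, then \<open>x\<close> would be parallel to
  \<open>m\<close> modulo \<open>p\<close>, although the form is a unit at \<open>m\<close> and
  vanishes modulo \<open>p\<close> at \<open>x\<close>.\<close>

lemma orth_coord_unit:
  assumes m: "\<not> p dvd qf a m" and x: "\<not> dvdv p x" "p dvd qf a x" and c: "cross m x = scale t v"
  shows "\<not> p dvd t"
proof
  assume t: "p dvd t"
  obtain a1 a2 a3 where a: "a = (a1, a2, a3)" by (cases a)
  obtain x1 x2 x3 where x': "x = (x1, x2, x3)" by (cases x)
  obtain m1 m2 m3 where m': "m = (m1, m2, m3)" by (cases m)
  have "dvdv p (cross m x)" unfolding c using t by (rule dvdv_scale)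
  hence d: "p dvd m2 * x3 - m3 * x2" "p dvd m3 * x1 - m1 * x3" "p dvd m1 * x2 - m2 * x1"
    using m' x' by auto
  have "p dvd qf (dual a) (cross m x)"
    unfolding c qf_scale using t by (simp add: power2_eq_square)
  hence "p dvd qf a m * qf a x - (bf a m x)\<^sup>2" by (simp add: lagrange_identity)
  hence "p dvd (bf a m x)\<^sup>2" using x(2) by (metis dvd_diff_right_iff dvd_mult)
  hence b: "p dvd bf a m x" by (simp add: pdvd_sq)
  have "qf a m * x1 = bf a m x * m1 - (a2 * m2 * (m1 * x2 - m2 * x1) - a3 * m3 * (m3 * x1 - m1 * x3))"
    "qf a m * x2 = bf a m x * m2 - (a3 * m3 * (m2 * x3 - m3 * x2) - a1 * m1 * (m1 * x2 - m2 * x1))"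
    "qf a m * x3 = bf a m x * m3 - (a1 * m1 * (m3 * x1 - m1 * x3) - a2 * m2 * (m2 * x3 - m3 * x2))"
    unfolding a x' m' by (simp_all add: power2_eq_square algebra_simps)
  hence "p dvd qf a m * x1" "p dvd qf a m * x2" "p dvd qf a m * x3"
    using b d by (metis dvd_diff dvd_mult dvd_mult2)+
  thus False using m x x' by (simp add: pdvd_mult)
qed

text \<open>In the plane orthogonal to \<open>v\<close> the form is \<open>y\<^sup>2 + D t\<^sup>2\<close> up to a unit, so a zero modulo
  \<open>p ^ n\<close> has \<open>y / t\<close> equal to one of two opposite values modulo \<open>p ^ j\<close>.\<close>

lemma two_of_three_close:
  assumes a: "unitv p a" and v: "prim v" and n: "2 * j \<le> n" "n \<ge> 1"
    and o: "dot x v = 0" "dot y v = 0" "dot z v = 0"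
    and q: "p ^ n dvd qf a x" "p ^ n dvd qf a y" "p ^ n dvd qf a z"
    and nd: "\<not> dvdv p x" "\<not> dvdv p y" "\<not> dvdv p z"
  shows "dvdv (p ^ j) (cross x y) \<or> dvdv (p ^ j) (cross x z) \<or> dvdv (p ^ j) (cross y z)"
proof -
  obtain u where u: "dot u v = 1" using v prim_def by auto
  obtain m where m: "dot m v = 0" "\<not> p dvd qf a m"
    using exists_unit_value_orth[OF a prim_not_dvdv[OF p(1) v]] by blast
  define D where "D = qf (dual a) v"
  define t where "t w = dot u (cross m w)" for w
  define b where "b w = bf a m w" for w
  have ct: "cross m w = scale (t w) v" if h: "dot w v = 0" for w
  proof -
    obtain c where "cross m w = scale c v" using cross_orth[OF v m(1) h] by blast
    thus ?thesis unfolding t_def by (simp add: dot_scale u)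
  qed
  have pp: "p dvd p ^ n" using n by (simp add: dvd_power)
  have form: "p ^ n dvd (b w)\<^sup>2 + (t w)\<^sup>2 * D" if "dot w v = 0" "p ^ n dvd qf a w" for w
  proof -
    have "(b w)\<^sup>2 + (t w)\<^sup>2 * D = qf a m * qf a w"
      using lagrange_identity[of a m w] unfolding ct[OF that(1)] qf_scale D_def b_def by simp
    thus ?thesis using that(2) by simp
  qed
  have tu: "\<not> p dvd t w" if "dot w v = 0" "p ^ n dvd qf a w" "\<not> dvdv p w" for w
    using orth_coord_unit[OF m(2) that(3) _ ct[OF that(1)]] that(2) pp dvd_trans by blast
  have close: "dvdv (p ^ j) (cross w w')"
    if h: "dot w v = 0" "dot w' v = 0" "p ^ j dvd b w * t w' - b w' * t w" for w w'
  proof -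
    obtain c where c: "cross w w' = scale c v" using cross_orth[OF v h(1,2)] by blast
    have "det3 m w w' = 0" unfolding c by (simp add: dot_scale m)
    hence "qf a m * c = b w * t w' - b w' * t w"
      using plane_identity[of a m u w w'] unfolding c b_def t_def by (simp add: dot_scale u m)
    hence "p ^ j dvd c" using h(3) prime_pow_dvd_mult_unit[OF p(1) _ m(2)] by metis
    thus ?thesis unfolding c by (rule dvdv_scale)
  qed
  \<comment> \<open>Eliminating \<open>D\<close> from the two congruences leaves a difference of
    squares. As \<open>n \<ge> 2 * j\<close>, one factor is divisible by \<open>p ^ j\<close>, and
    \<open>close\<close> excludes the first.\<close>
  have opp: "p ^ j dvd b w * t w' + b w' * t w"
    if "dot w v = 0" "dot w' v = 0" "p ^ n dvd qf a w" "p ^ n dvd qf a w'" "\<not> dvdv (p ^ j) (cross w w')" for w w'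
  proof -
    have "p ^ n dvd (t w')\<^sup>2 * ((b w)\<^sup>2 + (t w)\<^sup>2 * D) - (t w)\<^sup>2 * ((b w')\<^sup>2 + (t w')\<^sup>2 * D)"
      using form that by (intro dvd_diff dvd_mult) auto
    also have "\<dots> = (b w * t w' - b w' * t w) * (b w * t w' + b w' * t w)"
      by (simp add: power2_eq_square algebra_simps)
    finally have "p ^ j dvd b w * t w' - b w' * t w \<or> p ^ j dvd b w * t w' + b w' * t w"
      by (rule prime_pow_dvd_mult_cases[OF p(1)]) (use n in simp)
    thus ?thesis using close[OF that(1,2)] that(5) by blast
  qed
  show ?thesis
  proof (rule ccontr)
    assume c: "\<not> ?thesis"
    \<comment> \<open>If \<open>y\<close> and \<open>z\<close> are both opposite to
      \<open>x\<close>, they agree with each other.\<close>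
    have "p ^ j dvd t z * (b x * t y + b y * t x) - t y * (b x * t z + b z * t x)"
      using opp[of x y] opp[of x z] o q c by (intro dvd_diff dvd_mult) auto
    also have "\<dots> = t x * (b y * t z - b z * t y)" by (simp add: algebra_simps)
    finally have "p ^ j dvd b y * t z - b z * t y"
      using prime_pow_dvd_mult_unit[OF p(1)] tu o q nd by blast
    thus False using close o c by blast
  qed
qed

end

section \<open>Zeros in a lattice plane\<close>

lemma finite_nrm_le: "finite {m. real_of_int (nrm m) \<le> R}"
proof (rule finite_subset)
  show "finite ({-\<lfloor>R\<rfloor>..\<lfloor>R\<rfloor>} \<times> {-\<lfloor>R\<rfloor>..\<lfloor>R\<rfloor>} \<times> {-\<lfloor>R\<rfloor>..\<lfloor>R\<rfloor>})" by simp
  show "{m. real_of_int (nrm m) \<le> R} \<subseteq> {-\<lfloor>R\<rfloor>..\<lfloor>R\<rfloor>} \<times> {-\<lfloor>R\<rfloor>..\<lfloor>R\<rfloor>} \<times> {-\<lfloor>R\<rfloor>..\<lfloor>R\<rfloor>}"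
  proof
    fix m assume "m \<in> {m. real_of_int (nrm m) \<le> R}"
    hence r: "nrm m \<le> \<lfloor>R\<rfloor>" by (simp add: le_floor_iff)
    obtain m1 m2 m3 where m: "m = (m1, m2, m3)" by (cases m)
    have "\<bar>m1\<bar> \<le> \<lfloor>R\<rfloor>" "\<bar>m2\<bar> \<le> \<lfloor>R\<rfloor>" "\<bar>m3\<bar> \<le> \<lfloor>R\<rfloor>" using r unfolding m by auto
    thus "m \<in> {-\<lfloor>R\<rfloor>..\<lfloor>R\<rfloor>} \<times> {-\<lfloor>R\<rfloor>..\<lfloor>R\<rfloor>} \<times> {-\<lfloor>R\<rfloor>..\<lfloor>R\<rfloor>}"
      unfolding m by (simp add: abs_le_iff)
  qed
qed

lemma cross_diff: "cross x (y - z) = cross x y - cross x z"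
  by (cases x; cases y; cases z) (simp add: algebra_simps)

lemma dot_diff: "dot x (y - z) = dot x y - dot x z"
  by (cases x; cases y; cases z) (simp add: algebra_simps)

lemma scale_zero: "scale 0 v = (0, 0, 0)" by (cases v) simp

lemma zero3: "(0 :: ivec) = (0, 0, 0)" by (simp add: zero_prod_def)

lemma max_coordinate:
  "\<exists>e. \<bar>dot e m0\<bar> = nrm m0 \<and> (\<forall>m. \<bar>dot e m\<bar> \<le> nrm m)"
proof -
  obtain a b c where m: "m0 = (a, b, c)" by (cases m0)
  have 1: "\<bar>dot (1,0,0) m\<bar> \<le> nrm m" for m by (cases m) simp
  have 2: "\<bar>dot (0,1,0) m\<bar> \<le> nrm m" for m by (cases m) simp
  have 3: "\<bar>dot (0,0,1) m\<bar> \<le> nrm m" for m by (cases m) simp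
  have "nrm m0 = \<bar>a\<bar> \<or> nrm m0 = \<bar>b\<bar> \<or> nrm m0 = \<bar>c\<bar>" unfolding m by (simp add: max_def)
  thus ?thesis
  proof (elim disjE)
    assume "nrm m0 = \<bar>a\<bar>" thus ?thesis using 1 m by (intro exI[of _ "(1,0,0)"]) auto
  next
    assume "nrm m0 = \<bar>b\<bar>" thus ?thesis using 2 m by (intro exI[of _ "(0,1,0)"]) auto
  next
    assume "nrm m0 = \<bar>c\<bar>" thus ?thesis using 3 m by (intro exI[of _ "(0,0,1)"]) auto
  qed
qed

lemma same_quotient:
  fixes x y s w w' :: int
  assumes "x div w = y div w" "x - y = s * w'" "\<bar>w'\<bar> = w" "w \<ge> 1"
  shows "s = 0"
proof (rule ccontr)
  assume "s \<noteq> 0"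
  have "x - y = x mod w - y mod w" using assms(1) by (metis add_diff_cancel_left div_mult_mod_eq)
  moreover have "x mod w \<ge> 0" "x mod w < w" "y mod w \<ge> 0" "y mod w < w" using assms(4) by auto
  ultimately have "\<bar>x - y\<bar> < w" by linarith
  moreover have "\<bar>x - y\<bar> \<ge> w"
    unfolding assms(2) abs_mult assms(3) using \<open>s \<noteq> 0\<close> assms(4) by (intro mult_le_cancel_right1[THEN iffD2]) auto
  ultimately show False by simp
qed

text \<open>The vectors of the lattice plane are determined by their position \<open>t\<close> off the line of \<open>m0\<close>
  and by the quotient of a coordinate by the corresponding coordinate of \<open>m0\<close>.\<close>

lemma card_plane_class:
  fixes P :: int and R :: real
  assumes m0: "prim m0" "dot m0 v = 0" "real_of_int (nrm m0) \<le> R" and v: "prim v" and P: "P \<ge> 1"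
    and S: "\<And>m. m \<in> S \<Longrightarrow> prim m \<and> real_of_int (nrm m) \<le> R \<and> dot m v = 0 \<and> dvdv P (cross m0 m)"
  shows "real (card S) \<le> 2 + 24 * R\<^sup>2 / (P * nrm v)"
\<comment> \<open>If everything lies on the line of \<open>m0\<close>, only \<open>m0\<close> and
  its negative remain. Otherwise some \<open>t\<close> is nonzero, so \<open>T \<ge> 1\<close>, and
  together with \<open>w \<le> r\<close> this absorbs the additive constants of the box count; 24 is
  \<open>3 * 2 * 4\<close>.\<close>
proof (cases "\<exists>m\<in>S. cross m0 m \<noteq> (0, 0, 0)")
  case False
  have "S \<subseteq> {m0, scale (-1) m0}"
    using False S cross_prim_zero[OF m0(1)] by blast
  hence "card S \<le> card {m0, scale (-1) m0}" by (intro card_mono) auto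
  also have "\<dots> \<le> 2" by (simp add: card_insert_if)
  finally have "real (card S) \<le> 2" by simp
  moreover have "24 * R\<^sup>2 / (P * nrm v) \<ge> 0" using P nrm_nonneg[of v] by simp
  ultimately show ?thesis by linarith
next
  case True
  then obtain m1 where m1: "m1 \<in> S" "cross m0 m1 \<noteq> (0, 0, 0)" by blast
  define w where "w = nrm m0"
  have w: "w \<ge> 1" unfolding w_def using m0(1) by (rule prim_nonzero)
  have v1: "nrm v \<ge> 1" using v by (rule prim_nonzero)
  obtain e where e: "\<bar>dot e m0\<bar> = w" "\<And>m. \<bar>dot e m\<bar> \<le> nrm m"
    using max_coordinate[of m0] unfolding w_def by blast
  have ex: "\<exists>t. cross m0 m = scale (P * t) v" if h: "m \<in> S" for m
  proof -
    obtain c where c: "cross m0 m = scale c v" using cross_orth[OF v m0(2)] S[OF h] by blast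
    have "P dvd c" using dvdv_scale_prim[OF v] S[OF h] c by metis
    thus ?thesis using c by (metis dvdE)
  qed
  then obtain t where t: "\<And>m. m \<in> S \<Longrightarrow> cross m0 m = scale (P * t m) v" by metis
  define T where "T = \<lfloor>2 * R * w / (P * nrm v)\<rfloor>"
  define r where "r = \<lfloor>R\<rfloor>"
  have pos: "real_of_int (P * nrm v) > 0" using P v1 by simp
  have tT: "\<bar>t m\<bar> \<le> T" if h: "m \<in> S" for m
  proof -
    have "\<bar>P * t m\<bar> * nrm v = nrm (cross m0 m)" using t[OF h] by (simp add: nrm_scale)
    also have "\<dots> \<le> 2 * w * nrm m" using nrm_cross[of m0 m] w_def by simp
    finally have "\<bar>t m\<bar> * (P * nrm v) \<le> 2 * w * nrm m" using P by (simp add: abs_mult mult_ac)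
    hence "real_of_int \<bar>t m\<bar> * real_of_int (P * nrm v) \<le> 2 * w * nrm m"
      by (metis of_int_le_iff of_int_mult of_int_numeral)
    also have "\<dots> = (2 * real_of_int w) * nrm m" by simp
    also have "\<dots> \<le> (2 * real_of_int w) * R" by (rule mult_left_mono) (use S[OF h] w in simp_all)
    finally show ?thesis unfolding T_def le_floor_iff using pos by (simp add: pos_le_divide_eq mult_ac)
  qed
  have T1: "T \<ge> 1"
  proof -
    have "t m1 \<noteq> 0" using m1 t[OF m1(1)] by (auto simp: scale_zero)
    thus ?thesis using tT[OF m1(1)] by linarith
  qed
  have wr: "w \<le> r" unfolding r_def w_def using m0(3) by (simp add: le_floor_iff)
  define f where "f m = (t m, dot e m div w)" for m
  have inj: "inj_on f S"
  proof (rule inj_onI)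
    fix m m' assume h: "m \<in> S" "m' \<in> S" "f m = f m'"
    have "cross m0 (m - m') = (0, 0, 0)"
      using t[OF h(1)] t[OF h(2)] h(3) by (simp add: cross_diff f_def flip: zero3)
    then obtain s where s: "m - m' = scale s m0" using parallel_prim[OF m0(1)] by blast
    have "dot e m - dot e m' = s * dot e m0" using s dot_diff[of e m m'] dot_scale[of e s m0] by simp
    hence "s = 0" using same_quotient[of "dot e m" w "dot e m'" s "dot e m0"] e(1) w h(3) f_def by auto
    thus "m = m'" using s by (metis scale_zero zero3 eq_iff_diff_eq_0)
  qed
  have "f ` S \<subseteq> {-T..T} \<times> {-(r div w) - 1..r div w}"
  proof (rule image_subsetI)
    fix m assume h: "m \<in> S"
    have "nrm m \<le> r" unfolding r_def using S[OF h] by (simp add: le_floor_iff)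
    hence d: "dot e m \<le> r" "- r \<le> dot e m" using e(2)[of m] by linarith+
    have "dot e m div w \<le> r div w" using d w by (intro zdiv_mono1) auto
    moreover have "(- r) div w \<le> dot e m div w" using d w by (intro zdiv_mono1) auto
    \<comment> \<open>Division rounds down, so a negative quotient may lie one further from 0; this
      is the extra 1 in the box.\<close>
    moreover have "- (r div w) - 1 \<le> (- r) div w" using w by (simp add: zdiv_zminus1_eq_if)
    ultimately show "f m \<in> {-T..T} \<times> {-(r div w) - 1..r div w}"
      using tT[OF h] unfolding f_def by (auto simp: abs_le_iff)
  qed
  hence "card S \<le> card ({-T..T} \<times> {-(r div w) - 1..r div w})"
    by (intro card_inj_on_le[OF inj]) auto
  also have "real \<dots> = (2 * T + 1) * (2 * (r div w) + 2)"
    using T1 pos_imp_zdiv_nonneg_iff[of w r] w wr by (simp add: card_cartesian_product)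
  finally have c: "real (card S) \<le> (2 * T + 1) * (2 * (r div w) + 2)" by simp
  have a: "real_of_int (2 * T + 1) \<le> 3 * (2 * R * w / (P * nrm v))"
  proof -
    have "real_of_int T \<le> 2 * R * w / (P * nrm v)" unfolding T_def by linarith
    moreover have "real_of_int T \<ge> 1" using T1 by simp
    ultimately show ?thesis by simp
  qed
  have b: "real_of_int (2 * (r div w) + 2) \<le> 4 * (R / w)"
  proof -
    have "r div w \<ge> 1" using wr w by (metis div_self less_le_not_le zdiv_mono1 zero_less_one order_trans not_le int_one_le_iff_zero_less)
    moreover have "real_of_int (r div w) \<le> R / w"
    proof -
      have "real_of_int (r div w) \<le> real_of_int r / real_of_int w" by (rule real_of_int_div4)
      also have "\<dots> \<le> R / w" unfolding r_def using w by (intro divide_right_mono) auto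
      finally show ?thesis .
    qed
    ultimately show ?thesis by linarith
  qed
  have "real (card S) \<le> (3 * (2 * R * w / (P * nrm v))) * (4 * (R / w))"
  proof -
    have "0 \<le> r div w" using pos_imp_zdiv_nonneg_iff[of w r] w wr by simp
    hence "real_of_int (2 * T + 1) * real_of_int (2 * (r div w) + 2) \<le> (3 * (2 * R * w / (P * nrm v))) * (4 * (R / w))"
      using T1 a by (intro mult_mono a b) (auto intro: order_trans[rotated])
    thus ?thesis using c by simp
  qed
  also have "\<dots> = 24 * R\<^sup>2 / (P * nrm v)" using w by (simp add: power2_eq_square)
  finally show ?thesis by simp
qed

definition sols :: "int \<Rightarrow> ivec \<Rightarrow> nat \<Rightarrow> real \<Rightarrow> ivec set" where
  "sols p a n R = {m. prim m \<and> real_of_int (nrm m) \<le> R \<and> p ^ n dvd qf a m}"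

lemma finite_sols: "finite (sols p a n R)"
  unfolding sols_def by (rule finite_subset[OF _ finite_nrm_le[of R]]) auto

text \<open>Dyadic summation: the block between \<open>X / 2\<close> and \<open>X\<close>
  contributes at most \<open>2 * C * X powr (b - 1)\<close>, and halving \<open>X\<close> multiplies
  this by \<open>2 powr (1 - b)\<close>, which is below 1 because \<open>b > 1\<close>.\<close>

lemma sum_inverse_nrm_le:
  fixes A :: "ivec set" and X :: real
  assumes b: "b > 1" and C: "C \<ge> 0"
    and A: "finite A" "\<And>v. v \<in> A \<Longrightarrow> nrm v \<ge> 1"
    and block: "\<And>X :: real. X \<ge> 1 \<Longrightarrow> real (card {v\<in>A. X / 2 < nrm v \<and> nrm v \<le> X}) \<le> C * X powr b"
    and X: "X > 0"
  shows "(\<Sum>v | v \<in> A \<and> nrm v \<le> X. 1 / nrm v) \<le> 2 * C / (1 - 2 powr (1 - b)) * X powr (b - 1)"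
proof -
  \<comment> \<open>The value of the geometric series, that is, the fixed point of the recursion
    \<open>D = D * 2 powr (1 - b) + 2 * C\<close>.\<close>
  define D where "D = 2 * C / (1 - 2 powr (1 - b))"
  have l1: "2 powr (1 - b) < (1::real)" using b by (simp add: powr_less_one)
  have D: "D \<ge> 0" unfolding D_def using C l1 by simp
  have De: "D * 2 powr (1 - b) + 2 * C = D"
  proof -
    define y where "y = (2::real) powr (1 - b)"
    have "1 - y \<noteq> 0" using l1 unfolding y_def by linarith
    thus ?thesis unfolding D_def y_def[symmetric] by (simp add: divide_simps) (simp add: algebra_simps)
  qed
  have "X < 2 ^ k \<Longrightarrow> X > 0 \<Longrightarrow> (\<Sum>v | v \<in> A \<and> nrm v \<le> X. 1 / nrm v) \<le> D * X powr (b - 1)" for k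
  proof (induction k arbitrary: X)
    case 0
    hence e: "{v \<in> A. nrm v \<le> X} = {}" using A(2) by (fastforce simp del: nrm.simps)
    show ?case unfolding e using D by simp
  next
    case (Suc k)
    show ?case
    proof (cases "X < 1")
      case True
      hence e: "{v \<in> A. nrm v \<le> X} = {}" using A(2) by (fastforce simp del: nrm.simps)
      show ?thesis unfolding e using D by simp
    next
      case False
      define B where "B = {v\<in>A. X / 2 < nrm v \<and> nrm v \<le> X}"
      have s: "{v \<in> A. nrm v \<le> X} = {v \<in> A. nrm v \<le> X / 2} \<union> B" unfolding B_def using Suc.prems by auto
      have "(\<Sum>v | v \<in> A \<and> nrm v \<le> X. 1 / nrm v) = (\<Sum>v | v \<in> A \<and> nrm v \<le> X / 2. 1 / nrm v) + (\<Sum>v\<in>B. 1 / nrm v)"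
        unfolding s by (rule sum.union_disjoint) (use A in \<open>auto simp: B_def\<close>)
      moreover have "(\<Sum>v | v \<in> A \<and> nrm v \<le> X / 2. 1 / nrm v) \<le> D * (X / 2) powr (b - 1)"
        using Suc by (intro Suc.IH) auto
      moreover have "(X / 2) powr (b - 1) = X powr (b - 1) * 2 powr (1 - b)"
        using Suc.prems by (simp add: powr_divide powr_diff field_simps)
      moreover have "(\<Sum>v\<in>B. 1 / nrm v) \<le> (\<Sum>v\<in>B. 2 / X)"
        using Suc.prems by (intro sum_mono) (auto simp: B_def field_simps)
      moreover have "(\<Sum>v\<in>B. 2 / X) = card B * (2 / X)" by simp
      moreover have "card B * (2 / X) \<le> (C * X powr b) * (2 / X)"
        using block[of X] False unfolding B_def by (intro mult_right_mono) auto
      moreover have "(C * X powr b) * (2 / X) = 2 * C * X powr (b - 1)"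
        using Suc.prems by (simp add: powr_diff)
      ultimately have "(\<Sum>v | v \<in> A \<and> nrm v \<le> X. 1 / nrm v) \<le>
        D * (X powr (b - 1) * 2 powr (1 - b)) + 2 * C * X powr (b - 1)" by simp
      also have "\<dots> = (D * 2 powr (1 - b) + 2 * C) * X powr (b - 1)" by (simp add: algebra_simps)
      finally show ?thesis using De by simp
    qed
  qed
  moreover obtain k where "X < 2 ^ k" using real_arch_pow[of 2 X] by auto
  ultimately show ?thesis using X D_def by simp
qed

context
  fixes p :: int
  assumes p: "prime p" "p > 2"
begin

text \<open>By \<open>two_of_three_close\<close> the zeros in one plane form at most two projective
  classes modulo \<open>p ^ j\<close>; \<open>card_plane_class\<close> bounds each of them.\<close>

lemma card_plane_solutions:
  fixes R :: real
  assumes a: "unitv p a" and v: "prim v" and n: "2 * j \<le> n" "n \<ge> 1"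
  shows "real (card {m \<in> sols p a n R. dot m v = 0}) \<le> 2 * (2 + 24 * R\<^sup>2 / (p ^ j * nrm v))"
proof -
  define S where "S = {m \<in> sols p a n R. dot m v = 0}"
  have fin: "finite S" unfolding S_def using finite_sols by auto
  have P: "p ^ j \<ge> 1" using p by (simp add: one_le_power)
  have S: "prim m" "real_of_int (nrm m) \<le> R" "dot m v = 0" "p ^ n dvd qf a m" "\<not> dvdv p m" if "m \<in> S" for m
    using that prim_not_dvdv[OF p(1)] unfolding S_def sols_def by auto
  define B where "B = 2 + 24 * R\<^sup>2 / (p ^ j * nrm v)"
  have B: "B \<ge> 0" unfolding B_def using p nrm_nonneg[of v] by simp
  have cl: "real (card S') \<le> B" if "S' \<subseteq> S" "m0 \<in> S" "\<And>m. m \<in> S' \<Longrightarrow> dvdv (p ^ j) (cross m0 m)" for S' m0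
  proof -
    have "real (card S') \<le> 2 + 24 * R\<^sup>2 / real_of_int (p ^ j * nrm v)"
    proof (rule card_plane_class[OF S(1)[OF that(2)] S(3)[OF that(2)] S(2)[OF that(2)] v P])
      fix m assume h: "m \<in> S'"
      hence "m \<in> S" using that(1) by blast
      thus "prim m \<and> real_of_int (nrm m) \<le> R \<and> dot m v = 0 \<and> dvdv (p ^ j) (cross m0 m)"
        using S that(3)[OF h] by blast
    qed
    thus ?thesis unfolding B_def by simp
  qed
  have "real (card S) \<le> 2 * B"
  proof (cases "S = {}")
    case False
    then obtain m0 where m0: "m0 \<in> S" by blast
    define S1 S2 where "S1 = {m \<in> S. dvdv (p ^ j) (cross m0 m)}" and "S2 = {m \<in> S. \<not> dvdv (p ^ j) (cross m0 m)}"
    have "card S = card S1 + card S2"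
    proof -
      have "S = S1 \<union> S2" "S1 \<inter> S2 = {}" unfolding S1_def S2_def by blast+
      thus ?thesis using fin by (metis card_Un_disjoint finite_Un)
    qed
    moreover have "real (card S1) \<le> B" by (rule cl[OF _ m0]) (auto simp: S1_def)
    moreover have "real (card S2) \<le> B"
    proof (cases "S2 = {}")
      case False
      then obtain m1 where m1: "m1 \<in> S2" by blast
      have "dvdv (p ^ j) (cross m1 m)" if "m \<in> S2" for m
        using two_of_three_close[OF p a v n, of m0 m1 m] S m0 m1 that unfolding S2_def by blast
      thus ?thesis using cl[of S2 m1] m1 unfolding S2_def by blast
    qed (use B in simp)
    ultimately show ?thesis by simp
  qed (use B in simp)
  thus ?thesis unfolding S_def B_def .
qed

end

section \<open>Primitive zeros of small height\<close>

text \<open>The unit first entry permits the projective coordinates \<open>x2 / x1\<close> and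
  \<open>x3 / x1\<close>; the unit second entry makes \<open>x2\<close> recoverable from the other
  entries and its residue modulo \<open>p\<close>.\<close>

definition sols12 :: "int \<Rightarrow> ivec \<Rightarrow> nat \<Rightarrow> real \<Rightarrow> ivec set" where
  "sols12 p a n R = {m \<in> sols p a n R. \<not> p dvd fst m \<and> \<not> p dvd fst (snd m)}"

text \<open>Uniformity in \<open>a\<close> is essential, because the recursion passes to the dual
  form and the coefficients vary with \<open>n\<close>. Lowering \<open>b\<close> improves the bound
  and also admits smaller moduli \<open>p ^ n\<close>.\<close>

definition count_bound :: "int \<Rightarrow> real \<Rightarrow> real \<Rightarrow> real \<Rightarrow> bool" where
  "count_bound p b C K \<longleftrightarrow> (\<forall>a n R. unitv p a \<longrightarrow> R \<ge> 1 \<longrightarrow> real_of_int (p ^ n) \<ge> K * R powr (2 * b) \<longrightarrow>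
     real (card (sols p a n R)) \<le> C * R powr b)"

lemma card_UN_le_real:
  assumes "finite I" "\<And>i. i \<in> I \<Longrightarrow> real (card (A i)) \<le> f i"
  shows "real (card (\<Union>i\<in>I. A i)) \<le> (\<Sum>i\<in>I. f i)"
proof -
  have "real (card (\<Union>i\<in>I. A i)) \<le> real (\<Sum>i\<in>I. card (A i))"
    using card_UN_le[OF assms(1)] of_nat_le_iff by blast
  also have "\<dots> \<le> (\<Sum>i\<in>I. f i)" unfolding of_nat_sum using assms(2) by (rule sum_mono)
  finally show ?thesis .
qed

section \<open>Lifting of congruences, projective classes and the trivial count\<close>

context
  fixes p :: int
  assumes p: "prime p" "p > 2"
begin

text \<open>A zero modulo \<open>p\<close> with two entries divisible by \<open>p\<close> has the
  third divisible as well, contrary to primitivity. So at least two entries are units, and one of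
  three permutations of the coordinates moves them to the front.\<close>

lemma card_sols_le:
  assumes a: "unitv p a" and n: "n \<ge> 1"
    and B: "\<And>a. unitv p a \<Longrightarrow> real (card (sols12 p a n R)) \<le> B"
  shows "real (card (sols p a n R)) \<le> 3 * B"
proof -
  obtain a1 a2 a3 where a': "a = (a1, a2, a3)" by (cases a)
  define s where "s = (\<lambda>(x::int, y::int, z::int). (x, z, y))"
  define t where "t = (\<lambda>(x::int, y::int, z::int). (z, x, y))"
  have pr: "prim (x, z, y)" "prim (y, z, x)" if h: "prim (x, y, z)" for x y z
  proof -
    obtain u where u': "dot u (x, y, z) = 1" using h unfolding prim_def by blast
    obtain u1 u2 u3 where "u = (u1, u2, u3)" by (cases u)
    hence u: "dot (u1, u2, u3) (x, y, z) = 1" using u' by simp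
    show "prim (x, z, y)" unfolding prim_def using u by (intro exI[of _ "(u1, u3, u2)"]) (simp add: add_ac)
    show "prim (y, z, x)" unfolding prim_def using u by (intro exI[of _ "(u2, u3, u1)"]) (simp add: add_ac)
  qed
  have "sols p a n R \<subseteq> sols12 p a n R \<union> (s ` sols12 p (a1, a3, a2) n R \<union> t ` sols12 p (a2, a3, a1) n R)"
  proof
    fix m assume m: "m \<in> sols p a n R"
    obtain x y z where xyz: "m = (x, y, z)" by (cases m)
    have h: "prim (x, y, z)" "real_of_int (nrm (x, y, z)) \<le> R" "p ^ n dvd a1 * x\<^sup>2 + a2 * y\<^sup>2 + a3 * z\<^sup>2"
      using m unfolding sols_def xyz a' by auto
    have "p dvd p ^ n" using n by (simp add: dvd_power)
    hence d: "p dvd a1 * x\<^sup>2 + a2 * y\<^sup>2 + a3 * z\<^sup>2" using h(3) dvd_trans by blast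
    have nd: "\<not> (p dvd x \<and> p dvd y \<and> p dvd z)" using prim_not_dvdv[OF p(1) h(1)] by simp
    have u: "\<not> p dvd a1" "\<not> p dvd a2" "\<not> p dvd a3" using a unfolding a' unitv_iff[OF p] by auto
    have pd: "p dvd c * w\<^sup>2 \<longleftrightarrow> p dvd w" if "\<not> p dvd c" for c w
      using that by (simp add: pdvd_mult[OF p] pdvd_sq[OF p])
    have two: "\<not> p dvd x \<and> \<not> p dvd y \<or> \<not> p dvd x \<and> \<not> p dvd z \<or> \<not> p dvd y \<and> \<not> p dvd z"
    proof (rule ccontr)
      assume c: "\<not> ?thesis"
      then consider "p dvd x" "p dvd y" | "p dvd x" "p dvd z" | "p dvd y" "p dvd z" by blast
      thus False
      proof cases
        case 1
        hence "p dvd a1 * x\<^sup>2 + a2 * y\<^sup>2" using u by (simp add: pd)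
        hence "p dvd a3 * z\<^sup>2" using d by (simp add: dvd_add_right_iff)
        thus False using 1 u nd by (simp add: pd)
      next
        case 2
        hence "p dvd a1 * x\<^sup>2" "p dvd a3 * z\<^sup>2" using u by (simp_all add: pd)
        hence "p dvd a2 * y\<^sup>2" using d by (simp add: dvd_add_right_iff dvd_add_left_iff)
        thus False using 2 u nd by (simp add: pd)
      next
        case 3
        hence "p dvd a2 * y\<^sup>2" "p dvd a3 * z\<^sup>2" using u by (simp_all add: pd)
        hence "p dvd a1 * x\<^sup>2" using d by (simp add: dvd_add_right_iff dvd_add_left_iff)
        thus False using 3 u nd by (simp add: pd)
      qed
    qed
    have m12: "m \<in> sols12 p a n R" if "\<not> p dvd x" "\<not> p dvd y"
      using m that unfolding sols12_def xyz by simp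
    have "(x, z, y) \<in> sols12 p (a1, a3, a2) n R" if "\<not> p dvd x" "\<not> p dvd z"
      using that pr[OF h(1)] h unfolding sols12_def sols_def by (simp add: add_ac max.left_commute max.commute)
    hence m13: "m \<in> s ` sols12 p (a1, a3, a2) n R" if "\<not> p dvd x" "\<not> p dvd z"
      using that unfolding xyz s_def by (force intro: rev_image_eqI)
    have "(y, z, x) \<in> sols12 p (a2, a3, a1) n R" if "\<not> p dvd y" "\<not> p dvd z"
      using that pr[OF h(1)] h unfolding sols12_def sols_def by (simp add: add_ac max.left_commute max.commute)
    hence m23: "m \<in> t ` sols12 p (a2, a3, a1) n R" if "\<not> p dvd y" "\<not> p dvd z"
      using that unfolding xyz t_def by (force intro: rev_image_eqI)
    show "m \<in> sols12 p a n R \<union> (s ` sols12 p (a1, a3, a2) n R \<union> t ` sols12 p (a2, a3, a1) n R)"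
      using two m12 m13 m23 by blast
  qed
  moreover have f: "finite (sols12 p a n R)" for a unfolding sols12_def using finite_sols by auto
  ultimately have "card (sols p a n R) \<le>
      card (sols12 p a n R \<union> (s ` sols12 p (a1, a3, a2) n R \<union> t ` sols12 p (a2, a3, a1) n R))"
    by (intro card_mono) auto
  also have "\<dots> \<le> card (sols12 p a n R) + (card (sols12 p (a1, a3, a2) n R) + card (sols12 p (a2, a3, a1) n R))"
    by (intro order_trans[OF card_Un_le] add_mono order_refl card_image_le f)
  finally have "real (card (sols p a n R)) \<le> real (card (sols12 p a n R)) + (real (card (sols12 p (a1, a3, a2) n R)) + real (card (sols12 p (a2, a3, a1) n R)))"
    by (simp flip: of_nat_add)
  moreover have "unitv p (a1, a3, a2)" "unitv p (a2, a3, a1)" using a unfolding a' by simp_all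
  ultimately show ?thesis using B[OF a] B[of "(a1, a3, a2)"] B[of "(a2, a3, a1)"] by linarith
qed

text \<open>The uniqueness half of Hensel's lemma for square roots: \<open>A + B\<close> is
  congruent to \<open>2 * A\<close> modulo \<open>p\<close>, hence a unit, and can be
  cancelled.\<close>

lemma square_congruence_lift:
  assumes "p ^ j dvd c * (A\<^sup>2 - B\<^sup>2)" "\<not> p dvd c" "p dvd A - B" "\<not> p dvd A"
  shows "p ^ j dvd A - B"
proof -
  have "\<not> p dvd A + B"
  proof
    assume "p dvd A + B"
    hence "p dvd (A + B) + (A - B)" using assms(3) by (rule dvd_add)
    hence "p dvd 2 * A" by simp
    thus False using assms(4) not_dvd_2[OF p] pdvd_mult[OF p] by blast
  qed
  hence "\<not> p dvd c * (A + B)" using assms(2) pdvd_mult[OF p] by blast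
  moreover have "c * (A\<^sup>2 - B\<^sup>2) = (c * (A + B)) * (A - B)" by (simp add: power2_eq_square algebra_simps)
  ultimately show ?thesis using assms(1) prime_pow_dvd_mult_unit[OF p(1)] by metis
qed

text \<open>The quotient \<open>x3 / x1\<close> modulo \<open>p ^ j\<close> fixes the square of
  \<open>x2 / x1\<close> through the form, and the residue modulo \<open>p\<close> selects the root.
  Therefore \<open>p ^ j * p\<close> keys suffice instead of \<open>p ^ (2 * j)\<close>.\<close>

lemma same_key_close:
  assumes a: "unitv p (a1, a2, a3)"
    and q: "p ^ j dvd qf (a1, a2, a3) (x1, x2, x3)" "p ^ j dvd qf (a1, a2, a3) (y1, y2, y3)"
    and nd: "\<not> p dvd x1" "\<not> p dvd x2" "\<not> p dvd y1"
    and k: "p ^ j dvd x3 * y1 - y3 * x1" "p dvd x2 * y1 - y2 * x1"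
  shows "dvdv (p ^ j) (cross (x1, x2, x3) (y1, y2, y3))"
proof -
  have u: "\<not> p dvd a2" using a unfolding unitv_iff[OF p] by auto
  have "p ^ j dvd y1\<^sup>2 * qf (a1, a2, a3) (x1, x2, x3) - x1\<^sup>2 * qf (a1, a2, a3) (y1, y2, y3)
      - (a3 * (x3 * y1 + y3 * x1)) * (x3 * y1 - y3 * x1)"
    by (intro dvd_diff dvd_mult q k)
  also have "\<dots> = a2 * ((x2 * y1)\<^sup>2 - (y2 * x1)\<^sup>2)" by (simp add: power2_eq_square algebra_simps)
  finally have 3: "p ^ j dvd x2 * y1 - y2 * x1"
    by (rule square_congruence_lift[OF _ u k(2)]) (use nd in \<open>simp add: pdvd_mult[OF p]\<close>)
  have "p ^ j dvd x3 * (x2 * y1 - y2 * x1) - x2 * (x3 * y1 - y3 * x1)"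
    by (intro dvd_diff dvd_mult 3 k)
  also have "\<dots> = x1 * (x2 * y3 - x3 * y2)" by (simp add: algebra_simps)
  finally have "p ^ j dvd x2 * y3 - x3 * y2" using nd prime_pow_dvd_mult_unit[OF p(1)] by blast
  moreover have "p ^ j dvd x1 * y2 - x2 * y1" using 3 by (metis dvd_minus_iff minus_diff_eq mult.commute)
  ultimately show ?thesis using k(1) by (simp add: mult.commute)
qed

text \<open>In the Lagrange identity the product of form values is divisible by
  \<open>p ^ (2 * n)\<close> and the square by twice the exponent \<open>min n (2 * g)\<close>; the
  content \<open>p ^ g\<close> of the cross product takes away \<open>p ^ (2 * g)\<close>. The
  exponent is the difference, and for \<open>g > n\<close> truncated subtraction turns it into
  0.\<close>

lemma normal_vector_dvd:
  assumes "p ^ n dvd qf a x" "p ^ n dvd qf a y" "\<not> dvdv p x" "\<not> dvdv p y"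
    and c: "cross x y = scale (p ^ g * c) v" "\<not> p dvd c"
  shows "p ^ min (2 * g) (2 * n - 2 * g) dvd qf (dual a) v"
proof (cases "g \<le> n")
  case True
  define t where "t = min (2 * g) (2 * n - 2 * g)"
  have t: "2 * g + t = 2 * min n (2 * g)" unfolding t_def using True by linarith
  have "dvdv (p ^ g) (cross x y)" unfolding c(1) by (rule dvdv_scale) simp
  hence "p ^ min n (2 * g) dvd bf a x y" using bf_dvd[OF p] assms by blast
  hence 1: "p ^ (2 * g + t) dvd (bf a x y)\<^sup>2" unfolding t
    by (simp add: mult.commute[of 2] power_mult dvd_power_same)
  have "p ^ (2 * g + t) dvd p ^ n * p ^ n" unfolding t power_add[symmetric]
    by (intro le_imp_power_dvd) simp
  also have "\<dots> dvd qf a x * qf a y" using assms by (intro mult_dvd_mono)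
  finally have "p ^ (2 * g + t) dvd qf (dual a) (cross x y)"
    using 1 unfolding lagrange_identity[symmetric] by (intro dvd_diff)
  also have "qf (dual a) (cross x y) = p ^ (2 * g) * (c\<^sup>2 * qf (dual a) v)"
    unfolding c(1) qf_scale by (simp add: power_mult_distrib power_mult[symmetric] mult.commute)
  finally have "p ^ t dvd c\<^sup>2 * qf (dual a) v" using p by (simp add: power_add)
  thus ?thesis using c(2) prime_pow_dvd_mult_unit[OF p(1)] pdvd_sq[OF p] unfolding t_def by blast
next
  case False
  hence "min (2 * g) (2 * n - 2 * g) = 0" by simp
  thus ?thesis by (metis one_dvd power_0)
qed

text \<open>With the first and third entries chosen freely, the second is determined by its residue
  modulo \<open>p\<close>: its square is fixed modulo \<open>p ^ n\<close>, and \<open>p ^ n\<close>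
  exceeds \<open>2 * R\<close>. This is the start of the recursion.\<close>

lemma count_bound_trivial: "count_bound p 2 (27 * real_of_int p) 4"
  unfolding count_bound_def
proof (intro allI impI)
  fix a n and R :: real
  assume a: "unitv p a" and R: "R \<ge> 1" and big: "real_of_int (p ^ n) \<ge> 4 * R powr (2 * 2)"
  have R4: "R powr (2 * 2) \<ge> R"
    using R powr_mono[of 1 "2 * 2" R] by simp
  have n1: "n \<ge> 1"
  proof (rule ccontr)
    assume "\<not> n \<ge> 1"
    hence "n = 0" by simp
    hence "real_of_int (p ^ n) = 1" by simp
    thus False using big R4 R by linarith
  qed
  have pn: "2 * R < real_of_int (p ^ n)" using big R4 R by linarith
  have *: "real (card (sols12 p a n R)) \<le> 9 * real_of_int p * R\<^sup>2" if a: "unitv p a" for a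
  proof -
    obtain a1 a2 a3 where a': "a = (a1, a2, a3)" by (cases a)
    have u: "\<not> p dvd a2" using a unfolding a' unitv_iff[OF p] by auto
    define f where "f = (\<lambda>(x::int, y, z::int). (x, z, y mod p))"
    have box: "\<bar>x\<bar> \<le> \<lfloor>R\<rfloor> \<and> \<bar>y\<bar> \<le> \<lfloor>R\<rfloor> \<and> \<bar>z\<bar> \<le> \<lfloor>R\<rfloor>" if "(x, y, z) \<in> sols12 p a n R" for x y z
      using that unfolding sols12_def sols_def by (auto simp: le_floor_iff)
    have inj: "inj_on f (sols12 p a n R)"
    proof (rule inj_onI)
      fix m m' assume h: "m \<in> sols12 p a n R" "m' \<in> sols12 p a n R" "f m = f m'"
      obtain x y z where m: "m = (x, y, z)" by (cases m)
      obtain y' where m': "m' = (x, y', z)" and yy: "y mod p = y' mod p"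
        using h(3) m unfolding f_def by (cases m') auto
      have q: "p ^ n dvd a1 * x\<^sup>2 + a2 * y\<^sup>2 + a3 * z\<^sup>2" "p ^ n dvd a1 * x\<^sup>2 + a2 * y'\<^sup>2 + a3 * z\<^sup>2" "\<not> p dvd y"
        using h unfolding m m' a' sols12_def sols_def by auto
      have "p ^ n dvd (a1 * x\<^sup>2 + a2 * y\<^sup>2 + a3 * z\<^sup>2) - (a1 * x\<^sup>2 + a2 * y'\<^sup>2 + a3 * z\<^sup>2)"
        using q by (intro dvd_diff)
      also have "\<dots> = a2 * (y\<^sup>2 - y'\<^sup>2)" by (simp add: algebra_simps)
      finally have d: "p ^ n dvd y - y'"
        using square_congruence_lift[of n a2 y y'] u q(3) yy by (simp add: mod_eq_dvd_iff)
      have "\<bar>y - y'\<bar> \<le> 2 * \<lfloor>R\<rfloor>" using box[of x y z] box[of x y' z] h(1,2) unfolding m m' by auto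
      also have "\<dots> < p ^ n" using pn by linarith
      finally have "y = y'" using d by (metis dvd_imp_le_int eq_iff_diff_eq_0 linorder_not_le abs_of_nonneg
           order_less_imp_le zero_less_power p_pos[OF p])
      thus "m = m'" using m m' by simp
    qed
    have "f ` sols12 p a n R \<subseteq> {-\<lfloor>R\<rfloor>..\<lfloor>R\<rfloor>} \<times> {-\<lfloor>R\<rfloor>..\<lfloor>R\<rfloor>} \<times> {0..<p}"
    proof (rule image_subsetI)
      fix m assume "m \<in> sols12 p a n R"
      thus "f m \<in> {-\<lfloor>R\<rfloor>..\<lfloor>R\<rfloor>} \<times> {-\<lfloor>R\<rfloor>..\<lfloor>R\<rfloor>} \<times> {0..<p}"
        using box[of "fst m" "fst (snd m)" "snd (snd m)"] p unfolding f_def by (cases m) (auto simp: abs_le_iff)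
    qed
    hence "card (sols12 p a n R) \<le> card ({-\<lfloor>R\<rfloor>..\<lfloor>R\<rfloor>} \<times> {-\<lfloor>R\<rfloor>..\<lfloor>R\<rfloor>} \<times> {0..<p})"
      by (intro card_inj_on_le[OF inj]) auto
    also have "real \<dots> = (2 * \<lfloor>R\<rfloor> + 1) * (2 * \<lfloor>R\<rfloor> + 1) * p"
      using R p by (simp add: card_cartesian_product)
    also have "\<dots> \<le> (3 * R) * (3 * R) * p"
    proof -
      have "real_of_int (2 * \<lfloor>R\<rfloor> + 1) \<le> 3 * R" using R by linarith
      moreover have "real_of_int (2 * \<lfloor>R\<rfloor> + 1) \<ge> 0" using R by simp
      ultimately have "real_of_int (2 * \<lfloor>R\<rfloor> + 1) * real_of_int (2 * \<lfloor>R\<rfloor> + 1) \<le> (3 * R) * (3 * R)"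
        using R by (intro mult_mono) auto
      hence "real_of_int (2 * \<lfloor>R\<rfloor> + 1) * real_of_int (2 * \<lfloor>R\<rfloor> + 1) * p \<le> (3 * R) * (3 * R) * p"
        using p by (intro mult_right_mono) auto
      thus ?thesis by simp
    qed
    finally show ?thesis by (simp add: power2_eq_square mult_ac)
  qed
  have "real (card (sols p a n R)) \<le> 3 * (9 * real_of_int p * R\<^sup>2)"
    by (rule card_sols_le[OF a n1 *])
  thus "real (card (sols p a n R)) \<le> 27 * real_of_int p * R powr 2" using R by simp
qed

end

section \<open>Planes spanned by close zeros and the recursive count\<close>

context
  fixes p :: int
  assumes p: "prime p" "p > 2"
begin

lemma exists_prime_power_between:
  fixes Y :: real
  assumes "Y > 1"
  shows "\<exists>j\<ge>1. real_of_int (p ^ j) \<ge> Y \<and> real_of_int (p ^ j) \<le> p * Y"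
proof -
  define j where "j = (LEAST j. real_of_int (p ^ j) \<ge> Y)"
  obtain k where "Y < real_of_int p ^ k" using real_arch_pow[of "real_of_int p" Y] p by auto
  hence "real_of_int (p ^ k) \<ge> Y" by simp
  hence j: "real_of_int (p ^ j) \<ge> Y" unfolding j_def by (rule LeastI)
  have j1: "j \<ge> 1" using j assms by (cases j) auto
  have "\<not> real_of_int (p ^ (j - 1)) \<ge> Y" using j1 unfolding j_def by (intro not_less_Least) auto
  hence "p * real_of_int (p ^ (j - 1)) \<le> p * Y" using p by (intro mult_left_mono) auto
  moreover have "p * real_of_int (p ^ (j - 1)) = real_of_int (p ^ j)"
    using j1 by (metis of_int_mult power_Suc Suc_diff_1 less_eq_Suc_le One_nat_def)
  ultimately show ?thesis using j j1 by (intro exI[of _ j]) auto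
qed

lemma exists_inverse_mod_power: "\<exists>\<iota>. \<forall>x. \<not> p dvd x \<longrightarrow> p ^ j dvd \<iota> x * x - 1"
proof -
  have "\<exists>y. \<not> p dvd x \<longrightarrow> p ^ j dvd y * x - 1" for x
  proof (cases "p dvd x")
    case False
    hence "coprime x (p ^ j)" using coprime_prime_iff[OF p(1)] by simp
    then obtain y where "[x * y = 1] (mod p ^ j)" using cong_solve_coprime_int by blast
    thus ?thesis by (metis cong_iff_dvd_diff mult.commute)
  qed auto
  thus ?thesis by metis
qed

text \<open>Contains the normal vectors of the planes spanned by two zeros of \<open>a\<close> that agree projectively
  modulo \<open>p ^ j\<close>; see \<open>class_normal\<close>.\<close>

definition normals :: "real \<Rightarrow> real \<Rightarrow> ivec \<Rightarrow> real \<Rightarrow> ivec set" where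
  "normals b K a V = {v. prim v \<and> real_of_int (nrm v) \<le> V \<and>
     (\<exists>e. K * (2 * real_of_int (nrm v)) powr (2 * b) \<le> real_of_int (p ^ e) \<and> p ^ e dvd qf (dual a) v)}"

lemma finite_normals: "finite (normals b K a V)"
  unfolding normals_def by (rule finite_subset[OF _ finite_nrm_le[of V]]) auto

text \<open>For \<open>nrm v > X / 2\<close> the factor 2 in \<open>normals\<close> makes the
  guaranteed modulus at least \<open>K * X powr (2 * b)\<close>. All normals of one dyadic block are
  therefore zeros of the dual form modulo one common power \<open>p ^ e\<close>, to which
  \<open>count_bound\<close> applies.\<close>

lemma sum_normals_le:
  assumes cb: "count_bound p b C K" and b: "b > 1" and C: "C \<ge> 0" and K: "K \<ge> 0" and a: "unitv p a" and V: "V > 0"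
  shows "(\<Sum>v\<in>normals b K a V. 1 / nrm v) \<le> 2 * C / (1 - 2 powr (1 - b)) * V powr (b - 1)"
proof -
  have "real (card {v \<in> normals b K a V. X / 2 < nrm v \<and> nrm v \<le> X}) \<le> C * X powr b" if X: "X \<ge> 1" for X :: real
  proof -
    define e where "e = (LEAST e. K * X powr (2 * b) \<le> real_of_int (p ^ e))"
    obtain k where "K * X powr (2 * b) < real_of_int p ^ k"
      using real_arch_pow[of "real_of_int p"] p by auto
    hence "K * X powr (2 * b) \<le> real_of_int (p ^ k)" by simp
    hence e: "K * X powr (2 * b) \<le> real_of_int (p ^ e)" unfolding e_def by (rule LeastI)
    have "{v \<in> normals b K a V. X / 2 < nrm v \<and> nrm v \<le> X} \<subseteq> sols p (dual a) e X"
    proof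
      fix v assume v: "v \<in> {v \<in> normals b K a V. X / 2 < nrm v \<and> nrm v \<le> X}"
      then obtain e' where e': "K * (2 * real_of_int (nrm v)) powr (2 * b) \<le> real_of_int (p ^ e')" "p ^ e' dvd qf (dual a) v"
        unfolding normals_def by blast
      have "K * X powr (2 * b) \<le> K * (2 * real_of_int (nrm v)) powr (2 * b)"
        using v X K b by (intro mult_left_mono powr_mono2) auto
      hence "e \<le> e'" unfolding e_def using e'(1) by (intro Least_le) linarith
      hence "p ^ e dvd qf (dual a) v" using e'(2) by (meson dvd_trans le_imp_power_dvd)
      thus "v \<in> sols p (dual a) e X" using v unfolding sols_def normals_def by blast
    qed
    hence "card {v \<in> normals b K a V. X / 2 < nrm v \<and> nrm v \<le> X} \<le> card (sols p (dual a) e X)"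
      by (intro card_mono finite_sols)
    also have "real \<dots> \<le> C * X powr b"
      using cb unitv_dual[OF a] X e unfolding count_bound_def by blast
    finally show ?thesis by simp
  qed
  hence "(\<Sum>v | v \<in> normals b K a V \<and> nrm v \<le> V. 1 / nrm v) \<le> 2 * C / (1 - 2 powr (1 - b)) * V powr (b - 1)"
    using b C V by (intro sum_inverse_nrm_le finite_normals) (auto simp: normals_def dest: prim_nonzero simp del: nrm.simps)
  moreover have "{v. v \<in> normals b K a V \<and> real_of_int (nrm v) \<le> V} = normals b K a V"
    unfolding normals_def by blast
  ultimately show ?thesis by simp
qed

text \<open>The determinant is divisible by \<open>p ^ (3 * j)\<close> but at most
  \<open>6 * R ^ 3\<close> in absolute value, so it vanishes.\<close>

lemma class_coplanar:
  fixes R :: real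
  assumes a: "unitv p a" and n: "2 * j \<le> n" and R: "R \<ge> 0" and P: "6 * R ^ 3 < real_of_int (p ^ (3 * j))"
    and G: "G \<subseteq> sols p a n R" "\<And>x y. x \<in> G \<Longrightarrow> y \<in> G \<Longrightarrow> dvdv (p ^ j) (cross x y)"
    and x: "x \<in> G" "y \<in> G" "z \<in> G"
  shows "det3 x y z = 0"
proof (rule ccontr)
  assume "det3 x y z \<noteq> 0"
  have g: "prim w" "real_of_int (nrm w) \<le> R" "p ^ n dvd qf a w" "\<not> dvdv p w" if "w \<in> G" for w
  proof -
    have "w \<in> sols p a n R" using that G(1) by blast
    thus "prim w" "real_of_int (nrm w) \<le> R" "p ^ n dvd qf a w" unfolding sols_def by blast+
    thus "\<not> dvdv p w" using prim_not_dvdv[OF p(1)] by blast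
  qed
  have "p ^ (3 * j) dvd det3 x y z"
    by (rule det_dvd[OF p a n]) (use g x G(2) in auto)
  hence "p ^ (3 * j) \<le> \<bar>det3 x y z\<bar>" using \<open>det3 x y z \<noteq> 0\<close> dvd_imp_le_int p by (metis abs_of_nonneg zero_le_power p_pos order_less_imp_le)
  also have "\<dots> \<le> 3 * nrm x * nrm (cross y z)" by (rule abs_dot)
  also have "\<dots> \<le> 3 * nrm x * (2 * nrm y * nrm z)"
    using nrm_nonneg[of x] by (intro mult_left_mono nrm_cross) auto
  finally have "real_of_int (p ^ (3 * j)) \<le> real_of_int (3 * nrm x * (2 * nrm y * nrm z))"
    by (simp only: of_int_le_iff)
  also have "\<dots> = 6 * (real_of_int (nrm x) * real_of_int (nrm y) * real_of_int (nrm z))" by simp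
  also have "\<dots> \<le> 6 * (R * R * R)"
    using g x R nrm_nonneg by (intro mult_left_mono mult_mono) auto
  finally show False using P by (simp add: power3_eq_cube)
qed

text \<open>The exponent \<open>g\<close> is the exact power of \<open>p\<close> in the content of
  \<open>cross x y\<close>. It may exceed \<open>j\<close>; then \<open>v\<close> is correspondingly
  smaller, since \<open>p ^ g * nrm v\<close> is bounded by the norm of the cross product, but the
  power of \<open>p\<close> dividing the dual form at \<open>v\<close> changes as well.\<close>

lemma class_normal:
  fixes R :: real
  assumes a: "unitv p a" and n: "2 * j \<le> n" and R: "R \<ge> 0" and P: "6 * R ^ 3 < real_of_int (p ^ (3 * j))"
    and G: "G \<subseteq> sols p a n R" "\<And>x y. x \<in> G \<Longrightarrow> y \<in> G \<Longrightarrow> dvdv (p ^ j) (cross x y)"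
    and x: "x \<in> G" "y \<in> G" "cross x y \<noteq> (0, 0, 0)"
  shows "\<exists>v g. prim v \<and> (\<forall>m\<in>G. dot m v = 0) \<and> j \<le> g \<and> real_of_int (p ^ g) * nrm v \<le> 2 * R\<^sup>2 \<and>
           p ^ min (2 * g) (2 * n - 2 * g) dvd qf (dual a) v"
proof -
  have gg: "prim w" "real_of_int (nrm w) \<le> R" "p ^ n dvd qf a w" "\<not> dvdv p w" if "w \<in> G" for w
  proof -
    have "w \<in> sols p a n R" using that G(1) by blast
    thus "prim w" "real_of_int (nrm w) \<le> R" "p ^ n dvd qf a w" unfolding sols_def by blast+
    thus "\<not> dvdv p w" using prim_not_dvdv[OF p(1)] by blast
  qed
  obtain c v where v: "c \<ge> 1" "prim v" "cross x y = scale c v" using prim_factor[OF x(3)] by blast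
  define g where "g = multiplicity p c"
  have nu: "\<not> is_unit p" using p not_prime_unit by blast
  obtain c' where c': "c = p ^ g * c'" "\<not> p dvd c'"
    using multiplicity_decompose'[of c p] v(1) nu unfolding g_def by (metis not_one_le_zero)
  have "p ^ j dvd c" using dvdv_scale_prim[OF v(2)] G(2)[OF x(1,2)] v(3) by metis
  hence "j \<le> g" unfolding g_def using v(1) nu by (intro multiplicity_geI) auto
  moreover have "dot m v = 0" if m: "m \<in> G" for m
  proof -
    have "det3 m x y = 0" using class_coplanar[OF a n R P G m x(1,2)] by blast
    thus ?thesis using v(1) unfolding v(3) dot_scale by simp
  qed
  moreover have "real_of_int (p ^ g) * nrm v \<le> 2 * R\<^sup>2"
  proof -
    have c1: "c' \<ge> 1" using v(1) c'(1) p_pos[OF p] by (metis int_one_le_iff_zero_less zero_less_mult_pos zero_less_power)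
    have "p ^ g * nrm v \<le> c * nrm v" unfolding c'(1) using c1 p nrm_nonneg[of v]
      by (intro mult_right_mono) auto
    also have "\<dots> = nrm (cross x y)" unfolding v(3) nrm_scale using v(1) by simp
    also have "\<dots> \<le> 2 * nrm x * nrm y" by (rule nrm_cross)
    finally have "real_of_int (p ^ g * nrm v) \<le> real_of_int (2 * nrm x * nrm y)"
      by (simp only: of_int_le_iff)
    hence "real_of_int (p ^ g) * nrm v \<le> 2 * (real_of_int (nrm x) * real_of_int (nrm y))" by simp
    also have "\<dots> \<le> 2 * (R * R)" using gg x R nrm_nonneg by (intro mult_left_mono mult_mono) auto
    finally show ?thesis by (simp add: power2_eq_square)
  qed
  moreover have "p ^ min (2 * g) (2 * n - 2 * g) dvd qf (dual a) v"
    by (rule normal_vector_dvd[OF p gg(3)[OF x(1)] gg(3)[OF x(2)] gg(4)[OF x(1)] gg(4)[OF x(2)]])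
      (use v(3) c' in auto)
  ultimately show ?thesis using v(2) by blast
qed

text \<open>A good class has no two non-parallel members and contains at most one zero up to sign.
  All other zeros are counted by planes rather than by classes, so that many classes in the same
  plane are paid for only once. The hypothesis on \<open>normals\<close> isolates the numerical
  condition that the choice of \<open>j\<close> must meet.\<close>

lemma card_sols12_decomp:
  fixes R :: real
  assumes a: "unitv p a" and n: "2 * j \<le> n" "j \<ge> 1" and R: "R \<ge> 1" and P: "6 * R ^ 3 < real_of_int (p ^ (3 * j))"
    and V: "V = 2 * R\<^sup>2 / real_of_int (p ^ j)"
    and N: "\<And>v g. prim v \<Longrightarrow> j \<le> g \<Longrightarrow> real_of_int (p ^ g) * nrm v \<le> 2 * R\<^sup>2 \<Longrightarrow>
             p ^ min (2 * g) (2 * n - 2 * g) dvd qf (dual a) v \<Longrightarrow> v \<in> normals b K a V"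
  shows "real (card (sols12 p a n R)) \<le> 2 * real_of_int (p ^ j) * p + 28 * V * (\<Sum>v\<in>normals b K a V. 1 / nrm v)"
proof -
  obtain a1 a2 a3 where a': "a = (a1, a2, a3)" by (cases a)
  obtain \<iota> where i: "\<And>x. \<not> p dvd x \<Longrightarrow> p ^ j dvd \<iota> x * x - 1" using exists_inverse_mod_power by metis
  define key where "key = (\<lambda>(x, y, z). ((z * \<iota> x) mod p ^ j, (y * \<iota> x) mod p))"
  define A where "A = sols12 p a n R"
  define cl where "cl k = {m \<in> A. key m = k}" for k
  define keys where "keys = {0..<p ^ j} \<times> {0..<p}"
  define good where "good = {k \<in> keys. \<forall>x\<in>cl k. \<forall>y\<in>cl k. cross x y = (0, 0, 0)}"
  have pp: "p > 0" "p ^ j > 0" using p by auto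
  have kA: "key m \<in> keys" for m unfolding key_def keys_def using pp by (cases m) auto
  have pj: "p ^ j dvd p ^ n" using n by (intro le_imp_power_dvd) simp
  have pdj: "p dvd p ^ j" using n by (simp add: dvd_power)
  have close: "dvdv (p ^ j) (cross x y)" if h: "x \<in> cl k" "y \<in> cl k" for x y k
  proof -
    obtain x1 x2 x3 where x: "x = (x1, x2, x3)" by (cases x)
    obtain y1 y2 y3 where y: "y = (y1, y2, y3)" by (cases y)
    have nd: "\<not> p dvd x1" "\<not> p dvd x2" "\<not> p dvd y1" using h unfolding cl_def A_def sols12_def x y by auto
    have q: "p ^ j dvd qf (a1, a2, a3) (x1, x2, x3)" "p ^ j dvd qf (a1, a2, a3) (y1, y2, y3)"
      using h pj dvd_trans unfolding cl_def A_def sols12_def sols_def x y a' by blast+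
    have k: "p ^ j dvd x3 * \<iota> x1 - y3 * \<iota> y1" "p dvd x2 * \<iota> x1 - y2 * \<iota> y1"
      using h unfolding cl_def key_def x y by (auto simp flip: mod_eq_dvd_iff)
    have tr: "d dvd s * y1 - t * x1" if "d dvd s * \<iota> x1 - t * \<iota> y1" "d dvd p ^ j" for d s t
    proof -
      have "d dvd \<iota> x1 * x1 - 1" "d dvd \<iota> y1 * y1 - 1" using i nd that(2) dvd_trans by blast+
      hence "d dvd x1 * y1 * (s * \<iota> x1 - t * \<iota> y1) - s * y1 * (\<iota> x1 * x1 - 1) + t * x1 * (\<iota> y1 * y1 - 1)"
        by (rule dvd_add[OF dvd_diff[OF dvd_mult[OF that(1)] dvd_mult] dvd_mult])
      also have "\<dots> = s * y1 - t * x1" by (simp add: algebra_simps)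
      finally show ?thesis .
    qed
    show ?thesis unfolding x y
      by (rule same_key_close[OF p _ q nd tr[OF k(1) dvd_refl] tr[OF k(2) pdj]]) (use a a' in simp)
  qed
  have clA: "cl k \<subseteq> sols p a n R" for k unfolding cl_def A_def sols12_def by auto
  have pos: "R \<ge> 0" using R by simp
  have "A \<subseteq> (\<Union>k\<in>good. cl k) \<union> (\<Union>v\<in>normals b K a V. {m \<in> sols p a n R. dot m v = 0})"
  proof
    fix m assume m: "m \<in> A"
    define k where "k = key m"
    have mk: "m \<in> cl k" using m unfolding cl_def k_def by simp
    show "m \<in> (\<Union>k\<in>good. cl k) \<union> (\<Union>v\<in>normals b K a V. {m \<in> sols p a n R. dot m v = 0})"
    proof (cases "k \<in> good")
      case False
      then obtain x y where xy: "x \<in> cl k" "y \<in> cl k" "cross x y \<noteq> (0, 0, 0)"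
        using kA unfolding good_def k_def by blast
      obtain v g where "prim v" "\<forall>m\<in>cl k. dot m v = 0" "j \<le> g" "real_of_int (p ^ g) * nrm v \<le> 2 * R\<^sup>2"
           "p ^ min (2 * g) (2 * n - 2 * g) dvd qf (dual a) v"
        using class_normal[OF a n(1) pos P clA close[where k = k] xy] by blast
      hence "v \<in> normals b K a V" "dot m v = 0" using N mk by blast+
      thus ?thesis using clA mk by blast
    qed (use mk in blast)
  qed
  moreover have fk: "finite keys" unfolding keys_def by simp
  moreover have fA: "finite A" unfolding A_def sols12_def using finite_sols by auto
  moreover have fg: "finite good" unfolding good_def using fk by auto
  moreover have "finite ((\<Union>k\<in>good. cl k) \<union> (\<Union>v\<in>normals b K a V. {m \<in> sols p a n R. dot m v = 0}))"
    using fg fA finite_sols finite_normals unfolding cl_def by auto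
  ultimately have "card A \<le> card ((\<Union>k\<in>good. cl k) \<union> (\<Union>v\<in>normals b K a V. {m \<in> sols p a n R. dot m v = 0}))"
    by (intro card_mono)
  also have "\<dots> \<le> card (\<Union>k\<in>good. cl k) + card (\<Union>v\<in>normals b K a V. {m \<in> sols p a n R. dot m v = 0})"
    by (rule card_Un_le)
  finally have 1: "real (card A) \<le> real (card (\<Union>k\<in>good. cl k)) + real (card (\<Union>v\<in>normals b K a V. {m \<in> sols p a n R. dot m v = 0}))"
    by simp
  have "real (card (\<Union>k\<in>good. cl k)) \<le> (\<Sum>k\<in>good. 2)"
  proof (rule card_UN_le_real[OF fg])
    fix k assume k: "k \<in> good"
    show "real (card (cl k)) \<le> 2"
    proof (cases "cl k = {}")
      case False
      then obtain m0 where m0: "m0 \<in> cl k" by blast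
      have "prim m" if "m \<in> cl k" for m using that clA unfolding sols_def by blast
      hence "cl k \<subseteq> {m0, scale (-1) m0}"
        using cross_prim_zero m0 k unfolding good_def by blast
      hence "card (cl k) \<le> card {m0, scale (-1) m0}" by (intro card_mono) auto
      also have "\<dots> \<le> 2" by (simp add: card_insert_if)
      finally show ?thesis by simp
    qed simp
  qed
  also have "\<dots> = 2 * real (card good)" by simp
  also have "\<dots> \<le> 2 * real (card keys)" using fk by (simp add: good_def card_mono)
  also have "real (card keys) = real_of_int (p ^ j) * p" unfolding keys_def using pp by (simp add: card_cartesian_product)
  finally have 2: "real (card (\<Union>k\<in>good. cl k)) \<le> 2 * real_of_int (p ^ j) * p" by simp
  have "real (card (\<Union>v\<in>normals b K a V. {m \<in> sols p a n R. dot m v = 0})) \<le> (\<Sum>v\<in>normals b K a V. 28 * V * (1 / nrm v))"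
  proof (rule card_UN_le_real[OF finite_normals])
    fix v assume v: "v \<in> normals b K a V"
    hence pv: "prim v" "real_of_int (nrm v) \<le> V" unfolding normals_def by auto
    have v1: "nrm v \<ge> 1" using pv(1) by (rule prim_nonzero)
    have "real (card {m \<in> sols p a n R. dot m v = 0}) \<le> 2 * (2 + 24 * R\<^sup>2 / (p ^ j * nrm v))"
      using card_plane_solutions[OF p a pv(1), of j n R] n by simp
    also have "24 * R\<^sup>2 / (p ^ j * nrm v) = 12 * V / nrm v" unfolding V by simp
    \<comment> \<open>Since \<open>nrm v \<le> V\<close>, the constant 4 is at most
      \<open>4 * V / nrm v\<close>; this gives \<open>28 = 4 + 24\<close>.\<close>
    also have "2 * (2 + 12 * V / nrm v) \<le> 28 * V * (1 / nrm v)" using v1 pv(2) by (simp add: field_simps)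
    finally show "real (card {m \<in> sols p a n R. dot m v = 0}) \<le> 28 * V * (1 / nrm v)" .
  qed
  also have "\<dots> = 28 * V * (\<Sum>v\<in>normals b K a V. 1 / nrm v)" by (simp only: sum_distrib_left)
  finally show ?thesis using 1 2 unfolding A_def by linarith
qed

end

text \<open>The modulus \<open>p ^ j\<close> is taken of size about \<open>R powr c\<close>, where
  the number of classes and the contribution of the planes have the same order.\<close>

lemma count_bound_step:
  fixes p :: int
  assumes p: "prime p" "p > 2"
    and cb: "count_bound p b C K" and b: "b > 1" and C: "C \<ge> 0" and K: "K \<ge> 0"
  shows "\<exists>C'\<ge>0. \<exists>K'\<ge>0. count_bound p (2 * b / (b + 1)) C' K'"
proof -
  define c where "c = 2 * b / (b + 1)"
  have c1: "c > 1" "c < 2" unfolding c_def using b by (auto simp: field_simps)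
  have cb1: "(2 - c) * b = c" unfolding c_def using b by (simp add: field_simps)
  have cb2: "(2 - c) * (b - 1) = 2 * c - 2" using cb1 by (simp add: algebra_simps)
  \<comment> \<open>The 4 yields \<open>6 * R ^ 3 < p ^ (3 * j)\<close> and
    \<open>2 * V \<le> R powr (2 - c)\<close>; the \<open>sqrt K\<close> makes \<open>p ^ j\<close>
    large enough for the modulus required in \<open>normals\<close>.\<close>
  define \<kappa> where "\<kappa> = max 4 (sqrt K)"
  \<comment> \<open>The first entry forces \<open>2 * j \<le> n\<close>; the second covers normals
    whose exponent is \<open>2 * n - 2 * g\<close>.\<close>
  define K' where "K' = max ((p * \<kappa>)\<^sup>2) (4 * sqrt K)"
  define D where "D = 2 * C / (1 - 2 powr (1 - b))"
  define C' where "C' = 3 * (2 * (p * \<kappa>) * p + 28 * D)"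
  have kap: "\<kappa> \<ge> 4" "\<kappa> \<ge> sqrt K" unfolding \<kappa>_def by auto
  have l1: "2 powr (1 - b) < (1::real)" using b by (simp add: powr_less_one)
  have D: "D \<ge> 0" unfolding D_def using C l1 by simp
  have pr: "real_of_int p \<ge> 1" using p by simp
  have "real (card (sols p a n R)) \<le> C' * R powr c"
    if a: "unitv p a" and R: "R \<ge> 1" and big: "real_of_int (p ^ n) \<ge> K' * R powr (2 * c)" for a n R
  proof -
    have Rc: "R powr c \<ge> R" using powr_mono[of 1 c R] c1 R by simp
    have R2c: "(R powr c)\<^sup>2 = R powr (2 * c)" by (simp add: power2_eq_square flip: powr_add)
    define Y where "Y = \<kappa> * R powr c"
    have Y4: "Y \<ge> 4 * R powr c" unfolding Y_def using kap(1) by (intro mult_right_mono) auto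
    hence "Y > 1" using Rc R by linarith
    then obtain j where j: "j \<ge> 1" "real_of_int (p ^ j) \<ge> Y" "real_of_int (p ^ j) \<le> p * Y"
      using exists_prime_power_between[OF p] by blast
    define P where "P = real_of_int (p ^ j)"
    have P4: "P \<ge> 4 * R powr c" "P \<ge> 4 * R" using j Y4 Rc unfolding P_def by linarith+
    have Ppos: "P > 0" using P4(2) R by linarith
    have "real_of_int (p ^ (2 * j)) = P\<^sup>2" unfolding P_def by (simp add: power_mult mult.commute)
    also have "\<dots> \<le> (p * Y)\<^sup>2" using j Ppos unfolding P_def by (intro power_mono) auto
    also have "\<dots> = (p * \<kappa>)\<^sup>2 * R powr (2 * c)" unfolding Y_def R2c[symmetric] by (simp add: power_mult_distrib)
    also have "\<dots> \<le> K' * R powr (2 * c)" unfolding K'_def by (intro mult_right_mono) auto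
    also have "\<dots> \<le> real_of_int (p ^ n)" by (rule big)
    finally have "p ^ (2 * j) \<le> p ^ n" by (simp only: of_int_le_iff)
    hence n: "2 * j \<le> n" using p by (intro power_le_imp_le_exp[of p]) auto
    have P3: "6 * R ^ 3 < real_of_int (p ^ (3 * j))"
    proof -
      have "6 * R ^ 3 < (4 * R) ^ 3" using R by (simp add: power_mult_distrib)
      also have "\<dots> \<le> P ^ 3" using P4 R by (intro power_mono) auto
      also have "\<dots> = real_of_int (p ^ (3 * j))" unfolding P_def by (simp add: power_mult mult.commute flip: power_mult)
      finally show ?thesis .
    qed
    define V where "V = 2 * R\<^sup>2 / real_of_int (p ^ j)"
    have Vpos: "V > 0" unfolding V_def using R Ppos unfolding P_def by simp
    have V2: "2 * V \<le> R powr (2 - c)"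
    proof -
      have "2 * V \<le> 4 * R\<^sup>2 / (4 * R powr c)"
        unfolding V_def using P4(1) R Ppos unfolding P_def by (simp add: field_simps)
      also have "\<dots> = R powr (2 - c)" using R by (simp add: powr_diff)
      finally show ?thesis .
    qed
    have N: "v \<in> normals p b K a' V"
      if v: "prim v" and g: "j \<le> g" "real_of_int (p ^ g) * nrm v \<le> 2 * R\<^sup>2"
        and d: "p ^ min (2 * g) (2 * n - 2 * g) dvd qf (dual a') v" for v g a'
    proof -
      define w where "w = real_of_int (nrm v)"
      define G where "G = real_of_int (p ^ g)"
      have w1: "w \<ge> 1" unfolding w_def using prim_nonzero[OF v] by simp
      have PG: "P \<le> G" unfolding P_def G_def using g(1) p by (simp add: power_increasing)
      have Gpos: "G > 0" using PG Ppos by linarith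
      have "P * w \<le> G * w" using PG w1 by (intro mult_right_mono) auto
      hence wV: "w \<le> V" using g(2) Ppos unfolding V_def P_def[symmetric] G_def[symmetric] w_def[symmetric]
        by (simp add: field_simps)
      hence w2: "2 * w \<le> R powr (2 - c)" using V2 by linarith
      \<comment> \<open>The square root of the modulus demanded by \<open>normals\<close>. As the
        available exponent is a minimum of two even numbers, it suffices to bound \<open>s\<close>
        by \<open>p ^ g\<close> and by \<open>p ^ n / p ^ g\<close>.\<close>
      define s where "s = sqrt K * (2 * w) powr b"
      have s0: "s \<ge> 0" unfolding s_def using K by simp
      have "s \<le> \<kappa> * (R powr (2 - c)) powr b" unfolding s_def
        using kap w1 w2 b by (intro mult_mono powr_mono2) auto
      also have "\<dots> = Y" unfolding Y_def by (simp add: powr_powr cb1)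
      finally have sG: "s \<le> G" using j PG unfolding P_def by linarith
      \<comment> \<open>One factor \<open>2 * w\<close> is split off, because
        \<open>p ^ g * w\<close> is bounded by \<open>2 * R\<^sup>2\<close> while
        \<open>p ^ g\<close> alone has no useful upper bound.\<close>
      have "(2 * w) powr b = (2 * w) * (2 * w) powr (b - 1)"
        using w1 powr_add[of "2 * w" 1 "b - 1"] by simp
      also have "\<dots> \<le> (2 * w) * (R powr (2 - c)) powr (b - 1)"
        using w1 w2 b by (intro mult_left_mono powr_mono2) auto
      also have "\<dots> = 2 * w * R powr (2 * c - 2)" by (simp add: powr_powr cb2)
      finally have "s \<le> sqrt K * (2 * w * R powr (2 * c - 2))" unfolding s_def using K by (intro mult_left_mono) auto
      hence "G * s \<le> G * (sqrt K * (2 * w * R powr (2 * c - 2)))" using Gpos by (intro mult_left_mono) auto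
      also have "\<dots> = 2 * sqrt K * R powr (2 * c - 2) * (G * w)" by (simp add: mult_ac)
      also have "\<dots> \<le> 2 * sqrt K * R powr (2 * c - 2) * (2 * R\<^sup>2)"
        using g(2) K unfolding G_def w_def by (intro mult_left_mono) auto
      also have "\<dots> = 4 * sqrt K * R powr (2 * c)" using R by (simp add: powr_diff)
      also have "\<dots> \<le> K' * R powr (2 * c)" unfolding K'_def by (intro mult_right_mono) auto
      also have "\<dots> \<le> real_of_int (p ^ n)" by (rule big)
      finally have sn: "s \<le> real_of_int (p ^ n) / G" using Gpos by (simp add: field_simps)
      have ss: "K * (2 * real_of_int (nrm v)) powr (2 * b) = s\<^sup>2"
      proof -
        have "(2 * w) powr (2 * b) = ((2 * w) powr b)\<^sup>2" by (simp add: power2_eq_square flip: powr_add)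
        thus ?thesis unfolding s_def w_def using K by (simp add: power_mult_distrib)
      qed
      have "s\<^sup>2 \<le> real_of_int (p ^ min (2 * g) (2 * n - 2 * g))"
      proof (cases "2 * g \<le> 2 * n - 2 * g")
        case True
        have "s\<^sup>2 \<le> G\<^sup>2" using sG s0 by (intro power_mono) auto
        also have "\<dots> = real_of_int (p ^ (2 * g))" unfolding G_def by (simp add: power_mult mult.commute)
        finally show ?thesis using True by (simp add: min_def)
      next
        case False
        hence m: "min (2 * g) (2 * n - 2 * g) = 2 * (n - g)" by linarith
        have "real_of_int (p ^ n) / G \<le> real_of_int (p ^ (n - g))"
        proof -
          have "p ^ n \<le> p ^ ((n - g) + g)" using p by (intro power_increasing) auto
          hence "real_of_int (p ^ n) \<le> real_of_int (p ^ (n - g) * p ^ g)" by (simp only: of_int_le_iff power_add)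
          thus ?thesis using Gpos unfolding G_def by (simp add: field_simps)
        qed
        hence "s\<^sup>2 \<le> (real_of_int (p ^ (n - g)))\<^sup>2" using sn s0 by (intro power_mono) auto
        also have "\<dots> = real_of_int (p ^ (2 * (n - g)))" by (simp add: power_mult mult.commute)
        finally show ?thesis unfolding m .
      qed
      hence "\<exists>e. K * (2 * real_of_int (nrm v)) powr (2 * b) \<le> real_of_int (p ^ e) \<and> p ^ e dvd qf (dual a') v"
        using d unfolding ss by blast
      thus ?thesis using v wV unfolding normals_def[OF p] w_def by blast
    qed
    have n1: "n \<ge> 1" using n j by linarith
    have s12: "real (card (sols12 p a' n R)) \<le> (2 * (p * \<kappa>) * p + 28 * D) * R powr c" if a': "unitv p a'" for a'
    proof -
      have "real (card (sols12 p a' n R)) \<le> 2 * real_of_int (p ^ j) * p + 28 * V * (\<Sum>v\<in>normals p b K a' V. 1 / nrm v)"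
        by (rule card_sols12_decomp[OF p a' n j(1) R P3 V_def N])
      also have "\<dots> \<le> 2 * (p * Y) * p + 28 * V * (D * V powr (b - 1))"
        unfolding D_def using j p Vpos sum_normals_le[OF p cb b C K a' Vpos]
        by (intro add_mono mult_right_mono mult_left_mono) auto
      also have "28 * V * (D * V powr (b - 1)) = 28 * D * V powr b"
        using Vpos powr_add[of V 1 "b - 1"] by simp
      also have "2 * (p * Y) * p + 28 * D * V powr b \<le> 2 * (p * Y) * p + 28 * D * R powr c"
      proof -
        have "V powr b \<le> (R powr (2 - c)) powr b" using Vpos V2 b by (intro powr_mono2) auto
        also have "\<dots> = R powr c" by (simp add: powr_powr cb1)
        finally show ?thesis using D by (intro add_left_mono mult_left_mono) auto
      qed
      finally show ?thesis by (simp add: Y_def algebra_simps)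
    qed
    have "real (card (sols p a n R)) \<le> 3 * ((2 * (p * \<kappa>) * p + 28 * D) * R powr c)"
      by (rule card_sols_le[OF p a n1 s12])
    thus ?thesis unfolding C'_def by (simp only: mult.assoc)
  qed
  hence "count_bound p c C' K'" unfolding count_bound_def by blast
  moreover have "C' \<ge> 0" unfolding C'_def using D pr kap by simp
  moreover have "K' \<ge> 0" unfolding K'_def by (simp add: le_max_iff_disj)
  ultimately show ?thesis unfolding c_def by blast
qed

text \<open>The exponents are 2, 4/3, 8/7. Stopping at 4/3 would give
  \<open>7/18 * 4/3 = 14/27\<close>, slightly above 1/2.\<close>

lemma count_bound_8_7:
  fixes p :: int
  assumes p: "prime p" "p > 2"
  shows "\<exists>C\<ge>0. \<exists>K\<ge>0. count_bound p (8 / 7) C K"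
proof -
  obtain C K where 1: "C \<ge> 0" "K \<ge> 0" "count_bound p (4 / 3) C K"
    using count_bound_step[OF p count_bound_trivial[OF p]] p by auto
  obtain C' K' where 2: "C' \<ge> 0" "K' \<ge> 0" "count_bound p (8 / 7) C' K'"
    using count_bound_step[OF p 1(3) _ 1(1,2)] by auto
  thus ?thesis by blast
qed

section \<open>Exponential sums over the zeros\<close>

text \<open>The terms with \<open>w x \<noteq> 1\<close> cancel, because \<open>1 / (w x - 1)\<close> is invariant under \<open>f\<close>.\<close>

lemma sum_twist:
  fixes g w :: "'a \<Rightarrow> complex"
  assumes S: "finite S" and f: "f ` S \<subseteq> S" "inj_on f S"
    and g: "\<And>x. x \<in> S \<Longrightarrow> g (f x) = g x * w x" and w: "\<And>x. x \<in> S \<Longrightarrow> w (f x) = w x"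
  shows "sum g S = sum g {x \<in> S. w x = 1}"
proof -
  define T where "T = {x \<in> S. w x \<noteq> 1}"
  have fT: "finite T" unfolding T_def using S by simp
  have sub: "f ` T \<subseteq> T" unfolding T_def using f(1) w by auto
  have inj: "inj_on f T" using f(2) unfolding T_def by (rule inj_on_subset) auto
  have "bij_betw f T T" unfolding bij_betw_def using inj sub fT by (simp add: endo_inj_surj)
  hence "(\<Sum>x\<in>T. g (f x) / (w (f x) - 1)) = (\<Sum>x\<in>T. g x / (w x - 1))"
    by (rule sum.reindex_bij_betw)
  moreover have "(\<Sum>x\<in>T. g (f x) / (w (f x) - 1)) - (\<Sum>x\<in>T. g x / (w x - 1)) = (\<Sum>x\<in>T. g x)"
    unfolding sum_subtractf[symmetric]
  proof (rule sum.cong[OF refl])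
    fix x assume "x \<in> T"
    hence x: "x \<in> S" "w x - 1 \<noteq> 0" unfolding T_def by auto
    have "g (f x) / (w (f x) - 1) - g x / (w x - 1) = g x * (w x - 1) / (w x - 1)"
      using g[OF x(1)] w[OF x(1)] by (simp add: diff_divide_distrib[symmetric] algebra_simps)
    thus "g (f x) / (w (f x) - 1) - g x / (w x - 1) = g x" using x(2) by simp
  qed
  ultimately have "(\<Sum>x\<in>T. g x) = 0" by simp
  moreover have "S = T \<union> {x \<in> S. w x = 1}" "T \<inter> {x \<in> S. w x = 1} = {}" unfolding T_def by auto
  ultimately show ?thesis using S by (metis (no_types, lifting) add_0 sum.union_disjoint finite_Un)
qed

section \<open>Additive characters and residue vectors\<close>

definition ez :: "int \<Rightarrow> int \<Rightarrow> complex" where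
  "ez q d = cis (2 * pi * real_of_int d / real_of_int q)"

lemma ez_add: "ez q (c + d) = ez q c * ez q d"
  unfolding ez_def by (simp add: cis_mult add_divide_distrib ring_distribs)

lemma norm_ez [simp]: "norm (ez q d) = 1"
  unfolding ez_def by simp

lemma ez_eq_1_iff:
  assumes "q > 0"
  shows "ez q d = 1 \<longleftrightarrow> q dvd d"
proof
  assume "q dvd d"
  then obtain k where "d = q * k" by blast
  hence "2 * pi * real_of_int d / real_of_int q = 2 * pi * real_of_int k" using assms by simp
  thus "ez q d = 1" unfolding ez_def by (metis Ints_of_int cis_multiple_2pi)
next
  assume "ez q d = 1"
  hence "cos (2 * pi * real_of_int d / real_of_int q) = 1"
    unfolding ez_def by (metis cis.simps(1) one_complex.simps(1))
  then obtain n :: int where "2 * pi * real_of_int d / real_of_int q = real_of_int n * 2 * pi"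
    using cos_one_2pi_int by blast
  hence "(2 * pi) * (real_of_int d / real_of_int q) = (2 * pi) * real_of_int n" by (simp add: mult_ac)
  hence "real_of_int d / real_of_int q = n" by (subst (asm) mult_left_cancel) auto
  hence "real_of_int d = real_of_int (q * n)" using assms by (simp add: field_simps)
  thus "q dvd d" by (metis of_int_eq_iff dvd_triv_left)
qed

lemma ez_cong:
  assumes "q > 0" "q dvd c - d"
  shows "ez q c = ez q d"
proof -
  have "ez q c = ez q d * ez q (c - d)" using ez_add[of q d "c - d"] by simp
  thus ?thesis using assms by (simp add: ez_eq_1_iff)
qed

text \<open>Half the gradient of the form: tangent vectors at \<open>x\<close> are those orthogonal
  to \<open>lin a x\<close>.\<close>

fun lin :: "ivec \<Rightarrow> ivec \<Rightarrow> ivec" where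
  "lin (a1, a2, a3) (x1, x2, x3) = (a1 * x1, a2 * x2, a3 * x3)"

fun redv :: "int \<Rightarrow> ivec \<Rightarrow> ivec" where
  "redv q (x1, x2, x3) = (x1 mod q, x2 mod q, x3 mod q)"

fun unitc :: "int \<Rightarrow> ivec \<Rightarrow> bool" where
  "unitc p (x1, x2, x3) \<longleftrightarrow> \<not> p dvd x1 \<and> \<not> p dvd x2 \<and> \<not> p dvd x3"

fun boxed :: "int \<Rightarrow> ivec \<Rightarrow> bool" where
  "boxed q (x1, x2, x3) \<longleftrightarrow> 0 \<le> x1 \<and> x1 < q \<and> 0 \<le> x2 \<and> x2 < q \<and> 0 \<le> x3 \<and> x3 < q"

definition zeros :: "int \<Rightarrow> ivec \<Rightarrow> nat \<Rightarrow> ivec set" where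
  "zeros p a n = {x. boxed (p ^ n) x \<and> unitc p x \<and> p ^ n dvd qf a x}"

definition expsum :: "int \<Rightarrow> ivec \<Rightarrow> nat \<Rightarrow> ivec \<Rightarrow> complex" where
  "expsum p a n m = (\<Sum>x\<in>zeros p a n. ez (p ^ n) (dot m x))"

lemma finite_boxed: "finite {x. boxed q x}"
proof (rule finite_subset)
  show "{x. boxed q x} \<subseteq> {0..<q} \<times> {0..<q} \<times> {0..<q}"
  proof
    fix x assume "x \<in> {x. boxed q x}"
    thus "x \<in> {0..<q} \<times> {0..<q} \<times> {0..<q}" by (cases x) simp
  qed
qed simp

lemma finite_zeros: "finite (zeros p a n)"
  unfolding zeros_def by (rule finite_subset[OF _ finite_boxed[of "p ^ n"]]) auto

lemma redv_cong: "dvdv q (redv q x - x)"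
  by (cases x) (simp add: mod_eq_dvd_iff[symmetric])

lemma boxed_redv: "q > 0 \<Longrightarrow> boxed q (redv q x)"
  by (cases x) simp

lemma boxed_cong_eq:
  assumes "boxed q x" "boxed q y" "dvdv q (x - y)"
  shows "x = y"
proof -
  obtain x1 x2 x3 where x: "x = (x1, x2, x3)" by (cases x)
  obtain y1 y2 y3 where y: "y = (y1, y2, y3)" by (cases y)
  have "x1 mod q = y1 mod q" "x2 mod q = y2 mod q" "x3 mod q = y3 mod q"
    using assms(3) unfolding x y by (simp_all add: mod_eq_dvd_iff)
  thus ?thesis using assms(1,2) unfolding x y by simp
qed

lemma dvdv_trans: "c dvd d \<Longrightarrow> dvdv d x \<Longrightarrow> dvdv c x"
  by (cases x) (auto intro: dvd_trans)

lemma dvdv_add: "dvdv d x \<Longrightarrow> dvdv d y \<Longrightarrow> dvdv d (x + y)"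
  by (cases x; cases y) simp

lemma dvdv_diff: "dvdv d x \<Longrightarrow> dvdv d y \<Longrightarrow> dvdv d (x - y)"
  by (cases x; cases y) simp

lemma dvdv_diff_commute: "dvdv d (x - y) \<longleftrightarrow> dvdv d (y - x)"
  by (cases x; cases y) (simp add: dvd_diff_commute)

lemma dvdv_dot: "dvdv d x \<Longrightarrow> d dvd dot e x"
  by (cases x; cases e) simp

lemma dvdv_scale2: "dvdv d x \<Longrightarrow> dvdv d (scale c x)"
  by (cases x) simp

lemma scale_scale: "scale c (scale d x) = scale (c * d) x"
  by (cases x) simp

lemma scale_diff: "scale c (x - y) = scale c x - scale c y"
  by (cases x; cases y) (simp add: algebra_simps)

lemma lin_diff: "lin a (x - y) = lin a x - lin a y"
  by (cases a; cases x; cases y) (simp add: algebra_simps)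

lemma cross_diff_left: "cross (x - y) z = cross x z - cross y z"
  by (cases x; cases y; cases z) (simp add: algebra_simps)

lemma dvdv_lin: "dvdv d x \<Longrightarrow> dvdv d (lin a x)"
  by (cases x; cases a) simp

lemma dvdv_cross: "dvdv d x \<Longrightarrow> dvdv d (cross x y)"
  by (cases x; cases y) simp

lemma unitc_cong: "dvdv p (x - y) \<Longrightarrow> unitc p x \<Longrightarrow> unitc p y"
  by (cases x; cases y) (auto simp: dvd_diff_left_iff dvd_diff_right_iff; metis dvd_diff_right_iff)

lemma qf_cong: "dvdv d (x - y) \<Longrightarrow> d dvd qf a x - qf a y"
proof -
  assume h: "dvdv d (x - y)"
  have "qf a x - qf a y = dot (lin a (x + y)) (x - y)"
    by (cases a; cases x; cases y) (simp add: power2_eq_square algebra_simps)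
  thus ?thesis using dvdv_dot[OF h] by simp
qed

section \<open>Cancellation from tangential translations\<close>

context
  fixes p :: int
  assumes p: "prime p" "p > 2"
begin

text \<open>The translation adds \<open>p ^ h\<close> times the tangent vector
  \<open>cross e (lin a x)\<close>; the linear term of the form vanishes and the quadratic one is
  divisible by \<open>p ^ (2 * h)\<close>, hence by \<open>p ^ n\<close>. The character picks up a
  factor depending only on \<open>x\<close> modulo \<open>p ^ h\<close>, so \<open>sum_twist\<close>
  retains the points where it is 1. The general set \<open>S\<close> allows several directions
  \<open>e\<close> to be used in succession.\<close>

lemma sum_zeros_shift:
  assumes k: "k \<le> h" "k + h = n" "h \<ge> 1"
    and S: "S \<subseteq> zeros p a n" "\<And>x y. x \<in> S \<Longrightarrow> y \<in> zeros p a n \<Longrightarrow> dvdv (p ^ h) (x - y) \<Longrightarrow> y \<in> S"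
  shows "(\<Sum>x\<in>S. ez (p ^ n) (dot m x)) = (\<Sum>x\<in>{x \<in> S. p ^ k dvd dot e (cross (lin a x) m)}. ez (p ^ n) (dot m x))"
proof -
  define q where "q = p ^ n"
  define H where "H = p ^ h"
  have qpos: "q > 0" unfolding q_def using p by simp
  have qH: "q dvd H * H" unfolding q_def H_def power_add[symmetric] using k by (intro le_imp_power_dvd) simp
  have Hq: "H dvd q" unfolding q_def H_def using k by (intro le_imp_power_dvd) simp
  have kH: "p ^ k dvd H" unfolding H_def using k by (intro le_imp_power_dvd) simp
  have qkH: "q = H * p ^ k" unfolding q_def H_def power_add[symmetric] using k by (simp add: add.commute)
  have pH: "p dvd H" unfolding H_def using k by (simp add: dvd_power)
  define W where "W x = cross e (lin a x)" for x
  define F where "F x = redv q (x + scale H (W x))" for x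
  define w where "w x = ez q (H * dot e (cross (lin a x) m))" for x
  have Fq: "dvdv q (F x - (x + scale H (W x)))" for x unfolding F_def by (rule redv_cong)
  have FH: "dvdv H (F x - x)" for x
  proof -
    have "dvdv H ((F x - (x + scale H (W x))) + scale H (W x))"
      by (intro dvdv_add dvdv_trans[OF Hq Fq] dvdv_scale) simp
    thus ?thesis by (simp add: algebra_simps)
  qed
  have Fz: "F x \<in> zeros p a n" if x: "x \<in> zeros p a n" for x
  proof -
    have "qf a (x + scale H (W x)) = qf a x + (H * H) * qf a (W x)"
      unfolding W_def by (cases a; cases x; cases e) (simp add: power2_eq_square algebra_simps)
    moreover have "q dvd qf a x" using x unfolding zeros_def q_def by simp
    ultimately have "q dvd qf a (x + scale H (W x))" using qH by simp
    hence "q dvd qf a (F x)" using qf_cong[OF Fq[of x], of a] by (metis dvd_diff_left_iff)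
    moreover have "unitc p (F x)"
    proof (rule unitc_cong)
      show "dvdv p (x - F x)" using dvdv_trans[OF pH FH[of x]] by (simp add: dvdv_diff_commute)
      show "unitc p x" using x unfolding zeros_def by simp
    qed
    moreover have "boxed q (F x)" unfolding F_def using qpos by (rule boxed_redv)
    ultimately show ?thesis unfolding zeros_def q_def by simp
  qed
  have FS: "F ` S \<subseteq> S"
    using S Fz FH unfolding H_def by (metis (no_types, lifting) dvdv_diff_commute image_subsetI subsetD)
  have inj: "inj_on F S"
  proof (rule inj_onI)
    fix x y assume h: "x \<in> S" "y \<in> S" "F x = F y"
    have "dvdv H ((F y - y) - (F x - x))" by (intro dvdv_diff FH)
    hence xy: "dvdv H (x - y)" using h(3) by simp
    then obtain d where d: "x - y = scale H d"
      by (cases "x - y") (auto elim!: dvdE, metis scale.simps)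
    \<comment> \<open>Equal images already agree modulo \<open>H\<close>, so their tangent vectors
      differ by a multiple of \<open>H\<close>; after multiplication by \<open>H\<close> this is
      invisible modulo \<open>q\<close>.\<close>
    have "W x - W y = scale H (W d)"
      unfolding W_def cross_diff[symmetric] lin_diff[symmetric] d
      by (cases e; cases a; cases d) (simp add: algebra_simps)
    hence "x - y + scale H (W x) - scale H (W y) = x - y + scale (H * H) (W d)"
      by (simp add: scale_diff[symmetric] scale_scale add_diff_eq[symmetric])
    moreover have "dvdv q ((F y - (y + scale H (W y))) - (F x - (x + scale H (W x))))"
      by (intro dvdv_diff Fq)
    ultimately have "dvdv q (x - y + scale (H * H) (W d))" using h(3) by (simp add: algebra_simps)
    hence "dvdv q ((x - y + scale (H * H) (W d)) - scale (H * H) (W d))"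
      by (intro dvdv_diff dvdv_scale qH)
    hence "dvdv q (x - y)" by simp
    thus "x = y" using boxed_cong_eq h S(1) unfolding zeros_def q_def by blast
  qed
  have g: "ez q (dot m (F x)) = ez q (dot m x) * w x" for x
  proof -
    have "dot m (F x) - (dot m x + H * dot e (cross (lin a x) m)) = dot m (F x - (x + scale H (W x)))"
      unfolding W_def by (cases m; cases "F x"; cases x; cases a; cases e) (simp add: algebra_simps)
    hence "q dvd dot m (F x) - (dot m x + H * dot e (cross (lin a x) m))"
      using dvdv_dot[OF Fq] by simp
    thus ?thesis unfolding w_def using ez_cong[OF qpos] ez_add by metis
  qed
  have w: "w (F x) = w x" for x
  proof -
    have "dvdv H (cross (lin a (F x)) m - cross (lin a x) m)"
      unfolding cross_diff_left[symmetric] lin_diff[symmetric] by (intro dvdv_cross dvdv_lin FH)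
    hence "H dvd dot e (cross (lin a (F x)) m) - dot e (cross (lin a x) m)"
      unfolding dot_diff[symmetric] by (rule dvdv_dot)
    hence "H * H dvd H * dot e (cross (lin a (F x)) m) - H * dot e (cross (lin a x) m)"
      unfolding right_diff_distrib[symmetric] by (intro mult_dvd_mono dvd_refl)
    thus ?thesis unfolding w_def using qH dvd_trans by (intro ez_cong[OF qpos]) blast
  qed
  have "{x \<in> S. w x = 1} = {x \<in> S. p ^ k dvd dot e (cross (lin a x) m)}"
    unfolding w_def ez_eq_1_iff[OF qpos] using qkH qpos by auto
  moreover have "finite S" using S(1) finite_zeros finite_subset by blast
  ultimately show ?thesis
    using sum_twist[of S F "\<lambda>x. ez q (dot m x)" w, OF _ FS inj g w] unfolding q_def by simp
qed

end

section \<open>Dilations and the bound for a single exponential sum\<close>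

context
  fixes p :: int
  assumes p: "prime p" "p > 2"
begin

lemma dvdv_scale_unit:
  assumes "dvdv (p ^ n) (scale c x)" "\<not> p dvd c"
  shows "dvdv (p ^ n) x"
proof -
  obtain x1 x2 x3 where x: "x = (x1, x2, x3)" by (cases x)
  have "p ^ n dvd c * x1" "p ^ n dvd c * x2" "p ^ n dvd c * x3" using assms(1) unfolding x by auto
  hence "p ^ n dvd x1" "p ^ n dvd x2" "p ^ n dvd x3"
    using prime_pow_dvd_mult_unit[OF p(1) _ assms(2)] by blast+
  thus ?thesis unfolding x by simp
qed

text \<open>The zeros are stable under multiplication by units, and
  \<open>1 + p ^ (n - i - 1)\<close> changes the character by a factor that is 1 exactly when
  \<open>p ^ Suc i\<close> divides \<open>dot m x\<close>. Each application gains one power of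
  \<open>p\<close>.\<close>

lemma sum_zeros_dilate:
  fixes a m :: ivec
  assumes i: "i + 2 \<le> n" and k: "k \<le> n"
  defines "S \<equiv> \<lambda>i. {x \<in> zeros p a n. dvdv (p ^ k) (cross (lin a x) m) \<and> p ^ i dvd dot m x}"
  shows "(\<Sum>x\<in>S i. ez (p ^ n) (dot m x)) = (\<Sum>x\<in>S (Suc i). ez (p ^ n) (dot m x))"
proof -
  define q where "q = p ^ n"
  \<comment> \<open>The bound \<open>i + 2 \<le> n\<close> makes \<open>t\<close> divisible by
    \<open>p\<close>, so that \<open>1 + t\<close> is a unit, and \<open>t * t * p ^ i\<close>
    divisible by \<open>q\<close>, so that the twist is invariant.\<close>
  define t where "t = p ^ (n - i - 1)"
  define c where "c = 1 + t"
  have qpos: "q > 0" unfolding q_def using p by simp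
  have kq: "p ^ k dvd q" unfolding q_def using k by (intro le_imp_power_dvd)
  have iq: "p ^ i dvd q" unfolding q_def using i by (intro le_imp_power_dvd) simp
  have pq: "p dvd q" unfolding q_def using i by (simp add: dvd_power)
  have pt: "p dvd t" unfolding t_def using i by (simp add: dvd_power)
  have pc: "\<not> p dvd c" unfolding c_def using pt not_prime_unit[of p] p(1)
    by (metis dvd_add_left_iff)
  have qt: "q = t * p ^ Suc i" unfolding q_def t_def power_add[symmetric] using i by simp
  have qtt: "q dvd t * t * p ^ i" unfolding q_def t_def power_add[symmetric]
    using i by (intro le_imp_power_dvd) simp
  have tn0: "t \<noteq> 0" unfolding t_def using p by simp
  define F where "F x = redv q (scale c x)" for x
  define w where "w x = ez q (t * dot m x)" for x
  have Fq: "dvdv q (F x - scale c x)" for x unfolding F_def by (rule redv_cong)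
  have dF: "q dvd dot m (F x) - c * dot m x" for x
    using dvdv_dot[OF Fq] by (metis dot_diff dot_scale)
  have FS: "F ` S i \<subseteq> S i"
  proof (rule image_subsetI)
    fix x assume x: "x \<in> S i"
    have "q dvd qf a (scale c x)" using x unfolding S_def zeros_def q_def qf_scale by simp
    hence 1: "q dvd qf a (F x)" using qf_cong[OF Fq[of x], of a] by (metis dvd_diff_left_iff)
    have "unitc p (scale c x)"
      using x pc unfolding S_def zeros_def by (cases x) (simp add: pdvd_mult[OF p])
    moreover have "dvdv p (scale c x - F x)" using dvdv_trans[OF pq Fq] by (simp add: dvdv_diff_commute)
    ultimately have 2: "unitc p (F x)" by (rule unitc_cong[rotated])
    have 3: "boxed q (F x)" unfolding F_def using qpos by (rule boxed_redv)
    have "dvdv (p ^ k) (cross (lin a (F x - scale c x)) m)"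
      using dvdv_trans[OF kq Fq] by (intro dvdv_cross dvdv_lin)
    moreover have "dvdv (p ^ k) (scale c (cross (lin a x) m))"
      using x unfolding S_def by (intro dvdv_scale2) blast
    ultimately have "dvdv (p ^ k) (cross (lin a (F x - scale c x)) m + scale c (cross (lin a x) m))"
      by (rule dvdv_add)
    also have "cross (lin a (F x - scale c x)) m + scale c (cross (lin a x) m) = cross (lin a (F x)) m"
      by (cases a; cases "F x"; cases x; cases m) (simp add: algebra_simps)
    finally have 4: "dvdv (p ^ k) (cross (lin a (F x)) m)" .
    have "p ^ i dvd c * dot m x" using x unfolding S_def by simp
    hence 5: "p ^ i dvd dot m (F x)" using dF[of x] iq by (metis dvd_diff_left_iff dvd_trans)
    show "F x \<in> S i" unfolding S_def zeros_def using 1 2 3 4 5 q_def by simp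
  qed
  have inj: "inj_on F (S i)"
  proof (rule inj_onI)
    fix x y assume h: "x \<in> S i" "y \<in> S i" "F x = F y"
    have "dvdv q ((F y - scale c y) - (F x - scale c x))" by (intro dvdv_diff Fq)
    hence "dvdv q (scale c (x - y))" using h(3) by (simp add: scale_diff)
    hence "dvdv q (x - y)" using pc unfolding q_def by (rule dvdv_scale_unit)
    thus "x = y" using boxed_cong_eq h unfolding S_def zeros_def q_def by blast
  qed
  have g: "ez q (dot m (F x)) = ez q (dot m x) * w x" for x
  proof -
    have "c * dot m x = dot m x + t * dot m x" unfolding c_def by (simp add: algebra_simps)
    thus ?thesis unfolding w_def using ez_cong[OF qpos dF[of x]] ez_add by metis
  qed
  have w: "w (F x) = w x" if x: "x \<in> S i" for x
  proof -
    have "q dvd t * (dot m (F x) - c * dot m x)" using dF by simp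
    moreover have "q dvd t * t * dot m x"
    proof -
      have "t * t * p ^ i dvd t * t * dot m x" using x unfolding S_def by (intro mult_dvd_mono) auto
      thus ?thesis using qtt dvd_trans by blast
    qed
    ultimately have "q dvd t * (dot m (F x) - c * dot m x) + t * t * dot m x" by (rule dvd_add)
    also have "\<dots> = t * dot m (F x) - t * dot m x" unfolding c_def by (simp add: algebra_simps)
    finally show ?thesis unfolding w_def by (rule ez_cong[OF qpos])
  qed
  have "p ^ Suc i dvd d \<Longrightarrow> p ^ i dvd d" for d by (metis dvd_mult_right power_Suc)
  moreover have "q dvd t * d \<longleftrightarrow> p ^ Suc i dvd d" for d unfolding qt using tn0 by (simp del: power_Suc)
  ultimately have "{x \<in> S i. w x = 1} = S (Suc i)"
    unfolding w_def ez_eq_1_iff[OF qpos] S_def by blast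
  moreover have "finite (S i)" unfolding S_def using finite_zeros by auto
  ultimately show ?thesis
    using sum_twist[of "S i" F "\<lambda>x. ez q (dot m x)" w, OF _ FS inj g w] unfolding q_def by simp
qed

text \<open>Shifts along the three coordinate vectors force \<open>lin a x\<close> to be parallel to
  \<open>m\<close> modulo \<open>p ^ k\<close>; \<open>n - 1\<close> dilations then force
  \<open>p ^ (n - 1)\<close> to divide \<open>dot m x\<close>. The terms left over are bounded
  trivially.\<close>

lemma norm_expsum_le:
  fixes a m :: ivec
  assumes k: "k \<le> h" "k + h = n" "h \<ge> 1"
  shows "norm (expsum p a n m) \<le>
    real (card {x \<in> zeros p a n. dvdv (p ^ k) (cross (lin a x) m) \<and> p ^ (n - 1) dvd dot m x})"
proof -
  define C where "C x = cross (lin a x) m" for x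
  define Z where "Z = zeros p a n"
  have cl: "p ^ k dvd dot e (C y)" if "p ^ k dvd dot e (C x)" "dvdv (p ^ h) (x - y)" for e x y
  proof -
    have "p ^ k dvd p ^ h" using k(1) by (rule le_imp_power_dvd)
    hence "dvdv (p ^ k) (x - y)" using that(2) by (rule dvdv_trans)
    hence "dvdv (p ^ k) (C x - C y)"
      unfolding C_def cross_diff_left[symmetric] lin_diff[symmetric] by (intro dvdv_cross dvdv_lin)
    hence "p ^ k dvd dot e (C x) - dot e (C y)" unfolding dot_diff[symmetric] by (rule dvdv_dot)
    thus ?thesis using that(1) by (metis dvd_diff_right_iff)
  qed
  define Z1 where "Z1 = {x \<in> Z. p ^ k dvd dot (1,0,0) (C x)}"
  define Z2 where "Z2 = {x \<in> Z1. p ^ k dvd dot (0,1,0) (C x)}"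
  define Z3 where "Z3 = {x \<in> Z2. p ^ k dvd dot (0,0,1) (C x)}"
  let ?s = "\<lambda>S. \<Sum>x\<in>S. ez (p ^ n) (dot m x)"
  have "?s Z = ?s Z1" unfolding Z1_def C_def
    by (rule sum_zeros_shift[OF p k]) (simp_all add: Z_def)
  also have "\<dots> = ?s Z2" unfolding Z2_def C_def
  proof (rule sum_zeros_shift[OF p k])
    show "Z1 \<subseteq> zeros p a n" unfolding Z1_def Z_def by blast
    show "y \<in> Z1" if "x \<in> Z1" "y \<in> zeros p a n" "dvdv (p ^ h) (x - y)" for x y
      using that cl[OF _ that(3)] unfolding Z1_def Z_def by blast
  qed
  also have "\<dots> = ?s Z3" unfolding Z3_def C_def
  proof (rule sum_zeros_shift[OF p k])
    show "Z2 \<subseteq> zeros p a n" unfolding Z2_def Z1_def Z_def by blast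
    show "y \<in> Z2" if "x \<in> Z2" "y \<in> zeros p a n" "dvdv (p ^ h) (x - y)" for x y
      using that cl[OF _ that(3)] unfolding Z2_def Z1_def Z_def by blast
  qed
  finally have 1: "?s Z = ?s Z3" .
  have dc: "dvdv d y \<longleftrightarrow> d dvd dot (1,0,0) y \<and> d dvd dot (0,1,0) y \<and> d dvd dot (0,0,1) y" for d y
    by (cases y) simp
  define S where "S i = {x \<in> zeros p a n. dvdv (p ^ k) (cross (lin a x) m) \<and> p ^ i dvd dot m x}" for i
  have "x \<in> Z3 \<longleftrightarrow> x \<in> S 0" for x
    unfolding Z3_def Z2_def Z1_def S_def Z_def C_def using dc[of "p ^ k" "cross (lin a x) m"] by simp
  hence Z3: "Z3 = S 0" by blast
  have 2: "i \<le> n - 1 \<Longrightarrow> ?s (S i) = ?s (S 0)" for i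
  proof (induction i)
    case (Suc i)
    have "?s (S i) = ?s (S (Suc i))" unfolding S_def
      by (rule sum_zeros_dilate) (use Suc k in auto)
    thus ?case using Suc by simp
  qed simp
  have "expsum p a n m = ?s (S (n - 1))"
    unfolding expsum_def using 1 2[of "n - 1"] Z3 Z_def by simp
  hence "norm (expsum p a n m) \<le> (\<Sum>x\<in>S (n - 1). norm (ez (p ^ n) (dot m x)))"
    by (simp only: norm_sum)
  also have "\<dots> = card (S (n - 1))" by simp
  finally show ?thesis unfolding S_def .
qed

text \<open>The dual form at \<open>lin a x\<close> is a multiple of \<open>qf a x\<close>, so it
  nearly vanishes at vectors parallel to it. Beyond multiples of \<open>dot m x\<close> and
  \<open>qf a x\<close>, the entries of the cross product enter only through their squares; hence
  \<open>r\<close> may reach \<open>2 * l\<close> and not just \<open>l\<close>.\<close>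

lemma parallel_zero_dual:
  assumes a: "unitv p a" and x: "x \<in> zeros p a n"
    and c: "dvdv (p ^ l) (cross (lin a x) m)" and d: "p ^ r dvd dot m x" and r: "r \<le> 2 * l" "r \<le> n"
  shows "p ^ r dvd qf (dual a) m"
proof -
  obtain a1 a2 a3 where a': "a = (a1, a2, a3)" by (cases a)
  obtain x1 x2 x3 where x': "x = (x1, x2, x3)" by (cases x)
  obtain m1 m2 m3 where m': "m = (m1, m2, m3)" by (cases m)
  define c2 c3 where "c2 = a3 * x3 * m1 - a1 * x1 * m3" and "c3 = a1 * x1 * m2 - a2 * x2 * m1"
  have cc: "p ^ l dvd c2" "p ^ l dvd c3" using c unfolding a' x' m' c2_def c3_def by auto
  have "p ^ r dvd p ^ l * p ^ l" unfolding power_add[symmetric] using r by (intro le_imp_power_dvd) simp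
  hence sq: "p ^ r dvd c2\<^sup>2" "p ^ r dvd c3\<^sup>2"
    unfolding power2_eq_square using cc by (meson dvd_trans mult_dvd_mono)+
  have "p ^ n dvd qf a x" using x unfolding zeros_def by simp
  hence q: "p ^ r dvd qf a x" using r le_imp_power_dvd dvd_trans by blast
  have nd: "\<not> p dvd (a1 * x1)\<^sup>2"
    using a x unfolding a' x' zeros_def unitv_iff[OF p] by (simp add: pdvd_sq[OF p] pdvd_mult[OF p])
  have "(a1 * x1)\<^sup>2 * qf (dual a) m = (2 * a1 * x1 * m1 * (a1 * a2 * a3)) * dot m x
      - (m1\<^sup>2 * (a1 * a2 * a3)) * qf a x + ((a1 * a2) * c2\<^sup>2 + (a1 * a3) * c3\<^sup>2)"
    unfolding a' x' m' c2_def c3_def by (simp add: power2_eq_square algebra_simps)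
  moreover have "p ^ r dvd \<dots>"
    by (intro dvd_add[OF dvd_diff[OF dvd_mult[OF d] dvd_mult[OF q]] dvd_add[OF dvd_mult[OF sq(1)] dvd_mult[OF sq(2)]]])
  ultimately show ?thesis using prime_pow_dvd_mult_unit[OF p(1) _ nd] by metis
qed

text \<open>Given \<open>x1\<close>, parallelism to \<open>m\<close> fixes the other entries modulo
  \<open>p ^ l\<close>. The quotient of \<open>x2\<close> by \<open>p ^ l\<close> is still free, and
  then the form determines \<open>x3\<close> uniquely by lifting.\<close>

lemma card_parallel_zeros:
  assumes a: "unitv p a" and m: "\<not> dvdv p m" and l: "1 \<le> l" "l \<le> n"
  shows "real (card {x \<in> zeros p a n. dvdv (p ^ l) (cross (lin a x) m)}) \<le> real_of_int (p ^ (2 * n - l))"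
proof -
  obtain a1 a2 a3 where a': "a = (a1, a2, a3)" by (cases a)
  obtain m1 m2 m3 where m': "m = (m1, m2, m3)" by (cases m)
  define S where "S = {x \<in> zeros p a n. dvdv (p ^ l) (cross (lin a x) m)}"
  define f where "f = (\<lambda>(x1::int, x2, x3::int). (x1, x2 div p ^ l))"
  have u: "\<not> p dvd a1" "\<not> p dvd a2" "\<not> p dvd a3" using a unfolding a' unitv_iff[OF p] by auto
  have pl: "p dvd p ^ l" using l by (simp add: dvd_power)
  have pos: "p ^ l > 0" "p ^ (n - l) > 0" "p ^ n > 0" using p by auto
  have pn: "p ^ n = p ^ (n - l) * p ^ l" using l by (simp flip: power_add)
  have S: "\<not> p dvd x1 \<and> \<not> p dvd x3 \<and> p ^ l dvd a1 * x1 * m2 - a2 * x2 * m1 \<and> p ^ l dvd a3 * x3 * m1 - a1 * x1 * m3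
      \<and> p ^ n dvd a1 * x1\<^sup>2 + a2 * x2\<^sup>2 + a3 * x3\<^sup>2 \<and> boxed (p ^ n) (x1, x2, x3)"
    if "(x1, x2, x3) \<in> S" for x1 x2 x3
    using that unfolding S_def zeros_def a' m' by auto
  have inj: "inj_on f S"
  proof (rule inj_onI)
    fix x y assume h: "x \<in> S" "y \<in> S" "f x = f y"
    obtain x1 x2 x3 where x: "x = (x1, x2, x3)" by (cases x)
    obtain y2 y3 where y: "y = (x1, y2, y3)" and quo: "x2 div p ^ l = y2 div p ^ l"
      using h(3) unfolding f_def x by (cases y) auto
    note Sx = S[OF h(1)[unfolded x]] and Sy = S[OF h(2)[unfolded y]]
    have m1: "\<not> p dvd m1"
    proof
      assume m1: "p dvd m1"
      have "p dvd a1 * x1 * m2 - a2 * x2 * m1" "p dvd a3 * x3 * m1 - a1 * x1 * m3"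
        using Sx pl dvd_trans by blast+
      hence "p dvd a1 * x1 * m2" "p dvd a1 * x1 * m3"
        using m1 by (simp_all add: dvd_diff_left_iff dvd_diff_right_iff)
      thus False using m m1 u Sx unfolding m' by (simp add: pdvd_mult[OF p])
    qed
    have "p ^ l dvd (a1 * x1 * m2 - a2 * y2 * m1) - (a1 * x1 * m2 - a2 * x2 * m1)"
      by (rule dvd_diff) (use Sx Sy in blast)+
    also have "\<dots> = (a2 * m1) * (x2 - y2)" by (simp add: algebra_simps)
    finally have "p ^ l dvd x2 - y2"
      using prime_pow_dvd_mult_unit[OF p(1)] u m1 pdvd_mult[OF p] by blast
    hence "x2 mod p ^ l = y2 mod p ^ l" by (simp add: mod_eq_dvd_iff)
    hence e2: "x2 = y2" using quo by (metis div_mult_mod_eq)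
    have "p ^ l dvd (a3 * x3 * m1 - a1 * x1 * m3) - (a3 * y3 * m1 - a1 * x1 * m3)"
      by (rule dvd_diff) (use Sx Sy in blast)+
    also have "\<dots> = (a3 * m1) * (x3 - y3)" by (simp add: algebra_simps)
    finally have "p ^ l dvd x3 - y3"
      using prime_pow_dvd_mult_unit[OF p(1)] u m1 pdvd_mult[OF p] by blast
    hence d3: "p dvd x3 - y3" using pl dvd_trans by blast
    have "p ^ n dvd (a1 * x1\<^sup>2 + a2 * x2\<^sup>2 + a3 * x3\<^sup>2) - (a1 * x1\<^sup>2 + a2 * y2\<^sup>2 + a3 * y3\<^sup>2)"
      using Sx Sy by (intro dvd_diff) auto
    also have "\<dots> = a3 * (x3\<^sup>2 - y3\<^sup>2)" unfolding e2 by (simp add: algebra_simps)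
    finally have "p ^ n dvd x3 - y3" using square_congruence_lift[OF p] u d3 Sx by blast
    hence "x3 mod p ^ n = y3 mod p ^ n" by (simp add: mod_eq_dvd_iff)
    hence "x3 = y3" using Sx Sy by simp
    thus "x = y" using x y e2 by simp
  qed
  have "f ` S \<subseteq> {0..<p ^ n} \<times> {0..<p ^ (n - l)}"
  proof (rule image_subsetI)
    fix x assume h: "x \<in> S"
    obtain x1 x2 x3 where x: "x = (x1, x2, x3)" by (cases x)
    have b: "0 \<le> x1" "x1 < p ^ n" "0 \<le> x2" "x2 < p ^ n" using S[OF h[unfolded x]] by auto
    have "x2 div p ^ l < p ^ (n - l)"
    proof (rule ccontr)
      assume "\<not> ?thesis"
      hence "p ^ (n - l) * p ^ l \<le> (x2 div p ^ l) * p ^ l" using pos by (intro mult_right_mono) auto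
      moreover have "(x2 div p ^ l) * p ^ l + x2 mod p ^ l = x2" by (rule div_mult_mod_eq)
      moreover have "x2 mod p ^ l \<ge> 0" using pos by simp
      ultimately show False using b pn by linarith
    qed
    moreover have "0 \<le> x2 div p ^ l" using b pos by (simp add: pos_imp_zdiv_nonneg_iff)
    ultimately show "f x \<in> {0..<p ^ n} \<times> {0..<p ^ (n - l)}" unfolding f_def x using b by simp
  qed
  hence "card S \<le> card ({0..<p ^ n} \<times> {0..<p ^ (n - l)})" by (intro card_inj_on_le[OF inj]) auto
  also have "real \<dots> = real_of_int (p ^ n * p ^ (n - l))" using pos by (simp add: card_cartesian_product)
  also have "p ^ n * p ^ (n - l) = p ^ (2 * n - l)" using l by (simp add: mult_2 flip: power_add)
  finally show ?thesis unfolding S_def by simp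
qed

text \<open>A common factor \<open>p ^ i\<close> of the frequency weakens the parallelism condition
  by \<open>i\<close> digits: the bound grows by \<open>p ^ i\<close> and the modulus for the dual
  form shrinks by \<open>p ^ (2 * i)\<close>.\<close>

lemma norm_expsum_le_power:
  assumes a: "unitv p a" and n: "n \<ge> 2" and m: "\<not> dvdv p m" and i: "i < n div 2"
    and nz: "expsum p a n (scale (p ^ i) m) \<noteq> 0"
  shows "p ^ (n - 1 - 2 * i) dvd qf (dual a) m"
    and "norm (expsum p a n (scale (p ^ i) m)) \<le> real_of_int (p ^ (2 * n - n div 2 + i))"
proof -
  define k where "k = n div 2"
  define T where "T = {x \<in> zeros p a n. dvdv (p ^ k) (cross (lin a x) (scale (p ^ i) m)) \<and> p ^ (n - 1) dvd dot (scale (p ^ i) m) x}"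
  have k: "k \<le> n - k" "k + (n - k) = n" "n - k \<ge> 1" "2 * k + 1 \<ge> n" unfolding k_def using n by auto
  have le: "norm (expsum p a n (scale (p ^ i) m)) \<le> card T"
    unfolding T_def by (rule norm_expsum_le[OF k(1-3)])
  have dc: "dvdv (p ^ (k - i)) (cross (lin a x) m)" if h: "x \<in> T" for x
  proof -
    have "cross (lin a x) (scale (p ^ i) m) = scale (p ^ i) (cross (lin a x) m)"
      by (cases a; cases x; cases m) (simp add: algebra_simps)
    hence "dvdv (p ^ i * p ^ (k - i)) (scale (p ^ i) (cross (lin a x) m))"
      using h i unfolding T_def k_def power_add[symmetric] by simp
    thus ?thesis using p by (cases "cross (lin a x) m") simp
  qed
  have dd: "p ^ (n - 1 - i) dvd dot m x" if h: "x \<in> T" for x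
  proof -
    have "dot (scale (p ^ i) m) x = p ^ i * dot m x" by (metis dot_commute dot_scale)
    moreover have "n - 1 = i + (n - 1 - i)" using i n by linarith
    ultimately have "p ^ i * p ^ (n - 1 - i) dvd p ^ i * dot m x"
      using h unfolding T_def power_add[symmetric] by simp
    thus ?thesis using p by simp
  qed
  have "T \<noteq> {}" using le nz by auto
  then obtain x where x: "x \<in> T" by blast
  show "p ^ (n - 1 - 2 * i) dvd qf (dual a) m"
  proof (rule parallel_zero_dual[OF a _ dc[OF x]])
    show "x \<in> zeros p a n" using x unfolding T_def by simp
    show "p ^ (n - 1 - 2 * i) dvd dot m x" using dd[OF x] dvd_trans[OF le_imp_power_dvd[of "n - 1 - 2 * i" "n - 1 - i" p]] by simp
  qed (use k in auto)
  have "card T \<le> card {x \<in> zeros p a n. dvdv (p ^ (k - i)) (cross (lin a x) m)}"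
  proof (rule card_mono)
    show "finite {x \<in> zeros p a n. dvdv (p ^ (k - i)) (cross (lin a x) m)}" using finite_zeros by simp
    show "T \<subseteq> {x \<in> zeros p a n. dvdv (p ^ (k - i)) (cross (lin a x) m)}" using dc unfolding T_def by blast
  qed
  also have "real \<dots> \<le> real_of_int (p ^ (2 * n - (k - i)))"
    by (rule card_parallel_zeros[OF a m]) (use i in \<open>auto simp: k_def\<close>)
  also have "2 * n - (k - i) = 2 * n - n div 2 + i" using i unfolding k_def by linarith
  finally show "norm (expsum p a n (scale (p ^ i) m)) \<le> real_of_int (p ^ (2 * n - n div 2 + i))" using le by linarith
qed

end

section \<open>Summation of the exponential sums over small frequencies\<close>

context
  fixes p :: int
  assumes p: "prime p" "p > 2"
begin

text \<open>A content \<open>g\<close> prime to \<open>p\<close> can be cancelled from the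
  congruence and leaves a primitive zero of height \<open>R / g\<close>. Summing the primitive
  bounds over \<open>g\<close> converges because \<open>b > 1\<close>.\<close>

lemma card_nonprimitive_le:
  fixes R :: real
  assumes cb: "count_bound p b C K" and b: "b > 1" and C: "C \<ge> 0" and K: "K \<ge> 0"
    and a: "unitv p a" and big: "real_of_int (p ^ r) \<ge> K * R powr (2 * b)" and R: "R \<ge> 0"
  shows "real (card {m. \<not> dvdv p m \<and> real_of_int (nrm m) \<le> R \<and> p ^ r dvd qf a m})
           \<le> C * (\<Sum>g. real g powr (- b)) * R powr b"
proof -
  define I where "I = {1..nat \<lfloor>R\<rfloor>}"
  have sub: "{m. \<not> dvdv p m \<and> real_of_int (nrm m) \<le> R \<and> p ^ r dvd qf a m}
      \<subseteq> (\<Union>g\<in>I. scale (int g) ` sols p a r (R / real g))"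
  proof
    fix m assume "m \<in> {m. \<not> dvdv p m \<and> real_of_int (nrm m) \<le> R \<and> p ^ r dvd qf a m}"
    hence m: "\<not> dvdv p m" "real_of_int (nrm m) \<le> R" "p ^ r dvd qf a m" by auto
    have "m \<noteq> (0, 0, 0)" using m(1) by auto
    then obtain g v where v: "g \<ge> 1" "prim v" "m = scale g v" using prim_factor by blast
    have g: "\<not> p dvd g" using m(1) dvdv_scale v(3) by blast
    have "p ^ r dvd g\<^sup>2 * qf a v" using m(3) v(3) by (simp add: qf_scale)
    hence d: "p ^ r dvd qf a v" using prime_pow_dvd_mult_unit[OF p(1)] g pdvd_sq[OF p] by blast
    have n: "real_of_int g * real_of_int (nrm v) \<le> R" using m(2) v(1) unfolding v(3) nrm_scale by simp
    have "real_of_int g * 1 \<le> real_of_int g * real_of_int (nrm v)"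
      using v(1) prim_nonzero[OF v(2)] by (intro mult_left_mono) auto
    hence "real_of_int g \<le> R" using n by linarith
    hence gI: "nat g \<in> I" unfolding I_def using v(1) by (auto simp: le_floor_iff nat_le_eq_zle)
    have "real_of_int (nrm v) \<le> R / real (nat g)" using n v(1) by (simp add: field_simps)
    hence "v \<in> sols p a r (R / real (nat g))" using v d unfolding sols_def by simp
    hence "m \<in> scale (int (nat g)) ` sols p a r (R / real (nat g))" using v(1,3) by simp
    thus "m \<in> (\<Union>g\<in>I. scale (int g) ` sols p a r (R / real g))" using gI by blast
  qed
  have "card {m. \<not> dvdv p m \<and> real_of_int (nrm m) \<le> R \<and> p ^ r dvd qf a m}
      \<le> card (\<Union>g\<in>I. scale (int g) ` sols p a r (R / real g))"
    using sub finite_sols by (intro card_mono) (auto simp: I_def)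
  also have "real \<dots> \<le> (\<Sum>g\<in>I. C * (R powr b * real g powr (- b)))"
  proof (rule card_UN_le_real)
    fix g assume g: "g \<in> I"
    have g1: "real g \<ge> 1" "real g \<le> R" using g R unfolding I_def by (auto simp: le_nat_iff le_floor_iff)
    have "real (card (scale (int g) ` sols p a r (R / real g))) \<le> real (card (sols p a r (R / real g)))"
      using card_image_le[OF finite_sols] by simp
    also have "\<dots> \<le> C * (R / real g) powr b"
    proof -
      have "K * (R / real g) powr (2 * b) \<le> K * R powr (2 * b)"
        using g1 b K R by (intro mult_left_mono powr_mono2) (auto simp: field_simps mult_le_cancel_left1)
      hence "K * (R / real g) powr (2 * b) \<le> real_of_int (p ^ r)" using big by linarith
      moreover have "R / real g \<ge> 1" using g1 by simp
      ultimately show ?thesis using cb a unfolding count_bound_def by blast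
    qed
    also have "(R / real g) powr b = R powr b * real g powr (- b)"
      using g1 R by (simp add: powr_divide powr_minus_divide)
    finally show "real (card (scale (int g) ` sols p a r (R / real g))) \<le> C * (R powr b * real g powr (- b))" .
  qed (simp add: I_def)
  also have "\<dots> = C * R powr b * (\<Sum>g\<in>I. real g powr (- b))" by (simp add: sum_distrib_left mult_ac)
  also have "\<dots> \<le> C * R powr b * (\<Sum>g. real g powr (- b))"
  proof (intro mult_left_mono sum_le_suminf)
    show "summable (\<lambda>g. real g powr (- b))" using b by (simp add: summable_real_powr_iff)
  qed (use C in \<open>auto simp: I_def\<close>)
  finally show ?thesis by (simp add: mult_ac)
qed

lemma factor_prime_power:
  assumes "m \<noteq> (0, 0, 0)"
  shows "\<exists>i m'. m = scale (p ^ i) m' \<and> \<not> dvdv p m' \<and> p ^ i \<le> nrm m"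
proof -
  obtain g v where v: "g \<ge> 1" "prim v" "m = scale g v" using prim_factor assms by blast
  have nu: "\<not> is_unit p" using p not_prime_unit by blast
  define i where "i = multiplicity p g"
  obtain g' where g': "g = p ^ i * g'" "\<not> p dvd g'"
    using multiplicity_decompose'[of g p] v(1) nu unfolding i_def by (metis not_one_le_zero)
  have g1: "g' \<ge> 1" using v(1) g'(1) p_pos[OF p] by (metis int_one_le_iff_zero_less zero_less_mult_pos zero_less_power)
  have "p ^ i * 1 \<le> p ^ i * (g' * nrm v)"
    using p g1 prim_nonzero[OF v(2)] by (intro mult_left_mono) (auto simp: mult_pos_pos int_one_le_iff_zero_less)
  also have "\<dots> = nrm m" unfolding v(3) nrm_scale using v(1) g'(1) by simp
  finally have "p ^ i \<le> nrm m" by simp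
  moreover have "\<not> dvdv p (scale g' v)" using dvdv_scale_prim[OF v(2)] g'(2) by blast
  moreover have "m = scale (p ^ i) (scale g' v)" unfolding v(3) g'(1) scale_scale ..
  ultimately show ?thesis by blast
qed

text \<open>Frequencies are sorted by the power \<open>p ^ i\<close> they contain, where
  \<open>i < n div 2\<close> as \<open>p ^ i \<le> M\<close>. The loss \<open>p ^ i\<close> in the
  exponential sum is outweighed by the shrinking of the height to \<open>M / p ^ i\<close>, since
  \<open>b > 1\<close>. No \<open>i\<close> costs more than \<open>i = 0\<close>, and the number of
  values of \<open>i\<close> gives the factor \<open>n\<close>.\<close>

lemma sum_norm_expsum_le:
  fixes M :: real
  assumes cb: "count_bound p b C K" and b: "b > 1" and C: "C \<ge> 0" and K: "K \<ge> 0"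
    and a: "unitv p a" and n: "n \<ge> 2" and M: "M \<ge> 0" "M < real_of_int (p ^ (n div 2))"
    and big: "real_of_int (p ^ (n - 1)) \<ge> K * M powr (2 * b)"
  shows "(\<Sum>m | m \<noteq> (0, 0, 0) \<and> real_of_int (nrm m) \<le> M. norm (expsum p a n m))
     \<le> C * (\<Sum>g. real g powr (- b)) * real n * real_of_int (p ^ (2 * n - n div 2)) * M powr b"
proof -
  define k where "k = n div 2"
  define Z where "Z = (\<Sum>g. real g powr (- b))"
  define P where "P = real_of_int p"
  have P1: "P \<ge> 1" unfolding P_def using p by simp
  have Z: "Z \<ge> 0" unfolding Z_def using b by (intro suminf_nonneg) (auto simp: summable_real_powr_iff)
  define T where "T i = {m. \<not> dvdv p m \<and> real_of_int (nrm m) \<le> M / P ^ i}" for i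
  define T' where "T' i = {m. \<not> dvdv p m \<and> real_of_int (nrm m) \<le> M / P ^ i \<and> p ^ (n - 1 - 2 * i) dvd qf (dual a) m}" for i
  define I where "I = Sigma {..<k} T"
  define f where "f = (\<lambda>(i, m). scale (p ^ i) m)"
  have fT: "finite (T i)" for i unfolding T_def by (rule finite_subset[OF _ finite_nrm_le[of "M / P ^ i"]]) auto
  have fI: "finite I" unfolding I_def using fT by auto
  have sub: "{m. m \<noteq> (0, 0, 0) \<and> real_of_int (nrm m) \<le> M} \<subseteq> f ` I"
  proof
    fix m assume "m \<in> {m. m \<noteq> (0, 0, 0) \<and> real_of_int (nrm m) \<le> M}"
    hence m: "m \<noteq> (0, 0, 0)" "real_of_int (nrm m) \<le> M" by auto
    obtain i m' where i: "m = scale (p ^ i) m'" "\<not> dvdv p m'" "p ^ i \<le> nrm m" using factor_prime_power[OF m(1)] by blast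
    have "real_of_int (p ^ i) < real_of_int (p ^ k)" using i(3) m(2) M(2) unfolding k_def by linarith
    hence "p ^ i < p ^ k" by (simp only: of_int_less_iff)
    hence ik: "i < k" using p by (intro power_less_imp_less_exp[of p]) auto
    have "real_of_int (p ^ i) * real_of_int (nrm m') \<le> M" using m(2) p unfolding i(1) nrm_scale by simp
    hence "m' \<in> T i" unfolding T_def P_def using i(2) p by (simp add: field_simps)
    thus "m \<in> f ` I" unfolding f_def I_def using ik i(1) by force
  qed
  have "(\<Sum>m | m \<noteq> (0, 0, 0) \<and> real_of_int (nrm m) \<le> M. norm (expsum p a n m)) \<le> (\<Sum>m\<in>f ` I. norm (expsum p a n m))"
    using sub fI by (intro sum_mono2) auto
  also have "\<dots> \<le> (\<Sum>z\<in>I. norm (expsum p a n (f z)))"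
    using sum_image_le[OF fI, of "\<lambda>m. norm (expsum p a n m)" f] by (simp add: o_def)
  also have "\<dots> = (\<Sum>i<k. \<Sum>m\<in>T i. norm (expsum p a n (scale (p ^ i) m)))"
    unfolding I_def f_def using fT by (subst sum.Sigma) (auto intro!: sum.cong)
  also have "\<dots> \<le> (\<Sum>i<k. C * Z * real_of_int (p ^ (2 * n - k)) * M powr b)"
  proof (rule sum_mono)
    fix i assume "i \<in> {..<k}"
    hence i: "i < n div 2" unfolding k_def by simp
    have "(\<Sum>m\<in>T i. norm (expsum p a n (scale (p ^ i) m))) = (\<Sum>m\<in>T' i. norm (expsum p a n (scale (p ^ i) m)))"
    proof (rule sum.mono_neutral_right[OF fT])
      show "T' i \<subseteq> T i" unfolding T_def T'_def by blast
      show "\<forall>m\<in>T i - T' i. norm (expsum p a n (scale (p ^ i) m)) = 0"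
        using norm_expsum_le_power(1)[OF p a n _ i] unfolding T_def T'_def by auto
    qed
    also have "\<dots> \<le> (\<Sum>m\<in>T' i. real_of_int (p ^ (2 * n - k + i)))"
    proof (rule sum_mono)
      fix m assume "m \<in> T' i"
      hence "\<not> dvdv p m" unfolding T'_def by blast
      thus "norm (expsum p a n (scale (p ^ i) m)) \<le> real_of_int (p ^ (2 * n - k + i))"
        using norm_expsum_le_power(2)[OF p a n _ i, of m] p unfolding k_def
        by (cases "expsum p a n (scale (p ^ i) m) = 0") auto
    qed
    also have "\<dots> = real (card (T' i)) * (real_of_int (p ^ (2 * n - k)) * P ^ i)"
      by (simp add: power_add P_def)
    also have "\<dots> \<le> (C * Z * (M / P ^ i) powr b) * (real_of_int (p ^ (2 * n - k)) * P ^ i)"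
    proof (rule mult_right_mono)
      have Pi: "P ^ i \<ge> 1" using P1 by (rule one_le_power)
      show "real (card (T' i)) \<le> C * Z * (M / P ^ i) powr b"
        unfolding T'_def Z_def
      proof (rule card_nonprimitive_le[OF cb b C K unitv_dual[OF a]])
        \<comment> \<open>Shrinking the height divides the required modulus by at least
          \<open>P ^ (2 * i)\<close>, exactly what the weaker congruence for the dual form has
          lost.\<close>
        have "(M / P ^ i) powr (2 * b) = M powr (2 * b) / (P ^ i) powr (2 * b)"
          using M Pi by (simp add: powr_divide)
        also have "\<dots> \<le> M powr (2 * b) / (P ^ i) powr 2"
          using Pi P1 b by (intro divide_left_mono powr_mono mult_pos_pos) auto
        also have "(P ^ i) powr 2 = P ^ (2 * i)" using Pi P1 by (simp add: power_mult[symmetric] mult.commute)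
        finally have "K * (M / P ^ i) powr (2 * b) \<le> K * (M powr (2 * b) / P ^ (2 * i))" using K by (rule mult_left_mono)
        also have "\<dots> \<le> real_of_int (p ^ (n - 1)) / P ^ (2 * i)" using big P1 by (simp add: divide_right_mono)
        also have "\<dots> = real_of_int (p ^ (n - 1 - 2 * i))"
        proof -
          have "n - 1 = (n - 1 - 2 * i) + 2 * i" using i n by linarith
          hence "real_of_int (p ^ (n - 1)) = real_of_int (p ^ (n - 1 - 2 * i)) * P ^ (2 * i)"
            unfolding P_def by (metis of_int_mult of_int_power power_add)
          thus ?thesis using P1 by simp
        qed
        finally show "K * (M / P ^ i) powr (2 * b) \<le> real_of_int (p ^ (n - 1 - 2 * i))" .
        show "0 \<le> M / P ^ i" using M P1 by simp
      qed
    qed (use p P1 in auto)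
    also have "\<dots> \<le> C * Z * real_of_int (p ^ (2 * n - k)) * M powr b"
    proof -
      have Pi: "P ^ i \<ge> 1" using P1 by (rule one_le_power)
      have "(M / P ^ i) powr b * P ^ i = M powr b * (P ^ i / (P ^ i) powr b)" using M Pi by (simp add: powr_divide)
      also have "\<dots> \<le> M powr b * 1"
      proof (rule mult_left_mono)
        have "P ^ i \<le> (P ^ i) powr b" using Pi b powr_mono[of 1 b "P ^ i"] by simp
        moreover have "(P ^ i) powr b > 0" using P1 by simp
        ultimately show "P ^ i / (P ^ i) powr b \<le> 1" by (simp add: divide_le_eq_1)
      qed simp
      finally have "C * Z * real_of_int (p ^ (2 * n - k)) * ((M / P ^ i) powr b * P ^ i) \<le> C * Z * real_of_int (p ^ (2 * n - k)) * (M powr b * 1)"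
        using C Z p by (intro mult_left_mono) auto
      thus ?thesis by (simp add: mult_ac)
    qed
    finally show "(\<Sum>m\<in>T i. norm (expsum p a n (scale (p ^ i) m))) \<le> C * Z * real_of_int (p ^ (2 * n - k)) * M powr b" .
  qed
  also have "\<dots> = real k * (C * Z * real_of_int (p ^ (2 * n - k)) * M powr b)" by simp
  also have "\<dots> \<le> real n * (C * Z * real_of_int (p ^ (2 * n - k)) * M powr b)"
    using C Z p unfolding k_def by (intro mult_right_mono) auto
  finally show ?thesis unfolding k_def Z_def by (simp add: mult_ac)
qed

end

section \<open>The number of zeros\<close>

context
  fixes p :: int
  assumes p: "prime p" "p > 2"
begin

section \<open>Legendre symbols and points on conics modulo p\<close>

lemma Legendre_cong: "[a = b] (mod p) \<Longrightarrow> Legendre a p = Legendre b p"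
proof -
  assume h: "[a = b] (mod p)"
  hence "[a = 0] (mod p) \<longleftrightarrow> [b = 0] (mod p)" "[y = a] (mod p) \<longleftrightarrow> [y = b] (mod p)" for y
    by (meson cong_sym cong_trans)+
  thus ?thesis unfolding Legendre_def QuadRes_def by simp
qed

lemma Legendre_values: "Legendre a p \<in> {-1, 0, 1}"
  unfolding Legendre_def by auto

lemma Legendre_eq_0_iff: "Legendre a p = 0 \<longleftrightarrow> p dvd a"
  unfolding Legendre_def by (simp add: cong_0_iff)

text \<open>Euler's criterion gives the identity modulo \<open>p\<close>; both sides have absolute
  value at most 1, so they cannot differ by a nonzero multiple of \<open>p > 2\<close>.\<close>

lemma Legendre_mult: "Legendre (a * b) p = Legendre a p * Legendre b p"
proof -
  have E: "[Legendre x p = x ^ ((nat p - 1) div 2)] (mod p)" for x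
    using euler_criterion[of "nat p" x] p by simp
  have "[Legendre (a * b) p = Legendre a p * Legendre b p] (mod p)"
    using E[of "a * b"] cong_mult[OF E[of a] E[of b]] by (simp add: power_mult_distrib) (metis cong_sym cong_trans)
  hence "p dvd Legendre (a * b) p - Legendre a p * Legendre b p" by (simp add: cong_iff_dvd_diff)
  moreover have "\<bar>Legendre (a * b) p - Legendre a p * Legendre b p\<bar> < p"
    using Legendre_values[of "a * b"] Legendre_values[of a] Legendre_values[of b] p by auto
  ultimately show ?thesis using zdvd_not_zless[of "\<bar>Legendre (a * b) p - Legendre a p * Legendre b p\<bar>" p] by force
qed

lemma Legendre_square: "\<not> p dvd x \<Longrightarrow> Legendre (x\<^sup>2) p = 1"
  unfolding Legendre_def QuadRes_def using cong_refl[of "x\<^sup>2" p] pdvd_sq[OF p, of x]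
  by (metis cong_0_iff)

lemma residue_inverse: "\<not> p dvd a \<Longrightarrow> \<exists>b. [a * b = 1] (mod p)"
  using cong_solve_coprime_int[of a p] coprime_prime_iff[OF p(1)] by blast

lemma residue_eq: "x \<in> {0..<p} \<Longrightarrow> y \<in> {0..<p} \<Longrightarrow> p dvd x - y \<Longrightarrow> x = y"
  by (metis atLeastLessThan_iff mod_eq_dvd_iff mod_pos_pos_trivial)

lemma card_square_roots: "int (card {z \<in> {0..<p}. p dvd z\<^sup>2 - c}) = 1 + Legendre c p"
proof (cases "p dvd c")
  case True
  have "p dvd z\<^sup>2 - c \<longleftrightarrow> p dvd z" for z using True by (simp add: dvd_diff_left_iff pdvd_sq[OF p])
  hence "{z \<in> {0..<p}. p dvd z\<^sup>2 - c} = {0}" using p residue_eq[of _ 0] by auto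
  thus ?thesis using True Legendre_eq_0_iff by simp
next
  case False
  show ?thesis
  proof (cases "QuadRes p c")
    case True
    then obtain y where "[y\<^sup>2 = c] (mod p)" unfolding QuadRes_def by blast
    hence y: "p dvd y\<^sup>2 - c" by (simp add: cong_iff_dvd_diff)
    define r where "r = y mod p"
    have ry: "p dvd r - y" unfolding r_def by (simp add: mod_eq_dvd_iff[symmetric])
    have r: "r \<in> {0..<p}" unfolding r_def using p by simp
    have "p dvd (r + y) * (r - y) + (y\<^sup>2 - c)" using ry y by (intro dvd_add dvd_mult)
    also have "(r + y) * (r - y) + (y\<^sup>2 - c) = r\<^sup>2 - c" by (simp add: power2_eq_square algebra_simps)
    finally have rc: "p dvd r\<^sup>2 - c" .
    have r0: "\<not> p dvd r" using rc False by (metis dvd_diff_right_iff dvd_mult2 power2_eq_square)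
    have "{z \<in> {0..<p}. p dvd z\<^sup>2 - c} = {r, p - r}"
    proof
      show "{z \<in> {0..<p}. p dvd z\<^sup>2 - c} \<subseteq> {r, p - r}"
      proof
        fix z assume "z \<in> {z \<in> {0..<p}. p dvd z\<^sup>2 - c}"
        hence z: "z \<in> {0..<p}" "p dvd z\<^sup>2 - c" by auto
        have "p dvd (z\<^sup>2 - c) - (r\<^sup>2 - c)" using z(2) rc by (rule dvd_diff)
        also have "(z\<^sup>2 - c) - (r\<^sup>2 - c) = (z - r) * (z + r)" by (simp add: power2_eq_square algebra_simps)
        finally have "p dvd z - r \<or> p dvd z + r" by (simp add: pdvd_mult[OF p])
        thus "z \<in> {r, p - r}"
        proof
          assume "p dvd z - r" thus ?thesis using residue_eq z(1) r by blast
        next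
          assume h: "p dvd z + r"
          have "r \<noteq> 0" using r0 by auto
          hence "p - r \<in> {0..<p}" using r by auto
          moreover have "p dvd z - (p - r)" using h by (simp add: dvd_diff_left_iff algebra_simps)
          ultimately show ?thesis using residue_eq z(1) by blast
        qed
      qed
      have "r \<noteq> 0" using r0 by auto
      moreover have "p dvd (p - r)\<^sup>2 - c"
      proof -
        have "p dvd p * (p - 2 * r) + (r\<^sup>2 - c)" using rc by (intro dvd_add) auto
        also have "\<dots> = (p - r)\<^sup>2 - c" by (simp add: power2_eq_square algebra_simps)
        finally show ?thesis .
      qed
      ultimately show "{r, p - r} \<subseteq> {z \<in> {0..<p}. p dvd z\<^sup>2 - c}" using r rc by auto
    qed
    moreover have "r \<noteq> p - r"
    proof
      assume "r = p - r"
      hence "p dvd 2 * r" by (simp add: algebra_simps)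
      thus False using r0 not_dvd_2[OF p] by (simp add: pdvd_mult[OF p])
    qed
    ultimately show ?thesis using True False unfolding Legendre_def by (simp add: cong_0_iff)
  next
    case nq: False
    hence e: "{z \<in> {0..<p}. p dvd z\<^sup>2 - c} = {}" unfolding QuadRes_def by (auto simp: cong_iff_dvd_diff)
    show ?thesis unfolding e using nq False unfolding Legendre_def by (simp add: cong_0_iff)
  qed
qed

lemma card_scaled_square_roots:
  assumes "\<not> p dvd a"
  shows "int (card {z \<in> {0..<p}. p dvd a * z\<^sup>2 + c}) = 1 + Legendre (- a * c) p"
proof -
  obtain b where b: "p dvd a * b - 1" using residue_inverse[OF assms] by (auto simp: cong_iff_dvd_diff)
  have eq: "p dvd a * z\<^sup>2 + c \<longleftrightarrow> p dvd (a * z)\<^sup>2 - (- a * c)" for z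
  proof -
    have "(a * z)\<^sup>2 - (- a * c) = a * (a * z\<^sup>2 + c)" by (simp add: power2_eq_square algebra_simps)
    thus ?thesis using assms by (simp add: pdvd_mult[OF p])
  qed
  have sq: "p dvd (x mod p)\<^sup>2 - d \<longleftrightarrow> p dvd x\<^sup>2 - d" for x d
  proof -
    have "p dvd (x mod p)\<^sup>2 - x\<^sup>2" by (simp add: mod_eq_dvd_iff[symmetric] power_mod)
    hence "p dvd (x\<^sup>2 - d) + ((x mod p)\<^sup>2 - x\<^sup>2) \<longleftrightarrow> p dvd x\<^sup>2 - d" by (simp only: dvd_add_left_iff)
    thus ?thesis by simp
  qed
  have "bij_betw (\<lambda>z. (a * z) mod p) {z \<in> {0..<p}. p dvd a * z\<^sup>2 + c} {w \<in> {0..<p}. p dvd w\<^sup>2 - (- a * c)}"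
  proof (rule bij_betw_byWitness[where f' = "\<lambda>w. (b * w) mod p"])
    have id: "(b * ((a * z) mod p)) mod p = z" "(a * ((b * z) mod p)) mod p = z" if z: "z \<in> {0..<p}" for z
    proof -
      have "b * (a * z) - z = (a * b - 1) * z" "a * (b * z) - z = (a * b - 1) * z" by (simp_all add: algebra_simps)
      hence "p dvd b * (a * z) - z" "p dvd a * (b * z) - z" using b by simp_all
      thus "(b * ((a * z) mod p)) mod p = z" "(a * ((b * z) mod p)) mod p = z"
        using z by (simp_all add: mod_mult_right_eq mod_eq_dvd_iff[symmetric])
    qed
    show "\<forall>z\<in>{z \<in> {0..<p}. p dvd a * z\<^sup>2 + c}. (b * ((a * z) mod p)) mod p = z" using id by blast
    show "\<forall>w\<in>{w \<in> {0..<p}. p dvd w\<^sup>2 - (- a * c)}. (a * ((b * w) mod p)) mod p = w" using id by blast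
    show "(\<lambda>z. (a * z) mod p) ` {z \<in> {0..<p}. p dvd a * z\<^sup>2 + c} \<subseteq> {w \<in> {0..<p}. p dvd w\<^sup>2 - (- a * c)}"
    proof (rule image_subsetI)
      fix z assume "z \<in> {z \<in> {0..<p}. p dvd a * z\<^sup>2 + c}"
      hence "p dvd ((a * z) mod p)\<^sup>2 - (- a * c)" unfolding sq eq by blast
      thus "(a * z) mod p \<in> {w \<in> {0..<p}. p dvd w\<^sup>2 - (- a * c)}" using p by simp
    qed
    show "(\<lambda>w. (b * w) mod p) ` {w \<in> {0..<p}. p dvd w\<^sup>2 - (- a * c)} \<subseteq> {z \<in> {0..<p}. p dvd a * z\<^sup>2 + c}"
    proof (rule image_subsetI)
      fix w assume w: "w \<in> {w \<in> {0..<p}. p dvd w\<^sup>2 - (- a * c)}"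
      hence "p dvd ((a * ((b * w) mod p)) mod p)\<^sup>2 - (- a * c)" using id(2)[of w] by simp
      hence "p dvd (a * ((b * w) mod p))\<^sup>2 - (- a * c)" unfolding sq .
      thus "(b * w) mod p \<in> {z \<in> {0..<p}. p dvd a * z\<^sup>2 + c}" unfolding eq using p by simp
    qed
  qed
  hence "card {z \<in> {0..<p}. p dvd a * z\<^sup>2 + c} = card {w \<in> {0..<p}. p dvd w\<^sup>2 - (- a * c)}" by (rule bij_betw_same_card)
  thus ?thesis using card_square_roots[of "- a * c"] by (simp only:)
qed

lemma finite_residues: "finite {z \<in> {0..<p}. P z}"
  by (rule finite_subset[of _ "{0..<p}"]) auto

lemma card_pairs_by_fibres:
  "card {(y, z). y \<in> {0..<p} \<and> z \<in> {0..<p} \<and> P y z} = (\<Sum>y\<in>{0..<p}. card {z \<in> {0..<p}. P y z})"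
proof -
  have "{(y, z). y \<in> {0..<p} \<and> z \<in> {0..<p} \<and> P y z} = Sigma {0..<p} (\<lambda>y. {z \<in> {0..<p}. P y z})" by auto
  thus ?thesis by (simp only:) (rule card_SigmaI; use finite_residues in blast)
qed

text \<open>Counting the hyperbola \<open>z\<^sup>2 - y\<^sup>2 = c\<close> in two ways: by
  \<open>y\<close> it has \<open>p\<close> plus this sum many points, and the nonzero values of
  \<open>z - y\<close> parametrise it, which gives \<open>p - 1\<close>.\<close>

lemma sum_Legendre_quadratic:
  assumes c: "\<not> p dvd c"
  shows "(\<Sum>y\<in>{0..<p}. Legendre (y\<^sup>2 + c) p) = -1"
proof -
  define S where "S = {(y, z). y \<in> {0..<p} \<and> z \<in> {0..<p} \<and> p dvd z\<^sup>2 - (y\<^sup>2 + c)}"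
  have "int (card S) = (\<Sum>y\<in>{0..<p}. int (card {z \<in> {0..<p}. p dvd z\<^sup>2 - (y\<^sup>2 + c)}))"
    unfolding S_def card_pairs_by_fibres by simp
  also have "\<dots> = (\<Sum>y\<in>{0..<p}. 1 + Legendre (y\<^sup>2 + c) p)" by (simp only: card_square_roots)
  also have "\<dots> = p + (\<Sum>y\<in>{0..<p}. Legendre (y\<^sup>2 + c) p)" using p by (simp add: sum.distrib)
  finally have 1: "int (card S) = p + (\<Sum>y\<in>{0..<p}. Legendre (y\<^sup>2 + c) p)" .
  obtain h where h: "p dvd 2 * h - 1" using residue_inverse[OF not_dvd_2[OF p]] by (auto simp: cong_iff_dvd_diff)
  have pp: "p > 0" using p by simp
  define f where "f = (\<lambda>(y, z). (z - y) mod p)"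
  have inj: "inj_on f S"
  proof (rule inj_onI)
    fix s t assume st: "s \<in> S" "t \<in> S" "f s = f t"
    obtain y z where s: "s = (y, z)" by (cases s)
    obtain y' z' where t: "t = (y', z')" by (cases t)
    have d: "p dvd z\<^sup>2 - (y\<^sup>2 + c)" "p dvd z'\<^sup>2 - (y'\<^sup>2 + c)" using st unfolding S_def s t by auto
    have e: "p dvd (z - y) - (z' - y')" using st(3) unfolding f_def s t by (simp add: mod_eq_dvd_iff)
    have nd: "\<not> p dvd z - y"
    proof
      assume "p dvd z - y"
      hence "p dvd (z + y) * (z - y) - (z\<^sup>2 - (y\<^sup>2 + c))" using d dvd_diff[OF dvd_mult] by blast
      also have "\<dots> = c" by (simp add: power2_eq_square algebra_simps)
      finally show False using c by blast
    qed
    have "p dvd (z\<^sup>2 - (y\<^sup>2 + c)) - (z'\<^sup>2 - (y'\<^sup>2 + c)) - (z' + y') * ((z - y) - (z' - y'))"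
      by (rule dvd_diff[OF dvd_diff[OF d] dvd_mult[OF e]])
    also have "\<dots> = (z - y) * ((z + y) - (z' + y'))" by (simp add: power2_eq_square algebra_simps)
    finally have f: "p dvd (z + y) - (z' + y')" using nd by (simp add: pdvd_mult[OF p])
    have "p dvd ((z + y) - (z' + y')) + ((z - y) - (z' - y'))" using f e by (rule dvd_add)
    also have "\<dots> = 2 * (z - z')" by simp
    finally have "p dvd z - z'" using not_dvd_2[OF p] pdvd_mult[OF p] by blast
    hence zz: "z = z'" using st residue_eq unfolding S_def s t by blast
    have "p dvd y - y'" using e unfolding zz by (simp add: dvd_diff_commute)
    hence "y = y'" using st residue_eq unfolding S_def s t by blast
    thus "s = t" using zz s t by simp
  qed
  have "f ` S = {1..<p}"
  proof
    show "f ` S \<subseteq> {1..<p}"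
    proof (rule image_subsetI)
      fix s assume st: "s \<in> S"
      obtain y z where s: "s = (y, z)" by (cases s)
      have d: "p dvd z\<^sup>2 - (y\<^sup>2 + c)" using st unfolding S_def s by auto
      have "\<not> p dvd z - y"
      proof
        assume "p dvd z - y"
        hence "p dvd (z + y) * (z - y) - (z\<^sup>2 - (y\<^sup>2 + c))" using d dvd_diff[OF dvd_mult] by blast
        also have "\<dots> = c" by (simp add: power2_eq_square algebra_simps)
        finally show False using c by blast
      qed
      hence "(z - y) mod p \<noteq> 0" by (simp add: mod_eq_0_iff_dvd)
      moreover have "(z - y) mod p \<ge> 0" "(z - y) mod p < p" using pp by auto
      ultimately show "f s \<in> {1..<p}" unfolding f_def s by auto
    qed
    show "{1..<p} \<subseteq> f ` S"
    proof
      fix u assume u: "u \<in> {1..<p}"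
      have "\<not> p dvd u" using u zdvd_not_zless by auto
      then obtain w where w: "p dvd u * w - 1" using residue_inverse by (auto simp: cong_iff_dvd_diff)
      \<comment> \<open>With \<open>h\<close> as 1/2 and \<open>w\<close> as \<open>1 / u\<close>,
        this solves \<open>z - y = u\<close> and \<open>z + y = c / u\<close>.\<close>
      define z0 y0 where "z0 = h * (c * w + u)" and "y0 = h * (c * w - u)"
      have "z0 - y0 - u = (2 * h - 1) * u" unfolding z0_def y0_def by (simp add: algebra_simps)
      hence zy: "p dvd z0 - y0 - u" using h by simp
      have "z0\<^sup>2 - (y0\<^sup>2 + c) = ((2 * h)\<^sup>2 - 1) * (c * (u * w)) + c * (u * w - 1)"
        unfolding z0_def y0_def by (simp add: power2_eq_square algebra_simps)
      also have "(2 * h)\<^sup>2 - 1 = (2 * h - 1) * (2 * h + 1)" by (simp add: power2_eq_square algebra_simps)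
      finally have d: "p dvd z0\<^sup>2 - (y0\<^sup>2 + c)" using h w by simp
      have z: "p dvd z0 mod p - z0" "p dvd y0 mod p - y0" by (simp_all add: mod_eq_dvd_iff[symmetric])
      have "p dvd (z0 mod p - z0) * (z0 mod p + z0) - (y0 mod p - y0) * (y0 mod p + y0) + (z0\<^sup>2 - (y0\<^sup>2 + c))"
        by (rule dvd_add[OF dvd_diff[OF dvd_mult2[OF z(1)] dvd_mult2[OF z(2)]] d])
      also have "\<dots> = (z0 mod p)\<^sup>2 - ((y0 mod p)\<^sup>2 + c)" by (simp add: power2_eq_square algebra_simps)
      finally have "(y0 mod p, z0 mod p) \<in> S" unfolding S_def using pp by simp
      moreover have "f (y0 mod p, z0 mod p) = u"
      proof -
        have "f (y0 mod p, z0 mod p) = (z0 - y0) mod p" unfolding f_def by (simp add: mod_diff_eq)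
        also have "\<dots> = u mod p" using zy by (simp add: mod_eq_dvd_iff)
        finally show ?thesis using u by simp
      qed
      ultimately show "u \<in> f ` S" by force
    qed
  qed
  hence "card S = card {1..<p}" using card_image[OF inj] by simp
  hence "int (card S) = p - 1" using p by simp
  thus ?thesis using 1 by linarith
qed

text \<open>The affine conic has \<open>p\<close> minus \<open>Legendre (- a2 * a3) p\<close>
  points. Those with \<open>y = 0\<close> or \<open>z = 0\<close> are roots of a single quadratic;
  the two sets are disjoint because \<open>d\<close> is a unit. Removing them produces the remaining
  terms of \<open>s_p\<close>.\<close>

lemma card_conic_units:
  assumes a: "\<not> p dvd a1" "\<not> p dvd a2" "\<not> p dvd a3" and x: "\<not> p dvd x"
  shows "int (card {(y, z). y \<in> {0..<p} \<and> z \<in> {0..<p} \<and> \<not> p dvd y \<and> \<not> p dvd z \<and> p dvd a1 * x\<^sup>2 + a2 * y\<^sup>2 + a3 * z\<^sup>2})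
    = p - s_p p a1 a2 a3"
proof -
  define d where "d = a1 * x\<^sup>2"
  have d: "\<not> p dvd d" unfolding d_def using a x by (simp add: pdvd_mult[OF p] pdvd_sq[OF p])
  define A where "A = {(y, z). y \<in> {0..<p} \<and> z \<in> {0..<p} \<and> p dvd d + a2 * y\<^sup>2 + a3 * z\<^sup>2}"
  define B where "B = {(y, z). y \<in> {0..<p} \<and> z \<in> {0..<p} \<and> \<not> p dvd y \<and> \<not> p dvd z \<and> p dvd d + a2 * y\<^sup>2 + a3 * z\<^sup>2}"
  define Y where "Y = {z \<in> {0..<p}. p dvd a3 * z\<^sup>2 + d}"
  define Z where "Z = {y \<in> {0..<p}. p dvd a2 * y\<^sup>2 + d}"
  obtain b where b: "p dvd a2 * b - 1" using residue_inverse[OF a(2)] by (auto simp: cong_iff_dvd_diff)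
  have nb: "\<not> p dvd b"
  proof
    assume "p dvd b"
    hence "p dvd a2 * b - (a2 * b - 1)" using b dvd_diff[OF dvd_mult] by blast
    hence "is_unit p" by simp
    thus False using not_prime_unit[of p] p by blast
  qed
  have "int (card A) = (\<Sum>y\<in>{0..<p}. int (card {z \<in> {0..<p}. p dvd a3 * z\<^sup>2 + (d + a2 * y\<^sup>2)}))"
    unfolding A_def card_pairs_by_fibres by (simp add: add_ac)
  also have "\<dots> = (\<Sum>y\<in>{0..<p}. 1 + Legendre (- a3 * (d + a2 * y\<^sup>2)) p)"
    by (simp only: card_scaled_square_roots[OF a(3)])
  also have "\<dots> = (\<Sum>y\<in>{0..<p}. 1 + Legendre (- a2 * a3) p * Legendre (y\<^sup>2 + b * d) p)"
  proof (rule sum.cong[OF refl])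
    fix y
    have "- a3 * (d + a2 * y\<^sup>2) - (- a2 * a3) * (y\<^sup>2 + b * d) = (a3 * d) * (a2 * b - 1)"
      by (simp add: algebra_simps)
    hence "p dvd - a3 * (d + a2 * y\<^sup>2) - (- a2 * a3) * (y\<^sup>2 + b * d)" using b by simp
    hence "Legendre (- a3 * (d + a2 * y\<^sup>2)) p = Legendre ((- a2 * a3) * (y\<^sup>2 + b * d)) p"
      by (intro Legendre_cong) (simp only: cong_iff_dvd_diff)
    thus "1 + Legendre (- a3 * (d + a2 * y\<^sup>2)) p = 1 + Legendre (- a2 * a3) p * Legendre (y\<^sup>2 + b * d) p"
      by (simp only: Legendre_mult)
  qed
  also have "\<dots> = p + Legendre (- a2 * a3) p * (\<Sum>y\<in>{0..<p}. Legendre (y\<^sup>2 + b * d) p)"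
    using p by (simp add: sum.distrib sum_distrib_left)
  also have "(\<Sum>y\<in>{0..<p}. Legendre (y\<^sup>2 + b * d) p) = -1"
    by (rule sum_Legendre_quadratic) (use nb d in \<open>simp add: pdvd_mult[OF p]\<close>)
  finally have cA: "int (card A) = p - Legendre (- a2 * a3) p" by simp
  have LL: "Legendre (- c * d) p = Legendre (- a1 * c) p" for c
  proof -
    have e: "- c * d = (- a1 * c) * x\<^sup>2" unfolding d_def by simp
    show ?thesis unfolding e Legendre_mult[of "- a1 * c" "x\<^sup>2"] Legendre_square[OF x] by simp
  qed
  have cY: "int (card Y) = 1 + Legendre (- a1 * a3) p"
    unfolding Y_def card_scaled_square_roots[OF a(3)] LL ..
  have cZ: "int (card Z) = 1 + Legendre (- a1 * a2) p"
    unfolding Z_def card_scaled_square_roots[OF a(2)] LL ..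
  have z0: "w = 0" if "w \<in> {0..<p}" "p dvd w" for w using residue_eq[of w 0] that p by simp
  have "A = B \<union> (Pair 0 ` Y \<union> (\<lambda>y. (y, 0)) ` Z)"
  proof (intro Set.set_eqI)
    fix w :: "int \<times> int"
    obtain y z where w: "w = (y, z)" by (cases w)
    have "p dvd y \<Longrightarrow> y \<in> {0..<p} \<Longrightarrow> y = 0" "p dvd z \<Longrightarrow> z \<in> {0..<p} \<Longrightarrow> z = 0" using z0 by blast+
    thus "w \<in> A \<longleftrightarrow> w \<in> B \<union> (Pair 0 ` Y \<union> (\<lambda>y. (y, 0)) ` Z)"
      unfolding w A_def B_def Y_def Z_def using p by (auto simp: add_ac)
  qed
  moreover have fin: "finite B" "finite Y" "finite Z"
  proof -
    have "B \<subseteq> {0..<p} \<times> {0..<p}" unfolding B_def by auto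
    thus "finite B" by (rule finite_subset) simp
    show "finite Y" "finite Z" unfolding Y_def Z_def by (rule finite_residues)+
  qed
  moreover have "B \<inter> (Pair 0 ` Y \<union> (\<lambda>y. (y, 0)) ` Z) = {}" unfolding B_def by auto
  ultimately have "card A = card B + card (Pair 0 ` Y \<union> (\<lambda>y. (y, 0)) ` Z)" by (simp add: card_Un_disjoint)
  also have "Pair 0 ` Y \<inter> (\<lambda>y. (y, 0)) ` Z = {}" using d unfolding Y_def by auto
  hence "card (Pair 0 ` Y \<union> (\<lambda>y. (y, 0)) ` Z) = card (Pair (0::int) ` Y) + card ((\<lambda>y. (y, 0::int)) ` Z)"
    using fin by (intro card_Un_disjoint) auto
  also have "\<dots> = card Y + card Z" by (simp add: card_image inj_on_def)
  finally have "int (card B) = int (card A) - int (card Y) - int (card Z)" by simp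
  also have "\<dots> = p - s_p p a1 a2 a3" unfolding cA cY cZ s_p_def by simp
  finally show ?thesis unfolding B_def d_def .
qed

section \<open>The number of zeros modulo a prime power\<close>

lemma card_zeros_1:
  assumes a: "unitv p (a1, a2, a3)"
  shows "int (card (zeros p (a1, a2, a3) 1)) = (p - 1) * (p - s_p p a1 a2 a3)"
proof -
  have u: "\<not> p dvd a1" "\<not> p dvd a2" "\<not> p dvd a3" using a unfolding unitv_iff[OF p] by auto
  define F where "F x = {(y, z). y \<in> {0..<p} \<and> z \<in> {0..<p} \<and> \<not> p dvd y \<and> \<not> p dvd z \<and> p dvd a1 * x\<^sup>2 + a2 * y\<^sup>2 + a3 * z\<^sup>2}" for x
  have nd: "\<not> p dvd x \<longleftrightarrow> x \<noteq> 0" if "0 \<le> x" "x < p" for x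
    using that zdvd_not_zless[of x p] by (cases "x = 0") auto
  have "zeros p (a1, a2, a3) 1 = Sigma {1..<p} F"
  proof (intro Set.set_eqI)
    fix w :: ivec
    obtain x y z where w: "w = (x, y, z)" by (cases w)
    show "w \<in> zeros p (a1, a2, a3) 1 \<longleftrightarrow> w \<in> Sigma {1..<p} F"
      unfolding w zeros_def F_def using nd[of x] by auto
  qed
  moreover have "finite (F x)" for x
  proof -
    have "F x \<subseteq> {0..<p} \<times> {0..<p}" unfolding F_def by auto
    thus ?thesis by (rule finite_subset) simp
  qed
  ultimately have "int (card (zeros p (a1, a2, a3) 1)) = (\<Sum>x\<in>{1..<p}. int (card (F x)))" by simp
  also have "\<dots> = (\<Sum>x\<in>{1..<p}. p - s_p p a1 a2 a3)"
    using card_conic_units[OF u] nd unfolding F_def by (intro sum.cong) auto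
  also have "\<dots> = (p - 1) * (p - s_p p a1 a2 a3)" using p by simp
  finally show ?thesis .
qed

text \<open>Hensel lifting: the next digits of \<open>y\<close> and \<open>z\<close> are free, and
  that of \<open>x\<close> solves a linear congruence with unit coefficient
  \<open>2 * a1 * x\<close>.\<close>

lemma card_zeros_Suc:
  assumes a: "unitv p (a1, a2, a3)" and n: "n \<ge> 1"
  shows "int (card (zeros p (a1, a2, a3) (Suc n))) = p\<^sup>2 * int (card (zeros p (a1, a2, a3) n))"
proof -
  have u: "\<not> p dvd a1" "\<not> p dvd a2" "\<not> p dvd a3" using a unfolding unitv_iff[OF p] by auto
  define q where "q = p ^ n"
  have q: "q > 0" "p dvd q" "p ^ Suc n = p * q" unfolding q_def using p n by (auto simp: dvd_power)
  have pp: "p > 0" using p by simp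
  have qq: "p ^ Suc n dvd q * q" unfolding q_def power_add[symmetric] using n by (intro le_imp_power_dvd) simp
  define f where "f = (\<lambda>(x, y, z). ((x mod q, y mod q, z mod q), (y div q, z div q)))"
  have Z: "(x, y, z) \<in> zeros p (a1, a2, a3) k \<longleftrightarrow> 0 \<le> x \<and> x < p ^ k \<and> 0 \<le> y \<and> y < p ^ k \<and> 0 \<le> z \<and> z < p ^ k
     \<and> \<not> p dvd x \<and> \<not> p dvd y \<and> \<not> p dvd z \<and> p ^ k dvd a1 * x\<^sup>2 + a2 * y\<^sup>2 + a3 * z\<^sup>2" for x y z k
    unfolding zeros_def by auto
  have md: "p dvd x mod q \<longleftrightarrow> p dvd x" for x using q(2) by (rule dvd_mod_iff)
  have inj: "inj_on f (zeros p (a1, a2, a3) (Suc n))"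
  proof (rule inj_onI)
    fix s t assume st: "s \<in> zeros p (a1, a2, a3) (Suc n)" "t \<in> zeros p (a1, a2, a3) (Suc n)" "f s = f t"
    obtain x y z where s: "s = (x, y, z)" by (cases s)
    obtain x' y' z' where t: "t = (x', y', z')" by (cases t)
    have "x mod q = x' mod q" "y = y'" "z = z'"
      using st(3) unfolding f_def s t by (auto, (metis div_mult_mod_eq)+)
    note e = this
    have "p dvd x - x'" using e(1) q(2) by (metis mod_eq_dvd_iff dvd_trans)
    moreover have "p ^ Suc n dvd (a1 * x\<^sup>2 + a2 * y\<^sup>2 + a3 * z\<^sup>2) - (a1 * x'\<^sup>2 + a2 * y'\<^sup>2 + a3 * z'\<^sup>2)"
      by (rule dvd_diff) (use st Z in \<open>unfold s t, blast\<close>)+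
    hence "p ^ Suc n dvd a1 * (x\<^sup>2 - x'\<^sup>2)" unfolding e by (simp add: algebra_simps)
    ultimately have "p ^ Suc n dvd x - x'" using square_congruence_lift[OF p] u(1) st Z unfolding s by blast
    hence "x mod p ^ Suc n = x' mod p ^ Suc n" by (simp only: mod_eq_dvd_iff)
    moreover have "0 \<le> x" "x < p ^ Suc n" "0 \<le> x'" "x' < p ^ Suc n" using st Z unfolding s t by blast+
    ultimately have "x = x'" by (metis mod_pos_pos_trivial)
    thus "s = t" using e s t by simp
  qed
  have "f ` zeros p (a1, a2, a3) (Suc n) = zeros p (a1, a2, a3) n \<times> ({0..<p} \<times> {0..<p})"
  proof
    show "f ` zeros p (a1, a2, a3) (Suc n) \<subseteq> zeros p (a1, a2, a3) n \<times> ({0..<p} \<times> {0..<p})"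
    proof (rule image_subsetI)
      fix s assume st: "s \<in> zeros p (a1, a2, a3) (Suc n)"
      obtain x y z where s: "s = (x, y, z)" by (cases s)
      note h = st[unfolded s Z]
      have dv: "w div q \<in> {0..<p}" if "0 \<le> w" "w < p ^ Suc n" for w
      proof -
        have "w div q < p"
        proof (rule ccontr)
          assume "\<not> w div q < p"
          hence "p * q \<le> (w div q) * q" using q by (intro mult_right_mono) auto
          moreover have "(w div q) * q + w mod q = w" by (rule div_mult_mod_eq)
          moreover have "w mod q \<ge> 0" using q by simp
          ultimately show False using that q(3) by linarith
        qed
        thus ?thesis using that q by (simp add: pos_imp_zdiv_nonneg_iff)
      qed
      have "q dvd p ^ Suc n" unfolding q_def by (intro le_imp_power_dvd) simp
      hence d: "q dvd a1 * x\<^sup>2 + a2 * y\<^sup>2 + a3 * z\<^sup>2" using h dvd_trans by blast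
      have m: "q dvd w mod q - w" for w by (simp add: mod_eq_dvd_iff[symmetric])
      have "dvdv q ((x mod q, y mod q, z mod q) - (x, y, z))" using m by simp
      hence "q dvd qf (a1, a2, a3) (x mod q, y mod q, z mod q) - qf (a1, a2, a3) (x, y, z)" by (rule qf_cong)
      hence "q dvd a1 * (x mod q)\<^sup>2 + a2 * (y mod q)\<^sup>2 + a3 * (z mod q)\<^sup>2" using d by (simp add: dvd_diff_left_iff)
      hence "(x mod q, y mod q, z mod q) \<in> zeros p (a1, a2, a3) n" unfolding Z md using h q unfolding q_def by simp
      thus "f s \<in> zeros p (a1, a2, a3) n \<times> ({0..<p} \<times> {0..<p})" unfolding f_def s using dv h by simp
    qed
    show "zeros p (a1, a2, a3) n \<times> ({0..<p} \<times> {0..<p}) \<subseteq> f ` zeros p (a1, a2, a3) (Suc n)"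
    proof
      fix w assume w: "w \<in> zeros p (a1, a2, a3) n \<times> ({0..<p} \<times> {0..<p})"
      obtain x y z r s where w': "w = ((x, y, z), (r, s))" by (metis prod.exhaust)
      have xyz: "(x, y, z) \<in> zeros p (a1, a2, a3) n" and rs: "0 \<le> r" "r < p" "0 \<le> s" "s < p" using w w' by auto
      note h = xyz[unfolded Z]
      obtain e where e: "a1 * x\<^sup>2 + a2 * y\<^sup>2 + a3 * z\<^sup>2 = q * e" using h unfolding q_def by blast
      have "\<not> p dvd 2 * a1 * x" using u h not_dvd_2[OF p] by (simp add: pdvd_mult[OF p])
      then obtain b where b: "p dvd 2 * a1 * x * b - 1" using residue_inverse by (auto simp: cong_iff_dvd_diff)
      \<comment> \<open>At the lifted point the form equals \<open>q * (g + 2 * a1 * x * t)\<close>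
        up to a multiple of \<open>q * q\<close>; so the digit \<open>t\<close> must solve a linear
        congruence modulo \<open>p\<close>.\<close>
      define g where "g = e + 2 * a2 * y * r + 2 * a3 * z * s"
      define t where "t = (- g * b) mod p"
      have t: "0 \<le> t" "t < p" unfolding t_def using pp by auto
      have "p dvd t - (- g * b)" unfolding t_def mod_eq_dvd_iff[symmetric] by simp
      hence "p dvd 2 * a1 * x * (t - (- g * b)) - g * (2 * a1 * x * b - 1)" by (rule dvd_diff[OF dvd_mult dvd_mult[OF b]])
      also have "\<dots> = g + 2 * a1 * x * t" by (simp add: algebra_simps)
      finally have "p * q dvd (g + 2 * a1 * x * t) * q" by (rule mult_dvd_mono) simp
      moreover have "p * q dvd (q * q) * (a1 * t\<^sup>2 + a2 * r\<^sup>2 + a3 * s\<^sup>2)" using qq unfolding q(3) by (rule dvd_mult2)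
      ultimately have "p * q dvd (g + 2 * a1 * x * t) * q + (q * q) * (a1 * t\<^sup>2 + a2 * r\<^sup>2 + a3 * s\<^sup>2)" by (rule dvd_add)
      also have "(g + 2 * a1 * x * t) * q + (q * q) * (a1 * t\<^sup>2 + a2 * r\<^sup>2 + a3 * s\<^sup>2)
          = q * e + (a1 * ((x + q * t)\<^sup>2 - x\<^sup>2) + a2 * ((y + q * r)\<^sup>2 - y\<^sup>2) + a3 * ((z + q * s)\<^sup>2 - z\<^sup>2))"
        unfolding g_def by (simp add: power2_eq_square algebra_simps)
      also have "\<dots> = a1 * (x + q * t)\<^sup>2 + a2 * (y + q * r)\<^sup>2 + a3 * (z + q * s)\<^sup>2"
        unfolding e[symmetric] by (simp add: algebra_simps)
      finally have d: "p ^ Suc n dvd a1 * (x + q * t)\<^sup>2 + a2 * (y + q * r)\<^sup>2 + a3 * (z + q * s)\<^sup>2" unfolding q(3) .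
      have bd: "0 \<le> v + q * k \<and> v + q * k < p ^ Suc n" if "0 \<le> v" "v < q" "0 \<le> k" "k < p" for v k
      proof -
        have "q * k \<le> q * (p - 1)" using that q by (intro mult_left_mono) auto
        hence "v + q * k < q + q * (p - 1)" using that by linarith
        also have "\<dots> = p ^ Suc n" unfolding q(3) by (simp add: algebra_simps)
        finally show ?thesis using that q by simp
      qed
      have nd: "p dvd v + q * k \<longleftrightarrow> p dvd v" for v k using q(2) by (simp add: dvd_add_left_iff)
      have mem: "(x + q * t, y + q * r, z + q * s) \<in> zeros p (a1, a2, a3) (Suc n)"
        unfolding Z nd using d h t rs bd[of x t] bd[of y r] bd[of z s] unfolding q_def by simp
      have "f (x + q * t, y + q * r, z + q * s) = w"
        unfolding f_def w' using h q unfolding q_def[symmetric] by (simp add: div_add1_eq)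
      thus "w \<in> f ` zeros p (a1, a2, a3) (Suc n)" using mem by (metis imageI)
    qed
  qed
  hence "card (zeros p (a1, a2, a3) (Suc n)) = card (zeros p (a1, a2, a3) n \<times> ({0..<p} \<times> {0..<p}))"
    using card_image[OF inj] by simp
  thus ?thesis using pp by (simp add: card_cartesian_product power2_eq_square)
qed

lemma card_zeros:
  assumes a: "unitv p (a1, a2, a3)" and n: "n \<ge> 1"
  shows "real (card (zeros p (a1, a2, a3) n)) = C_p p a1 a2 a3 * real_of_int (p ^ n) ^ 2"
proof -
  have "int (card (zeros p (a1, a2, a3) (Suc k))) = (p - 1) * (p - s_p p a1 a2 a3) * (p ^ k)\<^sup>2" for k
  proof (induction k)
    case 0
    show ?case using card_zeros_1[OF a] by simp
  next
    case (Suc k)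
    show ?case using card_zeros_Suc[OF a, of "Suc k"] Suc by (simp add: power_mult_distrib mult_ac)
  qed
  from this[of "n - 1"] n
  have "int (card (zeros p (a1, a2, a3) n)) = (p - 1) * (p - s_p p a1 a2 a3) * (p ^ (n - 1))\<^sup>2" by simp
  hence "real (card (zeros p (a1, a2, a3) n)) = real_of_int ((p - 1) * (p - s_p p a1 a2 a3) * (p ^ (n - 1))\<^sup>2)"
    by (metis of_int_of_nat_eq)
  moreover have "real_of_int (p ^ n) = p * real_of_int (p ^ (n - 1))"
    using n by (metis of_int_mult power_Suc Suc_diff_1 less_eq_Suc_le One_nat_def)
  moreover define Q where "Q = real_of_int (p ^ (n - 1))"
  ultimately have "real (card (zeros p (a1, a2, a3) n)) = real_of_int (p - 1) * real_of_int (p - s_p p a1 a2 a3) * Q\<^sup>2"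
    and "real_of_int (p ^ n) = p * Q" by simp_all
  thus ?thesis unfolding C_p_def using p by (simp add: power_mult_distrib)
qed

end

section \<open>Sampling a Schwartz function\<close>

text \<open>A common majorant for Schwartz functions and their derivatives that is integrable,
  summable over sample points and stable under bounded shifts.\<close>

definition cauchy_weight :: "real \<Rightarrow> real" where
  "cauchy_weight t = 1 / (1 + t\<^sup>2)"

lemma cauchy_weight_pos: "cauchy_weight t > 0"
  unfolding cauchy_weight_def by (simp add: add_pos_nonneg)

lemma cauchy_weight_shift:
  assumes "\<bar>t - s\<bar> \<le> A"
  shows "cauchy_weight s \<le> 2 * (1 + A\<^sup>2) * cauchy_weight t"
proof -
  have "(t - s)\<^sup>2 \<le> A\<^sup>2" using assms by (simp add: abs_le_square_iff[symmetric] abs_of_nonneg)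
  moreover have "t\<^sup>2 \<le> 2 * s\<^sup>2 + 2 * (t - s)\<^sup>2"
    using zero_le_power2[of "t - 2 * s"] by (simp add: power2_eq_square algebra_simps)
  moreover have "0 \<le> A\<^sup>2 * s\<^sup>2" by simp
  moreover have "2 * (1 + A\<^sup>2) * (1 + s\<^sup>2) = 2 + 2 * A\<^sup>2 + 2 * s\<^sup>2 + 2 * (A\<^sup>2 * s\<^sup>2)" by (simp add: algebra_simps)
  ultimately have "1 + t\<^sup>2 \<le> 2 * (1 + A\<^sup>2) * (1 + s\<^sup>2)" by linarith
  moreover have "1 + s\<^sup>2 > 0" "1 + t\<^sup>2 > 0" by (simp_all add: add_pos_nonneg)
  ultimately show ?thesis unfolding cauchy_weight_def by (simp add: field_simps)
qed

text \<open>The weight is decreasing and is the derivative of \<open>arctan\<close>, so each sample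
  is at most \<open>N\<close> times the increment of \<open>arctan\<close> over the preceding
  cell.\<close>

lemma sum_cauchy_weight_nat:
  assumes "N > 0"
  shows "(\<Sum>x=1..X. cauchy_weight (real x / N)) \<le> N * arctan (real X / N)"
proof (induction X)
  case (Suc X)
  have "\<exists>z. real X / N < z \<and> z < real (Suc X) / N \<and>
      arctan (real (Suc X) / N) - arctan (real X / N) = (real (Suc X) / N - real X / N) * inverse (1 + z\<^sup>2)"
    using assms by (intro MVT2) (auto simp: divide_strict_right_mono intro: DERIV_arctan)
  then obtain z where z: "real X / N < z" "z < real (Suc X) / N"
      "arctan (real (Suc X) / N) - arctan (real X / N) = (real (Suc X) / N - real X / N) * inverse (1 + z\<^sup>2)" by blast
  have "real X / N \<ge> 0" using assms by simp
  hence "z\<^sup>2 \<le> (real (Suc X) / N)\<^sup>2" using z by (intro power_mono) auto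
  hence "cauchy_weight (real (Suc X) / N) \<le> inverse (1 + z\<^sup>2)"
    unfolding cauchy_weight_def inverse_eq_divide by (intro divide_left_mono mult_pos_pos) (auto simp: add_pos_nonneg)
  also have "\<dots> = N * (arctan (real (Suc X) / N) - arctan (real X / N))"
    unfolding z(3) using assms by (simp add: diff_divide_distrib[symmetric])
  finally show ?case using Suc by (simp add: algebra_simps)
qed simp

lemma sum_cauchy_weight_int:
  assumes N: "N \<ge> 1" and F: "finite (F :: int set)"
  shows "(\<Sum>x\<in>F. cauchy_weight (real_of_int x / N)) \<le> 6 * N"
proof -
  define X where "X = nat (Max (insert 0 (abs ` F)))"
  have "\<bar>x\<bar> \<le> int X" if "x \<in> F" for x
  proof -
    have "\<bar>x\<bar> \<le> Max (insert 0 (abs ` F))" using that F by (intro Max_ge) auto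
    thus ?thesis unfolding X_def by linarith
  qed
  hence "F \<subseteq> {- int X..int X}" by (force simp: abs_le_iff)
  hence "(\<Sum>x\<in>F. cauchy_weight (real_of_int x / N)) \<le> (\<Sum>x\<in>{- int X..int X}. cauchy_weight (real_of_int x / N))"
    by (intro sum_mono2) (auto intro: less_imp_le cauchy_weight_pos)
  also have "{- int X..int X} = (\<lambda>x. - int x) ` {1..X} \<union> ({0} \<union> int ` {1..X})"
  proof -
    have "x \<in> (\<lambda>x. - int x) ` {1..X} \<union> ({0} \<union> int ` {1..X})" if "x \<in> {- int X..int X}" for x
    proof (cases x "0 :: int" rule: linorder_cases)
      case less
      thus ?thesis using that by (intro UnI1 image_eqI[of _ _ "nat (- x)"]) auto
    next
      case greater
      thus ?thesis using that by (intro UnI2 image_eqI[of _ _ "nat x"]) auto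
    qed auto
    hence "{- int X..int X} \<subseteq> (\<lambda>x. - int x) ` {1..X} \<union> ({0} \<union> int ` {1..X})" by blast
    moreover have "(\<lambda>x. - int x) ` {1..X} \<union> ({0} \<union> int ` {1..X}) \<subseteq> {- int X..int X}" by auto
    ultimately show ?thesis by (rule equalityI)
  qed
  also have "(\<Sum>x\<in>(\<lambda>x. - int x) ` {1..X} \<union> ({0} \<union> int ` {1..X}). cauchy_weight (real_of_int x / N))
     = (\<Sum>x=1..X. cauchy_weight (real x / N)) + (1 + (\<Sum>x=1..X. cauchy_weight (real x / N)))"
    by (subst sum.union_disjoint; (subst sum.union_disjoint)?)
      (auto simp: sum.reindex inj_on_def cauchy_weight_def)
  also have "\<dots> \<le> N * (pi / 2) + (1 + N * (pi / 2))"
  proof -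
    have "(\<Sum>x=1..X. cauchy_weight (real x / N)) \<le> N * arctan (real X / N)" using N by (intro sum_cauchy_weight_nat) simp
    also have "\<dots> \<le> N * (pi / 2)" using N arctan_ubound by (intro mult_left_mono less_imp_le) auto
    finally show ?thesis by linarith
  qed
  also have "\<dots> \<le> 6 * N"
  proof -
    have "N * pi \<le> N * 4" using N pi_less_4 by (intro mult_left_mono) auto
    thus ?thesis using N by linarith
  qed
  finally show ?thesis .
qed

lemma cauchy_weight_summable:
  assumes N: "N \<ge> 1"
  shows "(\<lambda>x::int. cauchy_weight (real_of_int x / N)) summable_on UNIV"
  by (rule nonneg_bdd_above_summable_on)
    (use sum_cauchy_weight_int[OF N] in \<open>auto intro!: bdd_aboveI2 less_imp_le[OF cauchy_weight_pos]\<close>)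

lemma infsum_cauchy_weight:
  assumes N: "N \<ge> 1"
  shows "(\<Sum>\<^sub>\<infinity>x::int. cauchy_weight (real_of_int x / N)) \<le> 6 * N"
  using infsum_le_finite_sums[OF cauchy_weight_summable[OF N]] sum_cauchy_weight_int[OF N] by blast

lemma weight_bounded_summable:
  fixes g :: "int \<Rightarrow> complex"
  assumes N: "N \<ge> 1" and g: "\<And>x. norm (g x) \<le> C * cauchy_weight (real_of_int x / N)"
  shows "(\<lambda>x. norm (g x)) summable_on UNIV" and "norm (infsum g UNIV) \<le> 6 * C * N"
    and "(\<Sum>\<^sub>\<infinity>x. norm (g x)) \<le> 6 * C * N"
proof -
  have C: "C \<ge> 0"
  proof (rule ccontr)
    assume "\<not> C \<ge> 0"
    hence "C * cauchy_weight (real_of_int 0 / N) < 0" using cauchy_weight_pos by (simp add: mult_neg_pos)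
    thus False using g[of 0] norm_ge_zero[of "g 0"] by linarith
  qed
  have s: "(\<lambda>x::int. C * cauchy_weight (real_of_int x / N)) summable_on UNIV"
    using cauchy_weight_summable[OF N] by (rule summable_on_cmult_right)
  show a: "(\<lambda>x. norm (g x)) summable_on UNIV"
  proof (rule Infinite_Sum.abs_summable_on_comparison_test)
    show "(\<lambda>x::int. norm (C * cauchy_weight (real_of_int x / N))) summable_on UNIV"
      using s C less_imp_le[OF cauchy_weight_pos] by (simp add: abs_mult abs_of_nonneg)
    show "norm (g x) \<le> norm (C * cauchy_weight (real_of_int x / N))" for x
      using g[of x] by simp
  qed
  have "(\<Sum>\<^sub>\<infinity>x. norm (g x)) \<le> (\<Sum>\<^sub>\<infinity>x::int. C * cauchy_weight (real_of_int x / N))"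
    using a s g by (intro infsum_mono) auto
  also have "\<dots> = C * (\<Sum>\<^sub>\<infinity>x::int. cauchy_weight (real_of_int x / N))" by (rule infsum_cmult_right')
  also have "\<dots> \<le> C * (6 * N)" using infsum_cauchy_weight[OF N] C by (rule mult_left_mono)
  finally show n: "(\<Sum>\<^sub>\<infinity>x. norm (g x)) \<le> 6 * C * N" by simp
  show "norm (infsum g UNIV) \<le> 6 * C * N" using norm_infsum_bound[OF a] n by linarith
qed

section \<open>Decay of sampled Fourier transforms\<close>

lemma schwartz_deriv:
  assumes "schwartz f"
  shows "((deriv ^^ m) f has_real_derivative (deriv ^^ Suc m) f x) (at x)"
proof -
  have "(deriv ^^ m) f differentiable (at x)" using assms unfolding schwartz_def by blast
  thus ?thesis by (simp add: DERIV_deriv_iff_real_differentiable)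
qed

lemma schwartz_decay:
  assumes "schwartz f"
  shows "\<exists>C\<ge>0. \<forall>x. \<bar>(deriv ^^ m) f x\<bar> \<le> C * cauchy_weight x"
proof -
  have b: "bounded (range (\<lambda>x. \<bar>x\<bar> ^ k * \<bar>(deriv ^^ m) f x\<bar>))" for k using assms unfolding schwartz_def by blast
  obtain B0 where B0: "\<And>x. \<bar>\<bar>x\<bar> ^ 0 * \<bar>(deriv ^^ m) f x\<bar>\<bar> \<le> B0" using b[of 0] unfolding bounded_iff by auto
  obtain B2 where B2: "\<And>x. \<bar>\<bar>x\<bar> ^ 2 * \<bar>(deriv ^^ m) f x\<bar>\<bar> \<le> B2" using b[of 2] unfolding bounded_iff by auto
  have "\<bar>(deriv ^^ m) f x\<bar> \<le> (B0 + B2) * cauchy_weight x" for x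
  proof -
    have "(1 + x\<^sup>2) * \<bar>(deriv ^^ m) f x\<bar> \<le> B0 + B2" using B0[of x] B2[of x] by (simp add: algebra_simps abs_mult)
    moreover have "1 + x\<^sup>2 > 0" by (simp add: add_pos_nonneg)
    ultimately show ?thesis unfolding cauchy_weight_def by (simp add: field_simps)
  qed
  moreover have "B0 + B2 \<ge> 0" using B0[of 0] B2[of 0] by linarith
  ultimately show ?thesis by blast
qed

text \<open>Each difference is \<open>h\<close> times a derivative at an intermediate point. The
  induction replaces the whole family \<open>F\<close> by its differences, which again form a chain
  of derivatives.\<close>

lemma finite_difference_bound:
  fixes F :: "nat \<Rightarrow> real \<Rightarrow> real"
  assumes h: "h > 0" and d: "\<And>m x. (F m has_real_derivative F (Suc m) x) (at x)"
    and B: "\<And>s. t \<le> s \<Longrightarrow> s \<le> t + real A * h \<Longrightarrow> \<bar>F A s\<bar> \<le> B"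
  shows "\<bar>((\<lambda>g x. g (x + h) - g x) ^^ A) (F 0) t\<bar> \<le> h ^ A * B"
  using d B
proof (induction A arbitrary: F B)
  case 0
  show ?case using "0.prems"(2)[of t] by simp
next
  case (Suc A)
  define G where "G m x = F m (x + h) - F m x" for m x
  have "\<bar>((\<lambda>g x. g (x + h) - g x) ^^ A) (G 0) t\<bar> \<le> h ^ A * (h * B)"
  proof (rule Suc.IH)
    fix m x
    show "(G m has_real_derivative G (Suc m) x) (at x)"
      unfolding G_def by (intro DERIV_diff Suc.prems(1) DERIV_shift[THEN iffD1])
  next
    fix s assume s: "t \<le> s" "s \<le> t + real A * h"
    have "\<exists>z. s < z \<and> z < s + h \<and> F A (s + h) - F A s = (s + h - s) * F (Suc A) z"
      using h by (intro MVT2) (auto intro: Suc.prems(1))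
    then obtain z where z: "s < z" "z < s + h" "F A (s + h) - F A s = h * F (Suc A) z" by auto
    have "\<bar>F (Suc A) z\<bar> \<le> B" using z s by (intro Suc.prems(2)) (auto simp: algebra_simps)
    thus "\<bar>G A s\<bar> \<le> h * B" unfolding G_def z(3) using h by (simp add: abs_mult)
  qed
  moreover have "G 0 = (\<lambda>x. F 0 (x + h) - F 0 x)" unfolding G_def by simp
  ultimately show ?case by (simp only: funpow_Suc_right o_apply power_Suc2 mult.assoc)
qed

definition sample_sum :: "(real \<Rightarrow> real) \<Rightarrow> real \<Rightarrow> real \<Rightarrow> complex" where
  "sample_sum f N \<theta> = (\<Sum>\<^sub>\<infinity>x::int. complex_of_real (f (real_of_int x / N)) * cis (- 2 * pi * real_of_int x * \<theta>))"

text \<open>Summation by parts: shifting the sampling point by \<open>1 / N\<close> reindexes the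
  sum and multiplies it by a phase.\<close>

lemma sample_sum_difference:
  assumes N: "N \<ge> 1" and f: "\<And>t. \<bar>f t\<bar> \<le> C * cauchy_weight t"
  shows "sample_sum (\<lambda>x. f (x + 1 / N) - f x) N \<theta> = (cis (2 * pi * \<theta>) - 1) * sample_sum f N \<theta>"
proof -
  define u where "u x = complex_of_real (f (real_of_int x / N)) * cis (- 2 * pi * real_of_int x * \<theta>)" for x
  have "(\<lambda>x. norm (u x)) summable_on UNIV" unfolding u_def
    by (rule weight_bounded_summable(1)[OF N, of _ C]) (use f in \<open>simp add: norm_mult\<close>)
  hence su: "u summable_on UNIV" by (rule abs_summable_summable)
  have bij: "bij_betw (\<lambda>x::int. x + 1) UNIV UNIV" by (rule bij_betw_byWitness[where f' = "\<lambda>x. x - 1"]) auto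
  have su1: "(\<lambda>x. u (x + 1)) summable_on UNIV" using su summable_on_reindex_bij_betw[OF bij, of u] by simp
  have "complex_of_real (f (real_of_int x / N + 1 / N) - f (real_of_int x / N)) * cis (- 2 * pi * real_of_int x * \<theta>)
     = cis (2 * pi * \<theta>) * u (x + 1) - u x" for x
  proof -
    have "cis (2 * pi * \<theta>) * cis (- 2 * pi * real_of_int (x + 1) * \<theta>) = cis (- 2 * pi * real_of_int x * \<theta>)"
      by (simp add: cis_mult algebra_simps)
    moreover have "real_of_int x / N + 1 / N = real_of_int (x + 1) / N" by (simp add: add_divide_distrib)
    ultimately show ?thesis unfolding u_def by (simp only: of_real_diff left_diff_distrib) (simp add: mult_ac)
  qed
  hence "sample_sum (\<lambda>x. f (x + 1 / N) - f x) N \<theta> = (\<Sum>\<^sub>\<infinity>x. cis (2 * pi * \<theta>) * u (x + 1) - u x)"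
    unfolding sample_sum_def by simp
  also have "\<dots> = (\<Sum>\<^sub>\<infinity>x. cis (2 * pi * \<theta>) * u (x + 1)) - infsum u UNIV"
    using infsum_add[OF summable_on_cmult_right[OF su1, of "cis (2 * pi * \<theta>)"] summable_on_uminus[THEN iffD2, OF su]]
    by (simp add: infsum_uminus)
  also have "(\<Sum>\<^sub>\<infinity>x. cis (2 * pi * \<theta>) * u (x + 1)) = cis (2 * pi * \<theta>) * (\<Sum>\<^sub>\<infinity>x. u (x + 1))"
    by (rule infsum_cmult_right')
  also have "(\<Sum>\<^sub>\<infinity>x. u (x + 1)) = infsum u UNIV" by (rule infsum_reindex_bij_betw[OF bij])
  also have "infsum u UNIV = sample_sum f N \<theta>" unfolding u_def sample_sum_def ..
  finally show ?thesis by (simp add: algebra_simps)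
qed

lemma sample_sum_iterated_difference:
  assumes N: "N \<ge> 1" and f: "\<And>t. \<bar>f t\<bar> \<le> C * cauchy_weight t"
  shows "sample_sum (((\<lambda>g x. g (x + 1 / N) - g x) ^^ A) f) N \<theta> = (cis (2 * pi * \<theta>) - 1) ^ A * sample_sum f N \<theta>"
    and "\<exists>D. \<forall>t. \<bar>((\<lambda>g x. g (x + 1 / N) - g x) ^^ A) f t\<bar> \<le> D * cauchy_weight t"
proof (induction A)
  case 0
  { case 1 show ?case by simp }
  { case 2 show ?case using f by auto }
next
  case (Suc A)
  define g where "g = ((\<lambda>g x. g (x + 1 / N) - g x) ^^ A) f"
  obtain D where D: "\<And>t. \<bar>g t\<bar> \<le> D * cauchy_weight t" using Suc.IH(2) unfolding g_def by blast
  have e: "((\<lambda>g x. g (x + 1 / N) - g x) ^^ Suc A) f = (\<lambda>x. g (x + 1 / N) - g x)" unfolding g_def by simp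
  { case 1 show ?case unfolding e sample_sum_difference[OF N D] using Suc.IH(1) unfolding g_def[symmetric] by simp }
  { case 2
    have D0: "D \<ge> 0"
    proof (rule ccontr)
      assume "\<not> D \<ge> 0"
      hence "D * cauchy_weight 0 < 0" using cauchy_weight_pos by (simp add: mult_neg_pos)
      thus False using D[of 0] by linarith
    qed
    have "\<bar>g (t + 1 / N) - g t\<bar> \<le> (4 * D + D) * cauchy_weight t" for t
    proof -
      have "cauchy_weight (t + 1 / N) \<le> 2 * (1 + 1\<^sup>2) * cauchy_weight t"
        using N by (intro cauchy_weight_shift) auto
      hence "D * cauchy_weight (t + 1 / N) \<le> D * (4 * cauchy_weight t)" using D0 by (intro mult_left_mono) auto
      thus ?thesis using D[of t] D[of "t + 1 / N"] by (simp add: algebra_simps)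
    qed
    thus ?case unfolding e by blast }
qed

text \<open>The norm equals twice the absolute value of the sine of \<open>pi * \<theta>\<close>.
  The cubic Taylor bound on arguments up to 2 gives more than enough.\<close>

lemma norm_cis_diff_1:
  assumes "\<bar>\<theta>\<bar> \<le> 1 / 2"
  shows "norm (cis (2 * pi * \<theta>) - 1) \<ge> \<bar>\<theta>\<bar>"
proof -
  define x where "x = pi * \<bar>\<theta>\<bar>"
  have x0: "x \<ge> 0" unfolding x_def by simp
  have x2: "x \<le> 2"
  proof -
    have "x \<le> 4 * (1 / 2)" unfolding x_def using pi_less_4 assms by (intro mult_mono) auto
    thus ?thesis by simp
  qed
  have "\<bar>sin x - (\<Sum>m<3. sin_coeff m * x ^ m)\<bar> \<le> inverse (fact 3) * \<bar>x\<bar> ^ 3" by (rule Maclaurin_sin_bound)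
  moreover have "(\<Sum>m<3. sin_coeff m * x ^ m) = x" by (simp add: numeral_3_eq_3 sin_coeff_def)
  moreover have "inverse (fact 3) * \<bar>x\<bar> ^ 3 = x ^ 3 / 6" using x0 by (simp add: fact_numeral)
  ultimately have "sin x \<ge> x - x ^ 3 / 6" by linarith
  moreover have "x ^ 3 \<le> x * 4"
  proof -
    have "x * x\<^sup>2 \<le> x * 2\<^sup>2" using x0 x2 by (intro mult_left_mono power_mono) auto
    thus ?thesis by (simp add: power3_eq_cube power2_eq_square)
  qed
  ultimately have s: "2 * sin x \<ge> x / 2" using x0 by linarith
  have "(norm (cis (2 * pi * \<theta>) - 1))\<^sup>2 = (cos (2 * pi * \<theta>) - 1)\<^sup>2 + (sin (2 * pi * \<theta>))\<^sup>2"
    by (simp add: cmod_power2)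
  also have "\<dots> = 2 - 2 * cos (2 * pi * \<theta>)"
    using sin_cos_squared_add[of "2 * pi * \<theta>"] by (simp add: power2_eq_square algebra_simps)
  also have "cos (2 * pi * \<theta>) = cos (2 * x)" unfolding x_def
    by (metis abs_mult abs_of_pos cos_abs_real mult.assoc mult.left_commute pi_gt_zero zero_less_numeral)
  also have "2 - 2 * cos (2 * x) = (2 * sin x)\<^sup>2" by (simp add: cos_double_sin power_mult_distrib)
  finally have "norm (cis (2 * pi * \<theta>) - 1) = \<bar>2 * sin x\<bar>"
    by (metis abs_norm_cancel power2_eq_iff abs_minus_cancel real_sqrt_abs)
  also have "\<dots> \<ge> x / 2" using s by simp
  also have "x / 2 \<ge> \<bar>\<theta>\<bar>"
  proof -
    have "2 * \<bar>\<theta>\<bar> \<le> pi * \<bar>\<theta>\<bar>" using pi_ge_two by (intro mult_right_mono) auto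
    thus ?thesis unfolding x_def by simp
  qed
  finally show ?thesis .
qed

text \<open>Differencing \<open>A\<close> times shrinks the function by \<open>(1 / N) ^ A\<close>
  and multiplies the sum by a factor of size at least \<open>\<bar>\<theta>\<bar> ^ A\<close>. This
  takes the place of Poisson summation.\<close>

lemma sample_sum_decay:
  assumes f: "schwartz f"
  shows "\<exists>C\<ge>0. \<forall>N \<theta>. N \<ge> 1 \<longrightarrow> \<theta> \<noteq> 0 \<longrightarrow> \<bar>\<theta>\<bar> \<le> 1 / 2 \<longrightarrow> norm (sample_sum f N \<theta>) \<le> C * N * (1 / (N * \<bar>\<theta>\<bar>)) ^ A"
proof -
  obtain C where C: "C \<ge> 0" "\<And>x. \<bar>(deriv ^^ A) f x\<bar> \<le> C * cauchy_weight x" using schwartz_decay[OF f] by blast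
  obtain C0 where C0: "\<And>x. \<bar>(deriv ^^ 0) f x\<bar> \<le> C0 * cauchy_weight x" using schwartz_decay[OF f] by blast
  define D where "D = C * (2 * (1 + (real A)\<^sup>2))"
  have D: "D \<ge> 0" unfolding D_def using C(1) by simp
  have "norm (sample_sum f N \<theta>) \<le> (6 * D) * N * (1 / (N * \<bar>\<theta>\<bar>)) ^ A"
    if N: "N \<ge> 1" and t: "\<theta> \<noteq> 0" "\<bar>\<theta>\<bar> \<le> 1 / 2" for N \<theta>
  proof -
    define g where "g = ((\<lambda>g x. g (x + 1 / N) - g x) ^^ A) f"
    have gb: "\<bar>g x\<bar> \<le> ((1 / N) ^ A * D) * cauchy_weight x" for x
    proof -
      have "\<bar>g x\<bar> \<le> (1 / N) ^ A * (D * cauchy_weight x)"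
        unfolding g_def
      proof -
        have "\<bar>((\<lambda>g y. g (y + 1 / N) - g y) ^^ A) ((deriv ^^ 0) f) x\<bar> \<le> (1 / N) ^ A * (D * cauchy_weight x)"
        proof (rule finite_difference_bound)
          fix s assume s: "x \<le> s" "s \<le> x + real A * (1 / N)"
          have "real A * (1 / N) \<le> real A * 1" using N by (intro mult_left_mono) auto
          hence "cauchy_weight s \<le> 2 * (1 + (real A)\<^sup>2) * cauchy_weight x"
            using s by (intro cauchy_weight_shift) auto
          hence "C * cauchy_weight s \<le> C * (2 * (1 + (real A)\<^sup>2) * cauchy_weight x)" using C(1) by (rule mult_left_mono)
          thus "\<bar>(deriv ^^ A) f s\<bar> \<le> D * cauchy_weight x" using C(2)[of s] unfolding D_def by (simp add: mult_ac)
        qed (use N schwartz_deriv[OF f] in auto)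
        thus "\<bar>((\<lambda>g x. g (x + 1 / N) - g x) ^^ A) f x\<bar> \<le> (1 / N) ^ A * (D * cauchy_weight x)" by simp
      qed
      thus ?thesis by (simp add: mult_ac)
    qed
    have "norm (sample_sum g N \<theta>) \<le> 6 * ((1 / N) ^ A * D) * N"
      unfolding sample_sum_def by (rule weight_bounded_summable(2)[OF N]) (use gb in \<open>simp add: norm_mult\<close>)
    moreover have "sample_sum g N \<theta> = (cis (2 * pi * \<theta>) - 1) ^ A * sample_sum f N \<theta>"
      unfolding g_def by (rule sample_sum_iterated_difference(1)[OF N, of _ C0]) (use C0 in simp)
    ultimately have "norm (cis (2 * pi * \<theta>) - 1) ^ A * norm (sample_sum f N \<theta>) \<le> 6 * ((1 / N) ^ A * D) * N"
      by (simp add: norm_mult norm_power)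
    moreover have "\<bar>\<theta>\<bar> ^ A * norm (sample_sum f N \<theta>) \<le> norm (cis (2 * pi * \<theta>) - 1) ^ A * norm (sample_sum f N \<theta>)"
      using norm_cis_diff_1[OF t(2)] by (intro mult_right_mono power_mono) auto
    ultimately have "\<bar>\<theta>\<bar> ^ A * norm (sample_sum f N \<theta>) \<le> 6 * ((1 / N) ^ A * D) * N" by linarith
    moreover have "\<bar>\<theta>\<bar> ^ A > 0" using t by simp
    ultimately have "norm (sample_sum f N \<theta>) \<le> 6 * ((1 / N) ^ A * D) * N / \<bar>\<theta>\<bar> ^ A"
      by (simp add: pos_le_divide_eq mult.commute)
    also have "\<dots> = (6 * D) * N * (1 / (N * \<bar>\<theta>\<bar>)) ^ A"
      using N t by (simp add: power_divide power_mult_distrib field_simps)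
    finally show ?thesis .
  qed
  moreover have "6 * D \<ge> 0" using D by simp
  ultimately show ?thesis by blast
qed

section \<open>Riemann sums on the whole line\<close>

lemma integrable_cauchy_weight: "integrable lborel cauchy_weight"
  using integrable_inverse_1_plus_square
  unfolding set_integrable_def by (simp add: cauchy_weight_def[abs_def] inverse_eq_divide)

lemma schwartz_continuous: "schwartz f \<Longrightarrow> continuous_on S f"
  using schwartz_deriv[of f 0] by (intro DERIV_continuous_on) (auto intro: has_field_derivative_at_within)

lemma schwartz_integrable:
  assumes f: "schwartz f"
  shows "integrable lborel f"
proof -
  obtain C where C: "C \<ge> 0" "\<And>x. \<bar>(deriv ^^ 0) f x\<bar> \<le> C * cauchy_weight x" using schwartz_decay[OF f] by blast
  show ?thesis
  proof (rule Bochner_Integration.integrable_bound)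
    show "integrable lborel (\<lambda>x. C * cauchy_weight x)" using integrable_cauchy_weight by simp
    show "f \<in> borel_measurable lborel" using borel_measurable_continuous_onI[OF schwartz_continuous[OF f]] by simp
    show "AE x in lborel. norm (f x) \<le> norm (C * cauchy_weight x)" using C by (auto intro!: AE_I2 order_trans[OF _ abs_ge_self])
  qed
qed

lemma fourier_transform_0: "fourier_transform f 0 = complex_of_real (integral\<^sup>L lborel f)"
  unfolding fourier_transform_def by simp

lemma samples_summable:
  assumes N: "N \<ge> 1" and f: "\<And>t. \<bar>f t\<bar> \<le> C * cauchy_weight t"
  shows "(\<lambda>x::int. f (real_of_int x / N)) summable_on UNIV"
proof -
  have "(\<lambda>x::int. norm (complex_of_real (f (real_of_int x / N)))) summable_on UNIV"
    by (rule weight_bounded_summable(1)[OF N, of _ C]) (use f in simp)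
  hence "(\<lambda>x::int. norm (f (real_of_int x / N))) summable_on UNIV" by simp
  thus ?thesis by (rule abs_summable_summable)
qed

lemma infsum_complex_of_real:
  "f summable_on A \<Longrightarrow> (\<Sum>\<^sub>\<infinity>x\<in>A. complex_of_real (f x)) = complex_of_real (infsum f A)"
  by (intro infsumI has_sum_of_real has_sum_infsum)

lemma sample_sum_0:
  assumes N: "N \<ge> 1" and f: "\<And>t. \<bar>f t\<bar> \<le> C * cauchy_weight t"
  shows "sample_sum f N 0 = complex_of_real (\<Sum>\<^sub>\<infinity>x::int. f (real_of_int x / N))"
  unfolding sample_sum_def using infsum_complex_of_real[OF samples_summable[OF N f]] by simp

lemma integral_symmetric_limit:
  fixes f :: "real \<Rightarrow> real"
  assumes f: "schwartz f" and N: "N > 0"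
  shows "(\<lambda>X. integral {- (real X / N)..real X / N} f) \<longlonglongrightarrow> integral\<^sup>L lborel f"
proof -
  have int: "integrable lborel f" using schwartz_integrable[OF f] .
  have "(\<lambda>X. \<integral>x. indicator {- (real X / N)..real X / N} x *\<^sub>R f x \<partial>lborel) \<longlonglongrightarrow> integral\<^sup>L lborel f"
  proof (rule integral_dominated_convergence[where w = "\<lambda>x. norm (f x)"])
    show "f \<in> borel_measurable lborel" using int by auto
    show "(\<lambda>x. indicator {- (real X / N)..real X / N} x *\<^sub>R f x) \<in> borel_measurable lborel" for X
      using int by (intro borel_measurable_scaleR borel_measurable_indicator) auto
    show "integrable lborel (\<lambda>x. norm (f x))" using int by (rule integrable_norm)
    show "AE x in lborel. norm (indicator {- (real X / N)..real X / N} x *\<^sub>R f x) \<le> norm (f x)" for X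
      by (rule AE_I2) (simp add: indicator_def)
    show "AE x in lborel. (\<lambda>X. indicator {- (real X / N)..real X / N} x *\<^sub>R f x) \<longlonglongrightarrow> f x"
    proof (rule AE_I2)
      fix x :: real
      obtain X0 :: nat where X0: "\<bar>x\<bar> * N \<le> real X0" using real_arch_simple by blast
      have "indicator {- (real X / N)..real X / N} x *\<^sub>R f x = f x" if "X \<ge> X0" for X
      proof -
        have "\<bar>x\<bar> * N \<le> real X" using X0 that by linarith
        hence "\<bar>x\<bar> \<le> real X / N" using N by (simp add: field_simps)
        hence "x \<in> {- (real X / N)..real X / N}" by (simp add: abs_le_iff)
        thus ?thesis by simp
      qed
      hence "eventually (\<lambda>X. indicator {- (real X / N)..real X / N} x *\<^sub>R f x = f x) sequentially"
        by (rule eventually_sequentiallyI)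
      thus "(\<lambda>X. indicator {- (real X / N)..real X / N} x *\<^sub>R f x) \<longlonglongrightarrow> f x" by (rule tendsto_eventually)
    qed
  qed
  moreover have "(\<integral>x. indicator {- (real X / N)..real X / N} x *\<^sub>R f x \<partial>lborel) = integral {- (real X / N)..real X / N} f" for X
  proof -
    have "set_integrable lborel {- (real X / N)..real X / N} f"
      unfolding set_integrable_def using int by (intro integrable_mult_indicator) auto
    thus ?thesis using set_borel_integral_eq_integral(2) unfolding set_lebesgue_integral_def by blast
  qed
  ultimately show ?thesis by simp
qed

text \<open>By the mean value theorem a cell of length \<open>1 / N\<close> has error at most
  \<open>4 * C / N\<^sup>2\<close> times the weight at its left end; the weights add up to at most
  \<open>6 * N\<close>. The bound is proved on symmetric intervals and passed to the limit.\<close>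

lemma riemann_sum_error:
  assumes f: "schwartz f"
  shows "\<exists>C\<ge>0. \<forall>N\<ge>1. \<bar>(\<Sum>\<^sub>\<infinity>x::int. f (real_of_int x / N)) / N - integral\<^sup>L lborel f\<bar> \<le> C / N"
proof -
  obtain C where C: "C \<ge> 0" "\<And>x. \<bar>(deriv ^^ 1) f x\<bar> \<le> C * cauchy_weight x" using schwartz_decay[OF f] by blast
  obtain C0 where C0: "C0 \<ge> 0" "\<And>x. \<bar>(deriv ^^ 0) f x\<bar> \<le> C0 * cauchy_weight x" using schwartz_decay[OF f] by blast
  have "\<bar>(\<Sum>\<^sub>\<infinity>x::int. f (real_of_int x / N)) / N - integral\<^sup>L lborel f\<bar> \<le> 24 * C / N" if N: "N \<ge> 1" for N
  proof -
    define e where "e x = 4 * C / N\<^sup>2 * cauchy_weight (real_of_int x / N)" for x :: int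
    have cell: "\<bar>f (real_of_int x / N) / N - integral {real_of_int x / N..real_of_int (x + 1) / N} f\<bar> \<le> e x" for x
    proof -
      define a where "a = real_of_int x / N"
      have b: "real_of_int (x + 1) / N = a + 1 / N" unfolding a_def by (simp add: add_divide_distrib)
      have bd: "norm (f t - f a) \<le> 4 * C * cauchy_weight a / N" if t: "t \<in> {a..a + 1 / N}" for t
      proof (cases "t = a")
        case False
        hence "a < t" using t by auto
        hence "\<exists>z. a < z \<and> z < t \<and> f t - f a = (t - a) * (deriv ^^ Suc 0) f z"
          using schwartz_deriv[OF f, of 0] by (intro MVT2) auto
        then obtain z where z: "a < z" "z < t" "f t - f a = (t - a) * (deriv ^^ 1) f z" by auto
        have "1 / N \<le> 1" using N by simp
        hence "cauchy_weight z \<le> 2 * (1 + 1\<^sup>2) * cauchy_weight a"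
          using z t by (intro cauchy_weight_shift) auto
        hence "C * cauchy_weight z \<le> C * (4 * cauchy_weight a)" using C(1) by (intro mult_left_mono) auto
        hence "\<bar>(deriv ^^ 1) f z\<bar> \<le> 4 * C * cauchy_weight a" using C(2)[of z] by linarith
        hence "\<bar>t - a\<bar> * \<bar>(deriv ^^ 1) f z\<bar> \<le> (1 / N) * (4 * C * cauchy_weight a)"
          using t N by (intro mult_mono) auto
        thus ?thesis unfolding z(3) by (simp add: abs_mult)
      qed (use C N cauchy_weight_pos[of a] in simp)
      have ab: "a \<le> a + 1 / N" using N by simp
      have ci: "continuous_on {a..a + 1 / N} f" using schwartz_continuous[OF f] .
      have "norm (integral {a..a + 1 / N} (\<lambda>t. f t - f a)) \<le> (4 * C * cauchy_weight a / N) * (a + 1 / N - a)"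
        using ab ci bd by (intro integral_bound continuous_intros) auto
      moreover have "integral {a..a + 1 / N} (\<lambda>t. f t - f a) = integral {a..a + 1 / N} f - f a / N"
        using ab ci by (subst integral_diff) (auto intro: integrable_continuous_real)
      ultimately show ?thesis unfolding e_def b a_def[symmetric] by (simp add: power2_eq_square abs_minus_commute)
    qed
    have part: "\<bar>(\<Sum>x\<in>{- int X..<int X}. f (real_of_int x / N)) / N - integral {- (real X / N)..real X / N} f\<bar>
        \<le> (\<Sum>x\<in>{- int X..<int X}. e x)" for X
    proof (induction X)
      case (Suc X)
      have s: "{- int (Suc X)..<int (Suc X)} = insert (- int (Suc X)) (insert (int X) {- int X..<int X})" by auto
      have S: "(\<Sum>x\<in>{- int (Suc X)..<int (Suc X)}. g x) = g (- int (Suc X)) + (g (int X) + (\<Sum>x\<in>{- int X..<int X}. g x))"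
        for g :: "int \<Rightarrow> real" unfolding s by simp
      have io: "f integrable_on {a..b}" for a b using schwartz_continuous[OF f] by (rule integrable_continuous_real)
      have "integral {- (real (Suc X) / N)..real (Suc X) / N} f =
         integral {- (real (Suc X) / N)..- (real X / N)} f + integral {- (real X / N)..real (Suc X) / N} f"
        using N by (intro Henstock_Kurzweil_Integration.integral_combine[of "- (real (Suc X) / N)" "- (real X / N)" "real (Suc X) / N", symmetric] io)
          (auto simp: divide_right_mono intro: order_trans[of _ 0])
      also have "integral {- (real X / N)..real (Suc X) / N} f =
         integral {- (real X / N)..real X / N} f + integral {real X / N..real (Suc X) / N} f"
        using N by (intro Henstock_Kurzweil_Integration.integral_combine[of "- (real X / N)" "real X / N" "real (Suc X) / N", symmetric] io)
          (auto simp: divide_right_mono intro: order_trans[of _ 0])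
      finally have I: "integral {- (real (Suc X) / N)..real (Suc X) / N} f =
         integral {- (real (Suc X) / N)..- (real X / N)} f + (integral {- (real X / N)..real X / N} f + integral {real X / N..real (Suc X) / N} f)" .
      have 1: "\<bar>f (real_of_int (- int (Suc X)) / N) / N - integral {- (real (Suc X) / N)..- (real X / N)} f\<bar> \<le> e (- int (Suc X))"
      proof -
        have "real_of_int (- int (Suc X)) = - real (Suc X)" by simp
        hence "real_of_int (- int (Suc X)) / N = - (real (Suc X) / N)" by (simp only: minus_divide_left)
        moreover have "real_of_int (- int (Suc X) + 1) / N = - (real X / N)" by simp
        ultimately show ?thesis using cell[of "- int (Suc X)"] by (simp only:)
      qed
      have 2: "\<bar>f (real_of_int (int X) / N) / N - integral {real X / N..real (Suc X) / N} f\<bar> \<le> e (int X)"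
        using cell[of "int X"] by (simp add: add.commute)
      show ?case unfolding S I add_divide_distrib using 1 2 Suc by linarith
    qed simp
    have esum: "(\<Sum>x\<in>F. e x) \<le> 24 * C / N" if "finite F" for F
    proof -
      have "(\<Sum>x\<in>F. e x) = 4 * C / N\<^sup>2 * (\<Sum>x\<in>F. cauchy_weight (real_of_int x / N))"
        unfolding e_def by (simp only: sum_distrib_left)
      also have "\<dots> \<le> 4 * C / N\<^sup>2 * (6 * N)" using C(1) sum_cauchy_weight_int[OF N that] by (intro mult_left_mono) auto
      also have "\<dots> = 24 * C / N" using N by (simp add: power2_eq_square)
      finally show ?thesis .
    qed
    have summ: "(\<lambda>x::int. f (real_of_int x / N)) summable_on UNIV"
      by (rule samples_summable[OF N, of _ C0]) (use C0(2) in simp)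
    have fl: "filterlim (\<lambda>X. {- int X..<int X}) (finite_subsets_at_top UNIV) sequentially"
      unfolding filterlim_finite_subsets_at_top
    proof (intro allI impI)
      fix F :: "int set" assume F: "finite F \<and> F \<subseteq> UNIV"
      define X0 where "X0 = Suc (nat (Max (insert 0 (abs ` F))))"
      have "\<bar>x\<bar> < int X0" if "x \<in> F" for x
      proof -
        have "\<bar>x\<bar> \<le> Max (insert 0 (abs ` F))" using that F by (intro Max_ge) auto
        thus ?thesis unfolding X0_def by linarith
      qed
      hence X0: "F \<subseteq> {- int X0..<int X0}" by (fastforce simp: abs_less_iff)
      show "eventually (\<lambda>X. finite {- int X..<int X} \<and> F \<subseteq> {- int X..<int X} \<and> {- int X..<int X} \<subseteq> UNIV) sequentially"
      proof (rule eventually_sequentiallyI[of X0])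
        fix X assume "X \<ge> X0"
        hence "{- int X0..<int X0} \<subseteq> {- int X..<int X}" by auto
        thus "finite {- int X..<int X} \<and> F \<subseteq> {- int X..<int X} \<and> {- int X..<int X} \<subseteq> UNIV" using X0 by auto
      qed
    qed
    have "((\<lambda>x::int. f (real_of_int x / N)) has_sum (\<Sum>\<^sub>\<infinity>x::int. f (real_of_int x / N))) UNIV"
      using summ by (rule has_sum_infsum)
    hence "(\<lambda>X. \<Sum>x\<in>{- int X..<int X}. f (real_of_int x / N)) \<longlonglongrightarrow> (\<Sum>\<^sub>\<infinity>x::int. f (real_of_int x / N))"
      unfolding has_sum_def using filterlim_compose[OF _ fl] by blast
    hence "(\<lambda>X. \<bar>(\<Sum>x\<in>{- int X..<int X}. f (real_of_int x / N)) / N - integral {- (real X / N)..real X / N} f\<bar>)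
       \<longlonglongrightarrow> \<bar>(\<Sum>\<^sub>\<infinity>x::int. f (real_of_int x / N)) / N - integral\<^sup>L lborel f\<bar>"
      using N integral_symmetric_limit[OF f, of N] by (intro tendsto_intros) auto
    thus ?thesis
      by (rule LIMSEQ_le_const2) (use part esum in \<open>auto intro: order_trans\<close>)
  qed
  moreover have "24 * C \<ge> 0" using C(1) by simp
  ultimately show ?thesis by blast
qed

section \<open>Finite Fourier analysis\<close>

lemma has_sum_product_pair:
  fixes u :: "'a \<Rightarrow> complex" and v :: "'b \<Rightarrow> complex"
  assumes u: "(\<lambda>x. norm (u x)) summable_on UNIV" and v: "(\<lambda>x. norm (v x)) summable_on UNIV"
  shows "(\<lambda>(x, y). norm (u x * v y)) summable_on UNIV"
    and "((\<lambda>(x, y). u x * v y) has_sum infsum u UNIV * infsum v UNIV) UNIV"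
proof -
  have a: "(\<lambda>z. norm ((\<lambda>(x, y). u x * v y) z)) summable_on (UNIV \<times> UNIV)"
  proof (subst Infinite_Sum.abs_summable_on_Sigma_iff, intro conjI ballI)
    fix x :: 'a
    have "(\<lambda>y. norm (u x) * norm (v y)) summable_on UNIV" by (rule summable_on_cmult_right[OF v])
    thus "(\<lambda>y. norm ((\<lambda>(x, y). u x * v y) (x, y))) summable_on UNIV" by (simp add: norm_mult)
  next
    have "(\<lambda>x. norm (u x) * (\<Sum>\<^sub>\<infinity>y. norm (v y))) summable_on UNIV" by (rule summable_on_cmult_left[OF u])
    moreover have "0 \<le> (\<Sum>\<^sub>\<infinity>y. norm (v y))" by (rule infsum_nonneg) simp
    moreover have "(\<Sum>\<^sub>\<infinity>y. norm (u x) * norm (v y)) = norm (u x) * (\<Sum>\<^sub>\<infinity>y. norm (v y))" for x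
      by (rule infsum_cmult_right')
    ultimately show "(\<lambda>x. norm (\<Sum>\<^sub>\<infinity>y. norm ((\<lambda>(x, y). u x * v y) (x, y)))) summable_on UNIV"
      by (simp add: norm_mult abs_mult)
  qed
  thus "(\<lambda>(x, y). norm (u x * v y)) summable_on UNIV" by (simp add: case_prod_unfold)
  have s: "(\<lambda>(x, y). u x * v y) summable_on (UNIV \<times> UNIV)" using a by (rule abs_summable_summable)
  have "infsum (\<lambda>(x, y). u x * v y) (UNIV \<times> UNIV) = (\<Sum>\<^sub>\<infinity>x. \<Sum>\<^sub>\<infinity>y. u x * v y)"
    using infsum_Sigma'_banach[of "\<lambda>x y. u x * v y" UNIV "\<lambda>_. UNIV"] s by simp
  also have "\<dots> = (\<Sum>\<^sub>\<infinity>x. u x * infsum v UNIV)" by (simp only: infsum_cmult_right')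
  also have "\<dots> = infsum u UNIV * infsum v UNIV" by (rule infsum_cmult_left')
  finally show "((\<lambda>(x, y). u x * v y) has_sum infsum u UNIV * infsum v UNIV) UNIV"
    using has_sum_infsum[OF s] by simp
qed

lemma has_sum_product_triple:
  fixes u v w :: "int \<Rightarrow> complex"
  assumes u: "(\<lambda>x. norm (u x)) summable_on UNIV" and v: "(\<lambda>x. norm (v x)) summable_on UNIV"
    and w: "(\<lambda>x. norm (w x)) summable_on UNIV"
  shows "((\<lambda>(x, y, z). u x * (v y * w z)) has_sum infsum u UNIV * (infsum v UNIV * infsum w UNIV)) UNIV"
proof -
  define vw where "vw = (\<lambda>(y, z). v y * w z)"
  have "(\<lambda>x. norm (vw x)) summable_on UNIV"
    using has_sum_product_pair(1)[OF v w] unfolding vw_def by (simp add: case_prod_unfold)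
  moreover have "infsum vw UNIV = infsum v UNIV * infsum w UNIV"
    using infsumI[OF has_sum_product_pair(2)[OF v w]] unfolding vw_def by simp
  ultimately have "((\<lambda>(x, y). u x * vw y) has_sum infsum u UNIV * (infsum v UNIV * infsum w UNIV)) UNIV"
    using has_sum_product_pair(2)[OF u, of vw] by simp
  moreover have "(\<lambda>(x, y). u x * vw y) = (\<lambda>(x, y, z). u x * (v y * w z))" unfolding vw_def by auto
  ultimately show ?thesis by simp
qed

lemma has_sum_finite_combination:
  fixes f :: "'a \<Rightarrow> 'b \<Rightarrow> complex"
  assumes "finite A" "\<And>a. a \<in> A \<Longrightarrow> (f a has_sum s a) S"
  shows "((\<lambda>x. \<Sum>a\<in>A. f a x) has_sum (\<Sum>a\<in>A. s a)) S"
  using assms by (induction rule: finite_induct) (auto intro!: has_sum_add)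

text \<open>The range is a complete residue system, so shifting it by one multiplies the sum by
  \<open>ez q d\<close> without changing it. Its symmetry about 0 keeps \<open>m / q\<close> within
  1/2, where the decay estimate is available.\<close>

lemma sum_ez_orthogonal:
  assumes q: "q = 2 * r + 1" "r \<ge> 0"
  shows "(\<Sum>m\<in>{-r..r}. ez q (m * d)) = (if q dvd d then of_int q else 0)"
proof (cases "q dvd d")
  case True
  hence "ez q (m * d) = 1" for m using q by (subst ez_eq_1_iff) auto
  thus ?thesis using True q by simp
next
  case False
  have qp: "q > 0" using q by simp
  define S where "S = (\<Sum>m\<in>{-r..r}. ez q (m * d))"
  have "S * ez q d = (\<Sum>m\<in>{-r..r}. ez q ((m + 1) * d))"
    unfolding S_def sum_distrib_right by (simp add: ring_distribs ez_add)
  also have "\<dots> = (\<Sum>m\<in>{-r+1..r+1}. ez q (m * d))"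
    by (rule sum.reindex_bij_witness[of _ "\<lambda>m. m - 1" "\<lambda>m. m + 1"]) auto
  also have "\<dots> = (\<Sum>m\<in>{-r+1..r}. ez q (m * d)) + ez q ((r + 1) * d)"
  proof -
    have "{-r+1..r+1} = insert (r + 1) {-r+1..r}" using q by auto
    thus ?thesis by simp
  qed
  also have "ez q ((r + 1) * d) = ez q (-r * d)"
  proof (rule ez_cong[OF qp])
    have "(r + 1) * d - - r * d = q * d" unfolding q(1) by (simp add: algebra_simps)
    thus "q dvd (r + 1) * d - - r * d" by simp
  qed
  also have "(\<Sum>m\<in>{-r+1..r}. ez q (m * d)) + ez q (-r * d) = S"
  proof -
    have "{-r..r} = insert (-r) {-r+1..r}" using q by auto
    thus ?thesis unfolding S_def by simp
  qed
  finally have "S * (ez q d - 1) = 0" by (simp add: algebra_simps)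
  moreover have "ez q d \<noteq> 1" using False ez_eq_1_iff[OF qp] by simp
  ultimately show ?thesis using False unfolding S_def by simp
qed

section \<open>Fourier expansion of the weighted count\<close>

fun ball3 :: "int \<Rightarrow> ivec \<Rightarrow> bool" where
  "ball3 r (x, y, z) \<longleftrightarrow> \<bar>x\<bar> \<le> r \<and> \<bar>y\<bar> \<le> r \<and> \<bar>z\<bar> \<le> r"

lemma ball3_eq: "{m. ball3 r m} = {-r..r} \<times> {-r..r} \<times> {-r..r}"
  by (auto simp: abs_le_iff)

text \<open>Fourier inversion on residue vectors: by orthogonality in each coordinate only the zero
  congruent to \<open>x\<close> survives.\<close>

lemma indicator_by_expsum:
  assumes q: "p ^ n = 2 * r + 1" "r \<ge> 0"
  shows "(\<Sum>m | ball3 r m. expsum p a n m * ez (p ^ n) (- dot m x))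
    = (if redv (p ^ n) x \<in> zeros p a n then of_int (p ^ n) ^ 3 else 0)"
proof -
  define q where "q = p ^ n"
  have qr: "q = 2 * r + 1" and qp: "q > 0" using q unfolding q_def by auto
  obtain x1 x2 x3 where x: "x = (x1, x2, x3)" by (cases x)
  have inner: "(\<Sum>m | ball3 r m. ez q (dot m b) * ez q (- dot m x)) = (if dvdv q (b - x) then of_int q ^ 3 else 0)" for b
  proof -
    obtain b1 b2 b3 where b: "b = (b1, b2, b3)" by (cases b)
    have "(\<Sum>m | ball3 r m. ez q (dot m b) * ez q (- dot m x))
        = (\<Sum>(m1, m2, m3)\<in>{-r..r} \<times> {-r..r} \<times> {-r..r}. ez q (m1 * (b1 - x1)) * (ez q (m2 * (b2 - x2)) * ez q (m3 * (b3 - x3))))"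
      unfolding ball3_eq by (rule sum.cong) (auto simp: x b right_diff_distrib simp flip: ez_add intro!: arg_cong[where f = "ez q"])
    also have "\<dots> = (\<Sum>m1\<in>{-r..r}. ez q (m1 * (b1 - x1))) * ((\<Sum>m2\<in>{-r..r}. ez q (m2 * (b2 - x2))) * (\<Sum>m3\<in>{-r..r}. ez q (m3 * (b3 - x3))))"
      by (simp add: sum.cartesian_product[symmetric] sum_distrib_left[symmetric] sum_distrib_right[symmetric])
    also have "\<dots> = (if dvdv q (b - x) then of_int q ^ 3 else 0)"
      unfolding sum_ez_orthogonal[OF qr q(2)] b x by (simp add: power3_eq_cube)
    finally show ?thesis .
  qed
  have "(\<Sum>m | ball3 r m. expsum p a n m * ez q (- dot m x))
      = (\<Sum>b\<in>zeros p a n. \<Sum>m | ball3 r m. ez q (dot m b) * ez q (- dot m x))"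
    unfolding expsum_def q_def[symmetric] sum_distrib_right by (rule sum.swap)
  also have "\<dots> = (\<Sum>b\<in>zeros p a n. if b = redv q x then of_int q ^ 3 else 0)"
  proof (rule sum.cong[OF refl])
    fix b assume b: "b \<in> zeros p a n"
    have "dvdv q (b - x) \<longleftrightarrow> b = redv q x"
    proof
      assume "dvdv q (b - x)"
      hence "dvdv q ((b - x) - (redv q x - x))" using redv_cong by (rule dvdv_diff)
      hence "dvdv q (b - redv q x)" by simp
      moreover have "boxed q b" using b unfolding zeros_def q_def by blast
      ultimately show "b = redv q x" using boxed_redv[OF qp] boxed_cong_eq by blast
    qed (simp add: redv_cong)
    thus "(\<Sum>m | ball3 r m. ez q (dot m b) * ez q (- dot m x)) = (if b = redv q x then of_int q ^ 3 else 0)"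
      unfolding inner by simp
  qed
  also have "\<dots> = (if redv q x \<in> zeros p a n then of_int q ^ 3 else 0)" using finite_zeros by simp
  finally show ?thesis unfolding q_def .
qed

definition weighted_count :: "(real \<Rightarrow> real) \<Rightarrow> real \<Rightarrow> int \<Rightarrow> ivec \<Rightarrow> nat \<Rightarrow> real" where
  "weighted_count f N p a n = infsum (\<lambda>(x1, x2, x3). f (real_of_int x1 / N) * f (real_of_int x2 / N) * f (real_of_int x3 / N))
     {x. redv (p ^ n) x \<in> zeros p a n}"

fun sample_product :: "(real \<Rightarrow> real) \<Rightarrow> real \<Rightarrow> int \<Rightarrow> ivec \<Rightarrow> complex" where
  "sample_product f N q (m1, m2, m3) = sample_sum f N (m1 / q) * (sample_sum f N (m2 / q) * sample_sum f N (m3 / q))"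

lemma weighted_count_fourier:
  assumes q: "p ^ n = 2 * r + 1" "r \<ge> 0" and N: "N \<ge> 1" and f: "\<And>t. \<bar>f t\<bar> \<le> C * cauchy_weight t"
  shows "complex_of_real (weighted_count f N p a n) * of_int (p ^ n) ^ 3
    = (\<Sum>m | ball3 r m. expsum p a n m * sample_product f N (p ^ n) m)"
proof -
  define q where "q = p ^ n"
  define F where "F = (\<lambda>(x1, x2, x3). f (real_of_int x1 / N) * f (real_of_int x2 / N) * f (real_of_int x3 / N))"
  define Z where "Z = {x. redv q x \<in> zeros p a n}"
  define Y where "Y = (\<Sum>m | ball3 r m. expsum p a n m * sample_product f N q m)"
  have summand: "((\<lambda>x. expsum p a n m * (complex_of_real (F x) * ez q (- dot m x))) has_sum (expsum p a n m * sample_product f N q m)) UNIV" for m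
  proof -
    obtain m1 m2 m3 where m: "m = (m1, m2, m3)" by (cases m)
    define u where "u k x = complex_of_real (f (real_of_int x / N)) * cis (- 2 * pi * real_of_int x * (real_of_int k / q))" for k x
    have su: "(\<lambda>x. norm (u k x)) summable_on UNIV" for k
      by (rule weight_bounded_summable(1)[OF N, of _ C]) (use f in \<open>simp add: u_def norm_mult\<close>)
    have ue: "u k x = complex_of_real (f (real_of_int x / N)) * ez q (- (k * x))" for k x
      unfolding u_def ez_def by (simp add: mult_ac)
    have "((\<lambda>(x, y, z). u m1 x * (u m2 y * u m3 z)) has_sum sample_product f N q m) UNIV"
      using has_sum_product_triple[OF su su su, of m1 m2 m3] unfolding m sample_product.simps sample_sum_def u_def .
    moreover have "(\<lambda>(x, y, z). u m1 x * (u m2 y * u m3 z)) = (\<lambda>x. complex_of_real (F x) * ez q (- dot m x))"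
    proof (rule ext)
      fix x :: ivec
      obtain x1 x2 x3 where x: "x = (x1, x2, x3)" by (cases x)
      have "ez q (- dot m x) = ez q (- (m1 * x1)) * (ez q (- (m2 * x2)) * ez q (- (m3 * x3)))"
      proof -
        have "- dot m x = - (m1 * x1) + (- (m2 * x2) + - (m3 * x3))" unfolding m x by simp
        thus ?thesis by (simp only: ez_add)
      qed
      thus "(\<lambda>(x, y, z). u m1 x * (u m2 y * u m3 z)) x = complex_of_real (F x) * ez q (- dot m x)"
        unfolding x F_def ue by (simp add: mult_ac)
    qed
    ultimately show ?thesis by (intro has_sum_cmult_right) simp
  qed
  have "finite {m. ball3 r m}" unfolding ball3_eq by simp
  hence "((\<lambda>x. \<Sum>m | ball3 r m. expsum p a n m * (complex_of_real (F x) * ez q (- dot m x))) has_sum Y) UNIV"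
    unfolding Y_def using summand by (rule has_sum_finite_combination)
  moreover have "(\<Sum>m | ball3 r m. expsum p a n m * (complex_of_real (F x) * ez q (- dot m x)))
      = (if x \<in> Z then complex_of_real (F x) * of_int q ^ 3 else 0)" for x
  proof -
    have "(\<Sum>m | ball3 r m. expsum p a n m * (complex_of_real (F x) * ez q (- dot m x)))
       = complex_of_real (F x) * (\<Sum>m | ball3 r m. expsum p a n m * ez q (- dot m x))"
      by (simp add: sum_distrib_left mult_ac)
    thus ?thesis unfolding q_def indicator_by_expsum[OF q] Z_def by simp
  qed
  ultimately have "((\<lambda>x. if x \<in> Z then complex_of_real (F x) * of_int q ^ 3 else 0) has_sum Y) UNIV" by simp
  hence h: "((\<lambda>x. complex_of_real (F x) * of_int q ^ 3) has_sum Y) Z"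
    by (rule has_sum_cong_neutral[THEN iffD1, rotated 3]) auto
  have "q \<noteq> 0" using q unfolding q_def by linarith
  hence q0: "(of_int q :: complex) ^ 3 \<noteq> 0" by simp
  have "((\<lambda>x. (complex_of_real (F x) * of_int q ^ 3) * (1 / of_int q ^ 3)) has_sum Y * (1 / of_int q ^ 3)) Z"
    using h by (rule has_sum_cmult_left)
  hence h2: "((\<lambda>x. complex_of_real (F x)) has_sum Y / of_int q ^ 3) Z" using q0 by simp
  \<comment> \<open>The sum of real terms is complex so far; its real part is the weighted count,
    and uniqueness of sums shows that there is no imaginary part.\<close>
  have "((\<lambda>x. Re (complex_of_real (F x))) has_sum Re (Y / of_int q ^ 3)) Z" using h2 by (rule has_sum_Re)
  hence hr: "(F has_sum Re (Y / of_int q ^ 3)) Z" by simp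
  hence "weighted_count f N p a n = Re (Y / of_int q ^ 3)"
    unfolding weighted_count_def F_def Z_def q_def by (rule infsumI)
  moreover have "complex_of_real (Re (Y / of_int q ^ 3)) = Y / of_int q ^ 3"
    using has_sum_of_real[OF hr, where 'a = complex] h2 by (rule has_sum_unique)
  ultimately have "complex_of_real (weighted_count f N p a n) = Y / of_int q ^ 3" by (simp only:)
  hence "complex_of_real (weighted_count f N p a n) * of_int q ^ 3 = Y" using q0 by simp
  thus ?thesis unfolding Y_def q_def .
qed

text \<open>A frequency beyond \<open>M\<close> has at least one coordinate beyond \<open>M\<close>.
  Only that factor uses decay; the other two are bounded trivially by \<open>K0 * N\<close>.\<close>

lemma sample_product_bounds:
  fixes q r :: int and M :: real
  assumes q: "q = 2 * r + 1" "r \<ge> 0" and N: "N \<ge> 1" and M: "M > 0"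
    and K0: "K0 \<ge> 0" "\<And>\<theta>. norm (sample_sum f N \<theta>) \<le> K0 * N"
    and CA: "CA \<ge> 0" "\<And>\<theta>. \<theta> \<noteq> 0 \<Longrightarrow> \<bar>\<theta>\<bar> \<le> 1 / 2 \<Longrightarrow> norm (sample_sum f N \<theta>) \<le> CA * N * (1 / (N * \<bar>\<theta>\<bar>)) ^ A"
    and m: "ball3 r m"
  shows "norm (sample_product f N q m) \<le> (K0 * N) ^ 3"
    and "M < nrm m \<Longrightarrow> norm (sample_product f N q m) \<le> CA * N * (q / (N * M)) ^ A * (K0 * N)\<^sup>2"
proof -
  obtain m1 m2 m3 where m': "m = (m1, m2, m3)" by (cases m)
  define s where "s k = norm (sample_sum f N (real_of_int k / q))" for k
  have sp: "norm (sample_product f N q m) = s m1 * (s m2 * s m3)"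
    unfolding m' s_def by (simp add: norm_mult)
  have s0: "0 \<le> s k" "s k \<le> K0 * N" for k unfolding s_def using K0 by auto
  have KN: "K0 * N \<ge> 0" using K0 N by simp
  have "s m1 * (s m2 * s m3) \<le> (K0 * N) * ((K0 * N) * (K0 * N))"
    using s0 KN K0 N by (intro mult_mono mult_nonneg_nonneg) auto
  thus "norm (sample_product f N q m) \<le> (K0 * N) ^ 3" unfolding sp by (simp add: power3_eq_cube mult_ac)
  define E where "E = CA * N * (q / (N * M)) ^ A"
  have E0: "E \<ge> 0" unfolding E_def using CA N M q by simp
  have big: "s k \<le> E" if k: "M < \<bar>real_of_int k\<bar>" "\<bar>k\<bar> \<le> r" for k
  proof -
    have qp: "real_of_int q > 0" using q by simp
    have k0: "k \<noteq> 0" using k M by auto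
    have "2 * \<bar>k\<bar> \<le> q" using k q by linarith
    hence "2 * \<bar>real_of_int k\<bar> \<le> real_of_int q" by linarith
    hence h: "\<bar>real_of_int k / q\<bar> \<le> 1 / 2" using qp by (simp add: abs_divide field_simps)
    have "s k \<le> CA * N * (1 / (N * \<bar>real_of_int k / q\<bar>)) ^ A"
      unfolding s_def using CA(2)[OF _ h] k0 qp by simp
    also have "1 / (N * \<bar>real_of_int k / q\<bar>) = q / (N * \<bar>real_of_int k\<bar>)" using qp by (simp add: abs_divide)
    also have "CA * N * (q / (N * \<bar>real_of_int k\<bar>)) ^ A \<le> E"
      unfolding E_def using CA N M k qp
      by (intro mult_left_mono power_mono divide_left_mono mult_pos_pos) auto
    finally show ?thesis .
  qed
  assume "M < nrm m"
  then consider "M < \<bar>real_of_int m1\<bar>" | "M < \<bar>real_of_int m2\<bar>" | "M < \<bar>real_of_int m3\<bar>"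
    unfolding m' by (auto simp: less_max_iff_disj of_int_max)
  hence "s m1 * (s m2 * s m3) \<le> E * ((K0 * N) * (K0 * N))"
  proof cases
    case 1
    thus ?thesis using big[of m1] m s0 KN E0 K0 N unfolding m' by (intro mult_mono mult_nonneg_nonneg) auto
  next
    case 2
    have "s m2 * (s m1 * s m3) \<le> E * ((K0 * N) * (K0 * N))"
      using 2 big[of m2] m s0 KN E0 K0 N unfolding m' by (intro mult_mono mult_nonneg_nonneg) auto
    thus ?thesis by (simp add: mult_ac)
  next
    case 3
    have "s m3 * (s m1 * s m2) \<le> E * ((K0 * N) * (K0 * N))"
      using 3 big[of m3] m s0 KN E0 K0 N unfolding m' by (intro mult_mono mult_nonneg_nonneg) auto
    thus ?thesis by (simp add: mult_ac)
  qed
  thus "norm (sample_product f N q m) \<le> CA * N * (q / (N * M)) ^ A * (K0 * N)\<^sup>2"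
    unfolding sp E_def[symmetric] by (simp add: power2_eq_square mult_ac)
qed

section \<open>Main term and error of the weighted count\<close>

context
  fixes p :: int
  assumes p: "prime p" "p > 2"
begin

lemma prime_power_odd: "\<exists>r\<ge>0. p ^ n = 2 * r + 1"
proof -
  have "odd p" using p prime_odd_int by auto
  hence "odd (p ^ n)" by simp
  then obtain r where r: "p ^ n = 2 * r + 1" by (elim oddE)
  moreover have "p ^ n > 0" using p by simp
  ultimately show ?thesis by (intro exI[of _ r]) auto
qed

lemma card_zeros_le: "real (card (zeros p a n)) \<le> real_of_int (p ^ n) ^ 3"
proof -
  have "zeros p a n \<subseteq> {0..<p ^ n} \<times> {0..<p ^ n} \<times> {0..<p ^ n}"
  proof
    fix x assume "x \<in> zeros p a n"
    thus "x \<in> {0..<p ^ n} \<times> {0..<p ^ n} \<times> {0..<p ^ n}" unfolding zeros_def by (cases x) simp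
  qed
  hence "card (zeros p a n) \<le> card ({0..<p ^ n} \<times> {0..<p ^ n} \<times> {0..<p ^ n})" by (intro card_mono) auto
  also have "real \<dots> = real_of_int (p ^ n) ^ 3" using p by (simp add: card_cartesian_product power3_eq_cube)
  finally show ?thesis by simp
qed

lemma norm_expsum_trivial: "norm (expsum p a n m) \<le> real_of_int (p ^ n) ^ 3"
proof -
  have "norm (expsum p a n m) \<le> (\<Sum>x\<in>zeros p a n. norm (ez (p ^ n) (dot m x)))"
    unfolding expsum_def by (rule norm_sum)
  also have "\<dots> = real (card (zeros p a n))" by simp
  finally show ?thesis using card_zeros_le[of a n] by linarith
qed

text \<open>Frequency 0 is the main term and \<open>E\<close> covers frequencies up to
  \<open>M\<close>. The remaining ones, at most \<open>q ^ 3\<close> of them, are estimated with the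
  trivial bound \<open>q ^ 3\<close> for the exponential sum. The resulting \<open>q ^ 6\<close> is
  wasteful but is beaten by a large \<open>A\<close>.\<close>

lemma weighted_count_error:
  assumes N: "N \<ge> 1" and M: "M > 0"
    and f: "\<And>t. \<bar>f t\<bar> \<le> C * cauchy_weight t"
    and K0: "K0 \<ge> 0" "\<And>\<theta>. norm (sample_sum f N \<theta>) \<le> K0 * N"
    and CA: "CA \<ge> 0" "\<And>\<theta>. \<theta> \<noteq> 0 \<Longrightarrow> \<bar>\<theta>\<bar> \<le> 1 / 2 \<Longrightarrow> norm (sample_sum f N \<theta>) \<le> CA * N * (1 / (N * \<bar>\<theta>\<bar>)) ^ A"
    and G: "sample_sum f N 0 = complex_of_real G"
    and E: "(\<Sum>m | m \<noteq> (0, 0, 0) \<and> real_of_int (nrm m) \<le> M. norm (expsum p a n m)) \<le> E"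
  defines "q \<equiv> real_of_int (p ^ n)"
  shows "\<bar>weighted_count f N p a n * q ^ 3 - real (card (zeros p a n)) * G ^ 3\<bar>
    \<le> E * (K0 * N) ^ 3 + q ^ 6 * (CA * N * (q / (N * M)) ^ A * (K0 * N)\<^sup>2)"
proof -
  obtain r where r: "p ^ n = 2 * r + 1" "r \<ge> 0" using prime_power_odd by blast
  have q0: "q > 0" unfolding q_def using p by simp
  define g where "g m = expsum p a n m * sample_product f N (p ^ n) m" for m
  define B where "B = {m. ball3 r m}"
  have fB: "finite B" unfolding B_def ball3_eq by simp
  have cB: "real (card B) = q ^ 3"
    unfolding B_def ball3_eq q_def r(1) using r(2) by (simp add: card_cartesian_product power3_eq_cube mult_ac)
  have "expsum p a n (0, 0, 0) = of_nat (card (zeros p a n))"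
  proof -
    have "ez (p ^ n) (dot (0, 0, 0) x) = 1" for x by (cases x) (simp add: ez_def)
    thus ?thesis unfolding expsum_def by simp
  qed
  hence g0: "g (0, 0, 0) = complex_of_real (real (card (zeros p a n)) * G ^ 3)"
    unfolding g_def by (simp add: G power3_eq_cube)
  have "complex_of_real (weighted_count f N p a n) * of_int (p ^ n) ^ 3 = (\<Sum>m\<in>B. g m)"
    unfolding g_def B_def by (rule weighted_count_fourier[OF r N f])
  also have "\<dots> = g (0, 0, 0) + (\<Sum>m\<in>B - {(0, 0, 0)}. g m)"
    using fB r(2) by (intro sum.remove) (auto simp: B_def)
  finally have "(\<Sum>m\<in>B - {(0, 0, 0)}. g m) = complex_of_real (weighted_count f N p a n * q ^ 3 - real (card (zeros p a n)) * G ^ 3)"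
    unfolding g0 q_def by simp
  hence "\<bar>weighted_count f N p a n * q ^ 3 - real (card (zeros p a n)) * G ^ 3\<bar> = norm (\<Sum>m\<in>B - {(0, 0, 0)}. g m)"
    by (simp only: norm_of_real)
  also have "\<dots> \<le> (\<Sum>m\<in>B - {(0, 0, 0)}. norm (g m))" by (rule norm_sum)
  also have "\<dots> = (\<Sum>m\<in>{m\<in>B. m \<noteq> (0, 0, 0) \<and> real_of_int (nrm m) \<le> M}. norm (g m))
      + (\<Sum>m\<in>{m\<in>B. m \<noteq> (0, 0, 0) \<and> \<not> real_of_int (nrm m) \<le> M}. norm (g m))"
  proof -
    have "B - {(0, 0, 0)} = {m\<in>B. m \<noteq> (0, 0, 0) \<and> real_of_int (nrm m) \<le> M} \<union> {m\<in>B. m \<noteq> (0, 0, 0) \<and> \<not> real_of_int (nrm m) \<le> M}"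
      by blast
    moreover have "{m\<in>B. m \<noteq> (0, 0, 0) \<and> real_of_int (nrm m) \<le> M} \<inter> {m\<in>B. m \<noteq> (0, 0, 0) \<and> \<not> real_of_int (nrm m) \<le> M} = {}"
      by blast
    ultimately show ?thesis using fB by (simp only:) (rule sum.union_disjoint; simp)
  qed
  also have "\<dots> \<le> E * (K0 * N) ^ 3 + q ^ 6 * (CA * N * (q / (N * M)) ^ A * (K0 * N)\<^sup>2)"
  proof (rule add_mono)
    have "(\<Sum>m\<in>{m\<in>B. m \<noteq> (0, 0, 0) \<and> real_of_int (nrm m) \<le> M}. norm (g m))
        \<le> (\<Sum>m\<in>{m\<in>B. m \<noteq> (0, 0, 0) \<and> real_of_int (nrm m) \<le> M}. norm (expsum p a n m) * (K0 * N) ^ 3)"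
    proof (rule sum_mono)
      fix m assume "m \<in> {m\<in>B. m \<noteq> (0, 0, 0) \<and> real_of_int (nrm m) \<le> M}"
      hence b: "ball3 r m" unfolding B_def by blast
      show "norm (g m) \<le> norm (expsum p a n m) * (K0 * N) ^ 3"
        unfolding g_def norm_mult
        using sample_product_bounds(1)[OF r N M K0 CA b] by (intro mult_left_mono) auto
    qed
    also have "\<dots> \<le> (\<Sum>m | m \<noteq> (0, 0, 0) \<and> real_of_int (nrm m) \<le> M. norm (expsum p a n m) * (K0 * N) ^ 3)"
    proof (rule sum_mono2)
      show "finite {m. m \<noteq> (0, 0, 0) \<and> real_of_int (nrm m) \<le> M}"
        by (rule finite_subset[OF _ finite_nrm_le[of M]]) blast
    qed (use K0 N in auto)
    also have "\<dots> = (\<Sum>m | m \<noteq> (0, 0, 0) \<and> real_of_int (nrm m) \<le> M. norm (expsum p a n m)) * (K0 * N) ^ 3"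
      by (rule sum_distrib_right[symmetric])
    also have "\<dots> \<le> E * (K0 * N) ^ 3" using E K0 N by (intro mult_right_mono) auto
    finally show "(\<Sum>m\<in>{m\<in>B. m \<noteq> (0, 0, 0) \<and> real_of_int (nrm m) \<le> M}. norm (g m)) \<le> E * (K0 * N) ^ 3" .
  next
    define T where "T = CA * N * (q / (N * M)) ^ A * (K0 * N)\<^sup>2"
    have T0: "T \<ge> 0" unfolding T_def using CA N M q0 by simp
    have "(\<Sum>m\<in>{m\<in>B. m \<noteq> (0, 0, 0) \<and> \<not> real_of_int (nrm m) \<le> M}. norm (g m))
        \<le> (\<Sum>m\<in>{m\<in>B. m \<noteq> (0, 0, 0) \<and> \<not> real_of_int (nrm m) \<le> M}. q ^ 3 * T)"
    proof (rule sum_mono)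
      fix m assume "m \<in> {m\<in>B. m \<noteq> (0, 0, 0) \<and> \<not> real_of_int (nrm m) \<le> M}"
      hence b: "ball3 r m" "M < nrm m" unfolding B_def by auto
      show "norm (g m) \<le> q ^ 3 * T"
        unfolding g_def norm_mult T_def q_def
        using sample_product_bounds(2)[OF r N M K0 CA b] norm_expsum_trivial[of a n m] p
        by (intro mult_mono) auto
    qed
    also have "\<dots> = real (card {m\<in>B. m \<noteq> (0, 0, 0) \<and> \<not> real_of_int (nrm m) \<le> M}) * (q ^ 3 * T)" by simp
    also have "\<dots> \<le> real (card B) * (q ^ 3 * T)"
      using fB T0 q0 by (intro mult_right_mono) (auto intro!: card_mono)
    also have "\<dots> = q ^ 6 * T" unfolding cB by (simp flip: power_add)
    finally show "(\<Sum>m\<in>{m\<in>B. m \<noteq> (0, 0, 0) \<and> \<not> real_of_int (nrm m) \<le> M}. norm (g m)) \<le> q ^ 6 * (CA * N * (q / (N * M)) ^ A * (K0 * N)\<^sup>2)"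
      unfolding T_def .
  qed
  finally show ?thesis .
qed

lemma solution_set_eq:
  assumes n: "n \<ge> 1"
  shows "{(x1, x2, x3). coprime (x1 * x2 * x3) p \<and> [a1 * x1\<^sup>2 + a2 * x2\<^sup>2 + a3 * x3\<^sup>2 = 0] (mod p ^ n)}
    = {x. redv (p ^ n) x \<in> zeros p (a1, a2, a3) n}"
proof (intro Set.set_eqI)
  fix x :: ivec
  obtain x1 x2 x3 where x: "x = (x1, x2, x3)" by (cases x)
  have pos: "p ^ n > 0" using p by simp
  have pq: "p dvd p ^ n" using n by (simp add: dvd_power)
  have c: "dvdv (p ^ n) (redv (p ^ n) x - x)" by (rule redv_cong)
  have 1: "unitc p (redv (p ^ n) x) \<longleftrightarrow> unitc p x"
    using unitc_cong[of p "redv (p ^ n) x" x] unitc_cong[of p x "redv (p ^ n) x"] dvdv_trans[OF pq c]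
      dvdv_diff_commute by blast
  have 2: "p ^ n dvd qf (a1, a2, a3) (redv (p ^ n) x) \<longleftrightarrow> p ^ n dvd qf (a1, a2, a3) x"
    using qf_cong[OF c, of "(a1, a2, a3)"] by (metis dvd_diff_left_iff dvd_diff_right_iff)
  have "x \<in> {x. redv (p ^ n) x \<in> zeros p (a1, a2, a3) n} \<longleftrightarrow> unitc p x \<and> p ^ n dvd qf (a1, a2, a3) x"
    unfolding zeros_def using 1 2 boxed_redv[OF pos] by simp
  also have "\<dots> \<longleftrightarrow> x \<in> {(x1, x2, x3). coprime (x1 * x2 * x3) p \<and> [a1 * x1\<^sup>2 + a2 * x2\<^sup>2 + a3 * x3\<^sup>2 = 0] (mod p ^ n)}"
    unfolding x by (simp add: coprime_prime_iff[OF p(1)] pdvd_mult[OF p] cong_0_iff)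
  finally show "x \<in> {(x1, x2, x3). coprime (x1 * x2 * x3) p \<and> [a1 * x1\<^sup>2 + a2 * x2\<^sup>2 + a3 * x3\<^sup>2 = 0] (mod p ^ n)}
      \<longleftrightarrow> x \<in> {x. redv (p ^ n) x \<in> zeros p (a1, a2, a3) n}" by blast
qed

text \<open>As \<open>s_p\<close> is an integer below \<open>p\<close>, the difference is at least
  1. The bounds do not involve the coefficients, which is what makes a final division by
  \<open>C_p\<close> uniform.\<close>

lemma C_p_bounds:
  assumes "p > s_p p a1 a2 a3"
  shows "(p - 1) / real_of_int (p\<^sup>2) \<le> C_p p a1 a2 a3" and "C_p p a1 a2 a3 \<le> 1"
proof -
  have s: "s_p p a1 a2 a3 \<ge> -1"
    using Legendre_values[OF p, of "- a1 * a2"] Legendre_values[OF p, of "- a1 * a3"] Legendre_values[OF p, of "- a2 * a3"]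
    unfolding s_p_def by auto
  have "real_of_int (p - s_p p a1 a2 a3) \<ge> 1" using assms by linarith
  hence "1 * real_of_int (p - 1) \<le> real_of_int (p - s_p p a1 a2 a3) * real_of_int (p - 1)"
    using p by (intro mult_right_mono) auto
  thus "(p - 1) / real_of_int (p\<^sup>2) \<le> C_p p a1 a2 a3"
    unfolding C_p_def by (intro divide_right_mono) auto
  have "(p - s_p p a1 a2 a3) * (p - 1) \<le> (p + 1) * (p - 1)" using s p by (intro mult_right_mono) auto
  also have "\<dots> \<le> p\<^sup>2" by (simp add: power2_eq_square algebra_simps)
  finally have "real_of_int ((p - s_p p a1 a2 a3) * (p - 1)) \<le> real_of_int (p\<^sup>2)" by (simp only: of_int_le_iff)
  thus "C_p p a1 a2 a3 \<le> 1" unfolding C_p_def using p by (simp add: divide_le_eq_1)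
qed

end

text \<open>By continuity, a positive value would force a positive integral over a short
  interval.\<close>

lemma schwartz_zero:
  assumes f: "schwartz f" "\<And>x. f x \<ge> 0" and i: "integral\<^sup>L lborel f = 0"
  shows "f x = 0"
proof (rule ccontr)
  assume "f x \<noteq> 0"
  hence pos: "f x > 0" using f(2)[of x] by simp
  have "continuous (at x) f" using schwartz_continuous[OF f(1), of UNIV] by (simp add: continuous_on_eq_continuous_at)
  then obtain d where d: "d > 0" "\<And>y. \<bar>y - x\<bar> < d \<Longrightarrow> \<bar>f y - f x\<bar> < f x / 2"
    using pos unfolding continuous_at_eps_delta dist_real_def by (metis half_gt_zero)
  have "f y \<ge> indicator {x..x + d / 2} y *\<^sub>R (f x / 2)" for y
  proof (cases "y \<in> {x..x + d / 2}")
    case True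
    hence "\<bar>y - x\<bar> < d" using d(1) by auto
    hence "\<bar>f y - f x\<bar> < f x / 2" by (rule d(2))
    hence "f x / 2 \<le> f y" by linarith
    thus ?thesis using True by simp
  qed (use f in simp)
  moreover have "integrable lborel (\<lambda>y. indicator {x..x + d / 2} y *\<^sub>R (f x / 2))"
    using d(1) by (intro integrable_scaleR_left integrable_real_indicator) auto
  ultimately have "integral\<^sup>L lborel (\<lambda>y. indicator {x..x + d / 2} y *\<^sub>R (f x / 2)) \<le> integral\<^sup>L lborel f"
    using schwartz_integrable[OF f(1)] by (intro integral_mono) auto
  also have "integral\<^sup>L lborel (\<lambda>y. indicator {x..x + d / 2} y *\<^sub>R (f x / 2)) = (d / 2) * (f x / 2)"
    using d(1) by (subst integral_scaleR_left) auto
  finally show False using i d(1) pos by (simp add: mult_le_0_iff)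
qed

section \<open>Choice of parameters and passage to the limit\<close>

theorem theorem1p2:
  fixes \<epsilon> :: real and p :: int and \<Phi> :: "real \<Rightarrow> real"
    and a1 a2 a3 :: "nat \<Rightarrow> int" and N :: "nat \<Rightarrow> real"
  assumes "\<epsilon> > 0" and "prime p" and "p > 2"
    and "schwartz \<Phi>" and "\<And>x. \<Phi> x \<ge> 0"
    and "\<And>n. coprime (a1 n) p" and "\<And>n. coprime (a2 n) p" and "\<And>n. coprime (a3 n) p"
    and "\<And>n. p > s_p p (a1 n) (a2 n) (a3 n)"
    and "\<And>n. N n \<ge> real_of_int (p ^ n) powr (11/18 + \<epsilon>)"
  shows "(\<lambda>n. complex_of_real
            (infsum (\<lambda>(x1, x2, x3). \<Phi> (real_of_int x1 / N n) * \<Phi> (real_of_int x2 / N n) * \<Phi> (real_of_int x3 / N n))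
              {(x1 :: int, x2 :: int, x3 :: int).
                 coprime (x1 * x2 * x3) p \<and>
                 [a1 n * x1\<^sup>2 + a2 n * x2\<^sup>2 + a3 n * x3\<^sup>2 = 0] (mod (p ^ n))}))
         \<sim>[sequentially]
         (\<lambda>n. fourier_transform \<Phi> 0 ^ 3 * complex_of_real (C_p p (a1 n) (a2 n) (a3 n))
               * complex_of_real (N n ^ 3 / real_of_int (p ^ n)))"
proof -
  have p: "prime p" "p > 2" by fact+
  define I where "I = integral\<^sup>L lborel \<Phi>"
  define q where "q n = real_of_int (p ^ n)" for n
  define c where "c n = C_p p (a1 n) (a2 n) (a3 n)" for n
  define W where "W n = weighted_count \<Phi> (N n) p (a1 n, a2 n, a3 n) n" for n
  define F where "F n = infsum (\<lambda>(x1, x2, x3). \<Phi> (real_of_int x1 / N n) * \<Phi> (real_of_int x2 / N n) * \<Phi> (real_of_int x3 / N n))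
              {(x1 :: int, x2 :: int, x3 :: int).
                 coprime (x1 * x2 * x3) p \<and>
                 [a1 n * x1\<^sup>2 + a2 n * x2\<^sup>2 + a3 n * x3\<^sup>2 = 0] (mod (p ^ n))}" for n
  have FW: "F n = W n" if "n \<ge> 1" for n
    unfolding F_def W_def weighted_count_def solution_set_eq[OF p that] ..
  have p1: "real_of_int p > 1" using p by simp
  have q1: "q n \<ge> 1" for n unfolding q_def using p1 by simp
  have N1: "N n \<ge> 1" for n
  proof -
    have "1 \<le> q n powr (11/18 + \<epsilon>)" using q1 assms(1) by (intro ge_one_powr_ge_zero) auto
    thus ?thesis using assms(10)[of n] unfolding q_def by linarith
  qed
  have u: "unitv p (a1 n, a2 n, a3 n)" for n using assms by simp
  show ?thesis
  \<comment> \<open>In the degenerate case \<open>\<Phi>\<close> vanishes identically; both sides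
    are 0, and asymptotic equivalence counts 0 over 0 as ratio 1.\<close>
  proof (cases "I = 0")
    case True
    have z: "\<Phi> x = 0" for x using schwartz_zero[OF assms(4,5)] True unfolding I_def by blast
    have "fourier_transform \<Phi> 0 = 0" unfolding fourier_transform_0 using True I_def by simp
    thus ?thesis by (simp add: z case_prod_unfold)
  next
    case False
    have "I \<ge> 0" unfolding I_def using assms(5) by (intro Bochner_Integration.integral_nonneg) auto
    hence I: "I > 0" using False by simp
    obtain C where C: "C \<ge> 0" "\<And>x. \<bar>\<Phi> x\<bar> \<le> C * cauchy_weight x"
      using schwartz_decay[OF assms(4), of 0] by auto
    obtain B K where BK: "B \<ge> 0" "K \<ge> 0" "count_bound p (8 / 7) B K" using count_bound_8_7[OF p] by blast
    \<comment> \<open>After normalisation the large frequencies carry a factor \<open>q ^ 4\<close>.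
      Since \<open>q / (N * M)\<close> is at most \<open>q powr (- \<epsilon>)\<close>, the
      inequality \<open>\<epsilon> * A \<ge> 5\<close> leaves \<open>1 / q\<close>.\<close>
    define A where "A = nat \<lceil>5 / \<epsilon>\<rceil>"
    have A: "\<epsilon> * real A \<ge> 5"
    proof -
      have "5 / \<epsilon> \<le> real A" unfolding A_def by linarith
      thus ?thesis using assms(1) by (simp add: field_simps)
    qed
    obtain CA where CA: "CA \<ge> 0" "\<And>N \<theta>. N \<ge> 1 \<Longrightarrow> \<theta> \<noteq> 0 \<Longrightarrow> \<bar>\<theta>\<bar> \<le> 1 / 2 \<Longrightarrow> norm (sample_sum \<Phi> N \<theta>) \<le> CA * N * (1 / (N * \<bar>\<theta>\<bar>)) ^ A"
      using sample_sum_decay[OF assms(4), of A] by blast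
    define K0 where "K0 = 6 * C"
    have K0: "K0 \<ge> 0" unfolding K0_def using C(1) by simp
    have K0b: "norm (sample_sum \<Phi> N \<theta>) \<le> K0 * N" if "N \<ge> 1" for N \<theta>
      unfolding sample_sum_def K0_def by (rule weight_bounded_summable(2)[OF that]) (use C in \<open>simp add: norm_mult\<close>)
    define G where "G n = (\<Sum>\<^sub>\<infinity>x::int. \<Phi> (real_of_int x / N n))" for n
    have G: "sample_sum \<Phi> (N n) 0 = complex_of_real (G n)" for n
      unfolding G_def by (rule sample_sum_0[OF N1]) (rule C(2))
    define Z where "Z = (\<Sum>g. real g powr (- (8 / 7)))"
    have Z: "Z \<ge> 0" unfolding Z_def by (intro suminf_nonneg) (auto simp: summable_real_powr_iff)
    define H where "H = K0 ^ 3 * B * Z * p"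
    define H' where "H' = K0\<^sup>2 * CA"
    \<comment> \<open>The exponent is \<open>3/2 + 4/9 - 2 = - 1/18\<close>: exponential sums of
      size \<open>q powr (3/2)\<close>, a count of \<open>M powr (8/7)\<close>, and division by
      \<open>q\<^sup>2\<close>.\<close>
    define x where "x = real_of_int p powr (- (1 / 18))"
    have x: "0 < x" "x < 1" unfolding x_def using p1 by (auto simp: powr_less_one)
    have xn: "x ^ n = q n powr (- (1 / 18))" for n
      unfolding x_def q_def using p1 by (simp add: powr_power powr_powr flip: powr_realpow)
    have ev: "eventually (\<lambda>n. \<bar>W n * q n / N n ^ 3 - c n * (G n / N n) ^ 3\<bar> \<le> H * (real n * x ^ n) + H' * (1 / q n)) sequentially"
    proof -
      \<comment> \<open>The modulus needed for the count is about
        \<open>M powr (16/7) = q powr (8/9)\<close>; the slack \<open>q powr (1/9)\<close>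
        eventually exceeds the constant \<open>K * p\<close>.\<close>
      define y where "y = real_of_int p powr (1 / 9)"
      have y1: "y > 1" unfolding y_def using p1 by (simp add: gr_one_powr)
      obtain n0 where n0: "K * p < y ^ n0" using real_arch_pow[OF y1] by blast
      have "\<bar>W n * q n / N n ^ 3 - c n * (G n / N n) ^ 3\<bar> \<le> H * (real n * x ^ n) + H' * (1 / q n)"
        if n: "n \<ge> max n0 5" for n
      proof -
        define M where "M = q n powr (7 / 18)"
        have M0: "M > 0" unfolding M_def using q1[of n] by simp
        have qn: "q n = real_of_int p powr real n" unfolding q_def using p1 by (simp add: powr_realpow)
        have M1: "M < real_of_int (p ^ (n div 2))"
        proof -
          have "M = real_of_int p powr (7 / 18 * real n)" unfolding M_def qn by (simp add: powr_powr mult.commute)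
          \<comment> \<open>\<open>n div 2\<close> is at least \<open>(n - 1) / 2\<close>, which
            exceeds \<open>7 / 18 * n\<close> from \<open>n = 5\<close> on.\<close>
          also have "\<dots> < real_of_int p powr real (n div 2)" using p1 n by (intro powr_less_mono) linarith+
          finally show ?thesis using p1 by (simp add: powr_realpow)
        qed
        have M2: "K * M powr (2 * (8 / 7)) \<le> real_of_int (p ^ (n - 1))"
        proof -
          have "y ^ n0 \<le> y ^ n" using y1 n by (intro power_increasing) auto
          hence Ky: "K * p \<le> y ^ n" using n0 by linarith
          have yn: "y ^ n = real_of_int p powr (real n / 9)"
            unfolding y_def using p1 by (simp add: powr_powr flip: powr_realpow)
          have "K * M powr (2 * (8 / 7)) * p = (K * p) * real_of_int p powr (8 / 9 * real n)"
            unfolding M_def qn by (simp add: powr_powr mult_ac)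
          also have "\<dots> \<le> real_of_int p powr (real n / 9) * real_of_int p powr (8 / 9 * real n)"
            using Ky unfolding yn by (rule mult_right_mono) simp
          also have "\<dots> = real_of_int p powr real n" by (simp flip: powr_add)
          also have "\<dots> = real_of_int (p ^ (n - 1)) * p"
          proof -
            have "p ^ n = p ^ (n - 1) * p" using n by (metis power_minus_mult less_le_trans zero_less_numeral max.bounded_iff)
            thus ?thesis using qn unfolding q_def by (metis of_int_mult)
          qed
          finally show ?thesis using p1 by simp
        qed
        define E where "E = B * Z * real n * real_of_int (p ^ (2 * n - n div 2)) * M powr (8 / 7)"
        have E: "(\<Sum>m | m \<noteq> (0, 0, 0) \<and> real_of_int (nrm m) \<le> M. norm (expsum p (a1 n, a2 n, a3 n) n m)) \<le> E"
          unfolding E_def Z_def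
          by (rule sum_norm_expsum_le[OF p BK(3) _ BK(1,2) u]) (use n M0 M1 M2 in auto)
        have err: "\<bar>W n * q n ^ 3 - real (card (zeros p (a1 n, a2 n, a3 n) n)) * G n ^ 3\<bar>
            \<le> E * (K0 * N n) ^ 3 + q n ^ 6 * (CA * N n * (q n / (N n * M)) ^ A * (K0 * N n)\<^sup>2)"
          unfolding W_def q_def
          by (rule weighted_count_error[OF p N1 M0 C(2) K0 K0b[OF N1] CA(1) CA(2)[OF N1] G E])
        have cz: "real (card (zeros p (a1 n, a2 n, a3 n) n)) = c n * q n ^ 2"
          unfolding c_def q_def using card_zeros[OF p u] n by simp
        have Np: "N n > 0" using N1[of n] by linarith
        have qp: "q n > 0" using q1[of n] by linarith
        define D where "D = N n ^ 3 * (q n)\<^sup>2"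
        have D0: "D > 0" unfolding D_def using Np qp by simp
        have "W n * q n / N n ^ 3 - c n * (G n / N n) ^ 3 = (W n * q n ^ 3 - c n * q n ^ 2 * G n ^ 3) / D"
          unfolding D_def using Np qp by (simp add: field_simps power2_eq_square power3_eq_cube)
        hence "\<bar>W n * q n / N n ^ 3 - c n * (G n / N n) ^ 3\<bar> = \<bar>W n * q n ^ 3 - c n * q n ^ 2 * G n ^ 3\<bar> / D"
          using D0 by (simp add: abs_divide)
        also have "\<dots> \<le> (E * (K0 * N n) ^ 3 + q n ^ 6 * (CA * N n * (q n / (N n * M)) ^ A * (K0 * N n)\<^sup>2)) / D"
          using err D0 unfolding cz by (intro divide_right_mono) auto
        also have "\<dots> = K0 ^ 3 * (E / (q n)\<^sup>2) + H' * (q n ^ 4 * (q n / (N n * M)) ^ A)"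
        proof -
          have "E * (K0 * N n) ^ 3 / D = K0 ^ 3 * (E / (q n)\<^sup>2)"
            unfolding D_def using Np qp by (simp add: power_mult_distrib)
          moreover have "q n ^ 6 * (CA * N n * T * (K0 * N n)\<^sup>2) / D = H' * (q n ^ 4 * T)" for T
          proof -
            have "q n ^ 6 = q n ^ 4 * (q n)\<^sup>2" by (simp flip: power_add)
            hence "q n ^ 6 * (CA * N n * T * (K0 * N n)\<^sup>2) = (H' * (q n ^ 4 * T)) * D"
              unfolding D_def H'_def by (simp add: power_mult_distrib power3_eq_cube power2_eq_square)
            thus ?thesis using D0 by (simp only: nonzero_mult_div_cancel_right)
          qed
          ultimately show ?thesis by (simp only: add_divide_distrib)
        qed
        also have "\<dots> \<le> H * (real n * x ^ n) + H' * (1 / q n)"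
        proof (rule add_mono)
          have "real_of_int (p ^ k) = real_of_int p powr real k" for k using p1 by (simp add: powr_realpow)
          hence "real_of_int (p ^ (2 * n - n div 2)) = real_of_int p powr real (2 * n - n div 2)" .
          also have "\<dots> \<le> real_of_int p powr (1 + 3 / 2 * real n)" using p1 n by (intro powr_mono) linarith+
          also have "\<dots> = p * q n powr (3 / 2)" unfolding qn using p1 by (simp add: powr_add powr_powr mult.commute)
          finally have e1: "real_of_int (p ^ (2 * n - n div 2)) \<le> p * q n powr (3 / 2)" .
          have "E \<le> B * Z * real n * (p * q n powr (3 / 2)) * M powr (8 / 7)"
            unfolding E_def using e1 BK(1) Z by (intro mult_right_mono mult_left_mono) auto
          also have "M powr (8 / 7) = q n powr (4 / 9)" unfolding M_def by (simp add: powr_powr)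
          also have "B * Z * real n * (p * q n powr (3 / 2)) * q n powr (4 / 9)
              = (B * Z * p) * real n * (q n powr (- (1 / 18)) * q n powr 2)"
            by (simp add: mult_ac flip: powr_add)
          finally have "E / (q n)\<^sup>2 \<le> (B * Z * p) * (real n * x ^ n)"
            using qp unfolding xn by (simp add: divide_le_eq mult_ac)
          hence "K0 ^ 3 * (E / (q n)\<^sup>2) \<le> K0 ^ 3 * ((B * Z * p) * (real n * x ^ n))"
            using K0 by (intro mult_left_mono) auto
          thus "K0 ^ 3 * (E / (q n)\<^sup>2) \<le> H * (real n * x ^ n)" unfolding H_def by (simp add: mult_ac)
        next
          have "q n powr (11 / 18 + \<epsilon>) * M \<le> N n * M" using assms(10)[of n] M0 unfolding q_def by (intro mult_right_mono) auto
          hence "q n powr (1 + \<epsilon>) \<le> N n * M" unfolding M_def by (simp flip: powr_add)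
          hence "q n / (N n * M) \<le> q n / q n powr (1 + \<epsilon>)" using qp M0 Np by (intro divide_left_mono) auto
          also have "\<dots> = q n powr (- \<epsilon>)" using qp by (simp add: powr_add powr_minus field_simps)
          finally have "(q n / (N n * M)) ^ A \<le> (q n powr (- \<epsilon>)) ^ A" using qp M0 Np by (intro power_mono) auto
          also have "\<dots> = q n powr (- \<epsilon> * real A)" using qp by (simp add: powr_powr flip: powr_realpow)
          also have "\<dots> \<le> q n powr (- 5)" using q1[of n] A by (intro powr_mono) auto
          finally have "q n ^ 4 * (q n / (N n * M)) ^ A \<le> q n ^ 4 * q n powr (- 5)" using qp by (intro mult_left_mono) auto
          also have "\<dots> = 1 / q n"
          proof -
            have "q n powr (- 5) = 1 / q n ^ 5" using qp by (simp add: powr_minus_divide)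
            moreover have "q n ^ 5 = q n ^ 4 * q n" by (simp add: eval_nat_numeral)
            ultimately show ?thesis using qp by simp
          qed
          finally show "H' * (q n ^ 4 * (q n / (N n * M)) ^ A) \<le> H' * (1 / q n)"
            unfolding H'_def using CA(1) by (intro mult_left_mono) auto
        qed
        finally show ?thesis .
      qed
      thus ?thesis by (intro eventually_sequentiallyI)
    qed
    have pow_top: "filterlim (\<lambda>n. b ^ n) at_top sequentially" if "b > 1" for b :: real
      using that by (intro filterlim_at_infinity_imp_filterlim_at_top filterlim_realpow_sequentially_gt1) auto
    have qinf: "filterlim q at_top sequentially"
      using pow_top[OF p1] unfolding q_def by simp
    have Ninf: "filterlim N at_top sequentially"
    proof (rule filterlim_at_top_mono)
      show "filterlim (\<lambda>n. (real_of_int p powr (11 / 18 + \<epsilon>)) ^ n) at_top sequentially"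
        using assms(1) p1 by (intro pow_top gr_one_powr) auto
      have "(real_of_int p powr (11 / 18 + \<epsilon>)) ^ n = real_of_int (p ^ n) powr (11 / 18 + \<epsilon>)" for n
        using p1 by (simp add: powr_powr mult.commute flip: powr_realpow)
      thus "eventually (\<lambda>n. (real_of_int p powr (11 / 18 + \<epsilon>)) ^ n \<le> N n) sequentially"
        using assms(10) by simp
    qed
    have q0: "(\<lambda>n. 1 / q n) \<longlonglongrightarrow> 0" using tendsto_divide_0[OF tendsto_const filterlim_at_top_imp_at_infinity[OF qinf]] .
    have N0: "(\<lambda>n. 1 / N n) \<longlonglongrightarrow> 0" using tendsto_divide_0[OF tendsto_const filterlim_at_top_imp_at_infinity[OF Ninf]] .
    have "(\<lambda>n. real n * x ^ n) \<longlonglongrightarrow> 0" using powser_times_n_limit_0[of x] x by simp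
    hence "(\<lambda>n. H * (real n * x ^ n) + H' * (1 / q n)) \<longlonglongrightarrow> H * 0 + H' * 0" by (intro tendsto_intros q0)
    hence "(\<lambda>n. H * (real n * x ^ n) + H' * (1 / q n)) \<longlonglongrightarrow> 0" by (simp only: mult_zero_right add_0)
    with ev[folded real_norm_def] have l1: "(\<lambda>n. W n * q n / N n ^ 3 - c n * (G n / N n) ^ 3) \<longlonglongrightarrow> 0"
      by (rule Lim_null_comparison)
    obtain R where R: "R \<ge> 0" "\<And>N. N \<ge> 1 \<Longrightarrow> \<bar>(\<Sum>\<^sub>\<infinity>x::int. \<Phi> (real_of_int x / N)) / N - I\<bar> \<le> R / N"
      using riemann_sum_error[OF assms(4)] unfolding I_def by blast
    have "(\<lambda>n. R * (1 / N n)) \<longlonglongrightarrow> R * 0" by (intro tendsto_intros N0)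
    hence r0: "(\<lambda>n. R * (1 / N n)) \<longlonglongrightarrow> 0" by (simp only: mult_zero_right)
    have "norm (G n / N n - I) \<le> R * (1 / N n)" for n
      using R(2)[OF N1[of n]] unfolding G_def by simp
    hence "eventually (\<lambda>n. norm (G n / N n - I) \<le> R * (1 / N n)) sequentially" by (intro always_eventually allI)
    hence "(\<lambda>n. G n / N n - I) \<longlonglongrightarrow> 0" using r0 by (rule Lim_null_comparison)
    hence "(\<lambda>n. G n / N n) \<longlonglongrightarrow> I" by (simp add: LIM_zero_iff)
    hence "(\<lambda>n. (G n / N n) ^ 3 - I ^ 3) \<longlonglongrightarrow> I ^ 3 - I ^ 3" by (intro tendsto_intros)
    hence l2: "(\<lambda>n. \<bar>(G n / N n) ^ 3 - I ^ 3\<bar>) \<longlonglongrightarrow> 0" using tendsto_rabs_zero by simp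
    \<comment> \<open>The constants \<open>c n\<close> need not converge, so only differences are
      shown to tend to 0; this uniform lower bound then permits the division.\<close>
    define c0 where "c0 = (p - 1) / real_of_int (p\<^sup>2)"
    have c0: "c0 > 0" unfolding c0_def using p1 by simp
    have cb: "c0 \<le> c n" "c n \<le> 1" for n unfolding c0_def c_def using C_p_bounds[OF p assms(9)] by auto
    have l3: "(\<lambda>n. c n * (G n / N n) ^ 3 - c n * I ^ 3) \<longlonglongrightarrow> 0"
    proof (rule Lim_null_comparison[OF _ l2], rule always_eventually, rule allI)
      fix n
      have "\<bar>c n\<bar> * \<bar>(G n / N n) ^ 3 - I ^ 3\<bar> \<le> 1 * \<bar>(G n / N n) ^ 3 - I ^ 3\<bar>"
        using cb[of n] c0 by (intro mult_right_mono) auto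
      thus "norm (c n * (G n / N n) ^ 3 - c n * I ^ 3) \<le> \<bar>(G n / N n) ^ 3 - I ^ 3\<bar>"
        by (simp add: right_diff_distrib[symmetric] abs_mult)
    qed
    have "(\<lambda>n. (W n * q n / N n ^ 3 - c n * (G n / N n) ^ 3) + (c n * (G n / N n) ^ 3 - c n * I ^ 3)) \<longlonglongrightarrow> 0 + 0"
      by (intro tendsto_add l1 l3)
    hence "(\<lambda>n. \<bar>W n * q n / N n ^ 3 - c n * I ^ 3\<bar>) \<longlonglongrightarrow> 0" using tendsto_rabs_zero by simp
    hence "(\<lambda>n. \<bar>W n * q n / N n ^ 3 - c n * I ^ 3\<bar> * (1 / (c0 * I ^ 3))) \<longlonglongrightarrow> 0 * (1 / (c0 * I ^ 3))" by (intro tendsto_intros)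
    hence l4: "(\<lambda>n. \<bar>W n * q n / N n ^ 3 - c n * I ^ 3\<bar> * (1 / (c0 * I ^ 3))) \<longlonglongrightarrow> 0" by simp
    have "(\<lambda>n. W n / (I ^ 3 * c n * (N n ^ 3 / q n)) - 1) \<longlonglongrightarrow> 0"
    proof (rule Lim_null_comparison[OF _ l4], rule always_eventually, rule allI)
      fix n
      have cn: "c n > 0" using cb[of n] c0 by linarith
      have Np: "N n > 0" using N1[of n] by linarith
      have qp: "q n > 0" using q1[of n] by linarith
      have "W n / (I ^ 3 * c n * (N n ^ 3 / q n)) - 1 = (W n * q n / N n ^ 3 - c n * I ^ 3) * (1 / (c n * I ^ 3))"
        using cn Np qp I by (simp add: field_simps)
      moreover have "1 / (c n * I ^ 3) \<le> 1 / (c0 * I ^ 3)"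
        using cb[of n] c0 I cn by (intro divide_left_mono mult_right_mono) auto
      ultimately show "norm (W n / (I ^ 3 * c n * (N n ^ 3 / q n)) - 1)
          \<le> \<bar>W n * q n / N n ^ 3 - c n * I ^ 3\<bar> * (1 / (c0 * I ^ 3))"
        using cn I by (simp only: real_norm_def abs_mult) (intro mult_left_mono, auto)
    qed
    hence "(\<lambda>n. W n / (I ^ 3 * c n * (N n ^ 3 / q n))) \<longlonglongrightarrow> 1" by (simp add: LIM_zero_iff)
    hence "(\<lambda>n. complex_of_real (W n / (I ^ 3 * c n * (N n ^ 3 / q n)))) \<longlonglongrightarrow> complex_of_real 1" by (rule tendsto_of_real)
    hence "(\<lambda>n. complex_of_real (W n) / (fourier_transform \<Phi> 0 ^ 3 * complex_of_real (c n) * complex_of_real (N n ^ 3 / q n))) \<longlonglongrightarrow> 1"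
      unfolding fourier_transform_0 I_def[symmetric] by simp
    moreover have "eventually (\<lambda>n. complex_of_real (W n) / (fourier_transform \<Phi> 0 ^ 3 * complex_of_real (c n) * complex_of_real (N n ^ 3 / q n))
        = complex_of_real (F n) / (fourier_transform \<Phi> 0 ^ 3 * complex_of_real (c n) * complex_of_real (N n ^ 3 / q n))) sequentially"
      using FW by (intro eventually_sequentiallyI[of 1]) simp
    ultimately have "(\<lambda>n. complex_of_real (F n) / (fourier_transform \<Phi> 0 ^ 3 * complex_of_real (c n) * complex_of_real (N n ^ 3 / q n))) \<longlonglongrightarrow> 1"
      by (rule Lim_transform_eventually)
    thus ?thesis unfolding F_def c_def q_def by (rule asymp_equivI')
  qed
qed

end
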